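(* Let $\alpha=(\alpha_n)_{n\in\mathbb N}$ be a positive, strictly increasing sequence with $\alpha_n\to\infty$ such that $E_\alpha$ is not nuclear. Let $D(1)=\{\lambda\in\mathbb C:|\lambda-\frac12|<\frac12\}$, with closure $\overline{D(1)}$, and let $\mathsf C\in\mathcal L(E_\alpha)$ be the Cesàro operator. (i) If $\sup_{n\ge 3}\frac{\log(\log n)}{\alpha_n}<\infty$, then $\sigma(\mathsf C;E_\alpha)=\{0,1\}\cup D(1)$ and $\sigma^*(\mathsf C;E_\alpha)=\overline{D(1)}$. (ii) If $\sup_{n\ge 3}\frac{\log(\log n)}{\alpha_n}=\infty$, then $\sigma(\mathsf C;E_\alpha)=\overline{D(1)}=\sigma^*(\mathsf C;E_\alpha)$.
   Context: $\mathbb N=\{1,2,3,\dots\}$. For a strictly positive sequence $w$ on $\mathbb N$, $c_0(w)=\{x\in\mathbb C^{\mathbb N}: \lim_{n\to\infty} w(n)|x_n|=0\}$, a Banach space with norm $\sup_n w(n)|x_n|$. Given $\alpha$, fix a strictly increasing sequence $(s_k)_{k\in\mathbb N}\subset(1,\infty)$ with $s_k\to\infty$ and put $v_k(n):=s_k^{-\alpha_n}$. Define $E_\alpha:=\mathrm{ind}_k\, c_0(v_k)$, i.e. $E_\alpha=\bigcup_k c_0(v_k)\subseteq\mathbb C^{\mathbb N}$ endowed with the finest locally convex Hausdorff topology making all inclusions $c_0(v_k)\hookrightarrow E_\alpha$ continuous; $E_\alpha$ does not depend on the choice of $(s_k)$. It is known that $E_\alpha$ is nuclear if and only if $\sup_n\frac{\log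 n}{\alpha_n}<\infty$. The Cesàro operator is $\mathsf Cx=\left(\frac{x_1+\dots+x_n}{n}\right)_{n\in\mathbb N}$, and it belongs to $\mathcal L(E_\alpha)$ (continuous linear operators from $E_\alpha$ into itself). For a locally convex Hausdorff space $X$ and $T\in\mathcal L(X)$: $\rho(T;X)$ is the set of $\lambda\in\mathbb C$ such that $R(\lambda,T):=(\lambda I-T)^{-1}$ exists in $\mathcal L(X)$; $\sigma(T;X)=\mathbb C\setminus\rho(T;X)$; $\rho^*(T;X)$ is the set of $\lambda\in\mathbb C$ for which there is $\delta>0$ such that the open disc $B(\lambda,\delta)\subseteq\rho(T;X)$ and $\{R(\mu,T):\mu\in B(\lambda,\delta)\}$ is equicontinuous in $\mathcal L(X)$; $\sigma^*(T;X)=\mathbb C\setminus\rho^*(T;X)$. *)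

theory Defs
  imports "HOL-Analysis.Analysis" "HOL-Library.Function_Algebras"
begin

text \<open>
  A complex sequence indexed by \<open>{1, 2, 3, \<dots>}\<close> is a function \<open>x :: nat \<Rightarrow> complex\<close> with
  \<open>x 0 = 0\<close>, so that indices are the usual ones and equality of sequences is equality of functions.
  All locally convex spaces below are spaces of sequences; the carrier of the space is the
  \<open>topspace\<close> of its topology, and operators are only relevant on that carrier.
\<close>

definition smul :: "complex \<Rightarrow> (nat \<Rightarrow> complex) \<Rightarrow> nat \<Rightarrow> complex"  (infixr \<open>*\<^sub>C\<close> 75)
  where "c *\<^sub>C x = (\<lambda>n. c * x n)"

interpretation cseq: vector_space smul
  by unfold_locales (auto simp: smul_def fun_eq_iff algebra_simps)

definition linear_operator_on :: "(nat \<Rightarrow> complex) set \<Rightarrow> ((nat \<Rightarrow> complex) \<Rightarrow> nat \<Rightarrow> complex) \<Rightarrow> bool"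
  where "linear_operator_on E A \<longleftrightarrow>
    (\<forall>x\<in>E. \<forall>y\<in>E. A (x + y) = A x + A y) \<and> (\<forall>c. \<forall>x\<in>E. A (c *\<^sub>C x) = c *\<^sub>C A x)"

definition linear_functional_on :: "(nat \<Rightarrow> complex) set \<Rightarrow> ((nat \<Rightarrow> complex) \<Rightarrow> complex) \<Rightarrow> bool"
  where "linear_functional_on E f \<longleftrightarrow>
    (\<forall>x\<in>E. \<forall>y\<in>E. f (x + y) = f x + f y) \<and> (\<forall>c. \<forall>x\<in>E. f (c *\<^sub>C x) = c * f x)"

definition convex_cset :: "(nat \<Rightarrow> complex) set \<Rightarrow> bool"
  where "convex_cset V \<longleftrightarrow>
    (\<forall>x\<in>V. \<forall>y\<in>V. \<forall>t::real. 0 \<le> t \<longrightarrow> t \<le> 1 \<longrightarrow>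
       complex_of_real (1 - t) *\<^sub>C x + complex_of_real t *\<^sub>C y \<in> V)"


subsection \<open>Locally convex Hausdorff spaces\<close>

definition lc_hausdorff :: "(nat \<Rightarrow> complex) topology \<Rightarrow> bool"
  where "lc_hausdorff X \<longleftrightarrow>
    cseq.subspace (topspace X) \<and>
    continuous_map (prod_topology X X) X (\<lambda>(x, y). x + y) \<and>
    continuous_map (prod_topology euclidean X) X (\<lambda>(c, x). c *\<^sub>C x) \<and>
    (\<forall>U. openin X U \<and> 0 \<in> U \<longrightarrow> (\<exists>V. openin X V \<and> 0 \<in> V \<and> convex_cset V \<and> V \<subseteq> U)) \<and>
    Hausdorff_space X"

definition continuous_operators ::
    "(nat \<Rightarrow> complex) topology \<Rightarrow> ((nat \<Rightarrow> complex) \<Rightarrow> nat \<Rightarrow> complex) set"  (\<open>\<L>\<close>)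
  where "\<L> X = {A. linear_operator_on (topspace X) A \<and> continuous_map X X A}"

definition equicontinuous_ops ::
    "(nat \<Rightarrow> complex) topology \<Rightarrow> ((nat \<Rightarrow> complex) \<Rightarrow> nat \<Rightarrow> complex) set \<Rightarrow> bool"
  where "equicontinuous_ops X \<F> \<longleftrightarrow>
    \<F> \<subseteq> \<L> X \<and>
    (\<forall>U. openin X U \<and> 0 \<in> U \<longrightarrow> (\<exists>V. openin X V \<and> 0 \<in> V \<and> (\<forall>A\<in>\<F>. A ` V \<subseteq> U)))"


subsection \<open>Spectra\<close>

definition resolvent_op ::
    "(nat \<Rightarrow> complex) topology \<Rightarrow> ((nat \<Rightarrow> complex) \<Rightarrow> nat \<Rightarrow> complex) \<Rightarrow> complex \<Rightarrow>
     (nat \<Rightarrow> complex) \<Rightarrow> nat \<Rightarrow> complex"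
  where "resolvent_op X A z = inv_into (topspace X) (\<lambda>x. z *\<^sub>C x - A x)"

definition resolvent_set ::
    "(nat \<Rightarrow> complex) topology \<Rightarrow> ((nat \<Rightarrow> complex) \<Rightarrow> nat \<Rightarrow> complex) \<Rightarrow> complex set"
  where "resolvent_set X A =
    {z. bij_betw (\<lambda>x. z *\<^sub>C x - A x) (topspace X) (topspace X) \<and> resolvent_op X A z \<in> \<L> X}"

definition spectrum ::
    "(nat \<Rightarrow> complex) topology \<Rightarrow> ((nat \<Rightarrow> complex) \<Rightarrow> nat \<Rightarrow> complex) \<Rightarrow> complex set"
  where "spectrum X A = UNIV - resolvent_set X A"

definition resolvent_set_star ::
    "(nat \<Rightarrow> complex) topology \<Rightarrow> ((nat \<Rightarrow> complex) \<Rightarrow> nat \<Rightarrow> complex) \<Rightarrow> complex set"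
  where "resolvent_set_star X A =
    {z. \<exists>\<delta>>0. ball z \<delta> \<subseteq> resolvent_set X A \<and> equicontinuous_ops X (resolvent_op X A ` ball z \<delta>)}"

definition spectrum_star ::
    "(nat \<Rightarrow> complex) topology \<Rightarrow> ((nat \<Rightarrow> complex) \<Rightarrow> nat \<Rightarrow> complex) \<Rightarrow> complex set"
  where "spectrum_star X A = UNIV - resolvent_set_star X A"


subsection \<open>Nuclear spaces\<close>

definition continuous_seminorm :: "(nat \<Rightarrow> complex) topology \<Rightarrow> ((nat \<Rightarrow> complex) \<Rightarrow> real) \<Rightarrow> bool"
  where "continuous_seminorm X p \<longleftrightarrow>
    (\<forall>x\<in>topspace X. 0 \<le> p x) \<and>
    (\<forall>x\<in>topspace X. \<forall>y\<in>topspace X. p (x + y) \<le> p x + p y) \<and>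
    (\<forall>c. \<forall>x\<in>topspace X. p (c *\<^sub>C x) = cmod c * p x) \<and>
    continuous_map X euclideanreal p"

text \<open>
  For a seminorm \<open>p\<close> on \<open>E\<close>, the local Banach space \<open>E_p\<close> is the completion of \<open>E / ker p\<close>.
  Its elements are represented by \<open>p\<close>-Cauchy sequences in \<open>E\<close> (a constant sequence represents the
  class of an element of \<open>E\<close>), and the norm of the represented element is the limit of the
  \<open>p\<close>-values.
\<close>

definition seminorm_Cauchy ::
    "(nat \<Rightarrow> complex) set \<Rightarrow> ((nat \<Rightarrow> complex) \<Rightarrow> real) \<Rightarrow> (nat \<Rightarrow> nat \<Rightarrow> complex) \<Rightarrow> bool"
  where "seminorm_Cauchy E p u \<longleftrightarrow>
    range u \<subseteq> E \<and> (\<forall>e>0. \<exists>M. \<forall>i\<ge>M. \<forall>j\<ge>M. p (u i - u j) < e)"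

definition completion_norm ::
    "((nat \<Rightarrow> complex) \<Rightarrow> real) \<Rightarrow> (nat \<Rightarrow> nat \<Rightarrow> complex) \<Rightarrow> real"
  where "completion_norm p u = lim (\<lambda>k. p (u k))"

text \<open>
  The canonical map \<open>E_q \<rightarrow> E_p\<close> (for \<open>p \<le> q\<close>) is a nuclear operator: it is a sum
  \<open>\<Sum>n. f n \<otimes> y n\<close> with functionals \<open>f n\<close> on \<open>E_q\<close> of norm at most \<open>a n\<close> and \<open>y n\<close> in \<open>E_p\<close>
  such that \<open>\<Sum>n. a n * \<parallel>y n\<parallel>\<close> is finite. Functionals on \<open>E_q\<close> are given by their restrictions to
  the dense image of \<open>E\<close>, and for the same reason it suffices to require the representation of the
  canonical map at the elements of \<open>E\<close>.
\<close>

definition canonical_map_nuclear ::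
    "(nat \<Rightarrow> complex) set \<Rightarrow> ((nat \<Rightarrow> complex) \<Rightarrow> real) \<Rightarrow> ((nat \<Rightarrow> complex) \<Rightarrow> real) \<Rightarrow> bool"
  where "canonical_map_nuclear E q p \<longleftrightarrow>
    (\<exists>f :: nat \<Rightarrow> (nat \<Rightarrow> complex) \<Rightarrow> complex. \<exists>a :: nat \<Rightarrow> real. \<exists>y :: nat \<Rightarrow> nat \<Rightarrow> nat \<Rightarrow> complex.
       (\<forall>n. linear_functional_on E (f n) \<and> 0 \<le> a n \<and> (\<forall>x\<in>E. cmod (f n x) \<le> a n * q x)) \<and>
       (\<forall>n. seminorm_Cauchy E p (y n)) \<and>
       summable (\<lambda>n. a n * completion_norm p (y n)) \<and>
       (\<forall>x\<in>E. (\<lambda>N. completion_norm p (\<lambda>k. x - (\<Sum>n<N. f n x *\<^sub>C y n k))) \<longlonglongrightarrow> 0))"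

definition nuclear_space :: "(nat \<Rightarrow> complex) topology \<Rightarrow> bool"
  where "nuclear_space X \<longleftrightarrow>
    (\<forall>p. continuous_seminorm X p \<longrightarrow>
       (\<exists>q. continuous_seminorm X q \<and> (\<forall>x\<in>topspace X. p x \<le> q x) \<and>
            canonical_map_nuclear (topspace X) q p))"


subsection \<open>The weighted spaces $c_0(w)$ and their inductive limits\<close>

definition c0 :: "(nat \<Rightarrow> real) \<Rightarrow> (nat \<Rightarrow> complex) set"
  where "c0 w = {x. x 0 = 0 \<and> (\<lambda>n. w n * cmod (x n)) \<longlonglongrightarrow> 0}"

definition c0_norm :: "(nat \<Rightarrow> real) \<Rightarrow> (nat \<Rightarrow> complex) \<Rightarrow> real"
  where "c0_norm w x = (SUP n\<in>{1..}. w n * cmod (x n))"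

text \<open>
  The distance is cut off outside the space because the locale \<open>Metric_space\<close> asks for a
  nonnegative function on the whole type.
\<close>

definition c0_dist :: "(nat \<Rightarrow> real) \<Rightarrow> (nat \<Rightarrow> complex) \<Rightarrow> (nat \<Rightarrow> complex) \<Rightarrow> real"
  where "c0_dist w x y = (if x \<in> c0 w \<and> y \<in> c0 w then c0_norm w (x - y) else 0)"

definition c0_topology :: "(nat \<Rightarrow> real) \<Rightarrow> (nat \<Rightarrow> complex) topology"
  where "c0_topology w = Metric_space.mtopology (c0 w) (c0_dist w)"

lemma c0_bdd:
  assumes "x \<in> c0 w"
  shows "bdd_above ((\<lambda>n. w n * cmod (x n)) ` {1..})"
proof -
  have "(\<lambda>n. w n * cmod (x n)) \<longlonglongrightarrow> 0"
    using assms by (simp add: c0_def)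
  then have "bounded (range (\<lambda>n. w n * cmod (x n)))"
    by (rule convergent_imp_bounded)
  then show ?thesis
    by (meson bdd_above_mono bounded_imp_bdd_above image_mono top_greatest)
qed

lemma c0_norm_upper:
  assumes "x \<in> c0 w" "n \<ge> 1"
  shows "w n * cmod (x n) \<le> c0_norm w x"
  unfolding c0_norm_def by (rule cSUP_upper[OF _ c0_bdd[OF assms(1)]]) (use assms in auto)

lemma c0_subspace:
  assumes w: "\<And>n. n \<ge> 1 \<Longrightarrow> w n > 0"
  shows "cseq.subspace (c0 w)"
proof (rule cseq.subspaceI)
  show "0 \<in> c0 w" by (simp add: c0_def)
next
  fix x y assume xy: "x \<in> c0 w" "y \<in> c0 w"
  have "(\<lambda>n. w n * cmod (x n + y n)) \<longlonglongrightarrow> 0"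
  proof (rule tendsto_sandwich)
    show "\<forall>\<^sub>F n in sequentially. 0 \<le> w n * cmod (x n + y n)"
      using eventually_ge_at_top[of 1] by eventually_elim (use w in \<open>auto simp: less_imp_le\<close>)
    show "\<forall>\<^sub>F n in sequentially. w n * cmod (x n + y n) \<le> w n * cmod (x n) + w n * cmod (y n)"
      using eventually_ge_at_top[of 1]
    proof eventually_elim
      case (elim n)
      then show ?case using w[of n]
        by (simp flip: distrib_left add: norm_triangle_ineq)
    qed
    show "(\<lambda>n. w n * cmod (x n) + w n * cmod (y n)) \<longlonglongrightarrow> 0"
      using xy tendsto_add[of "\<lambda>n. w n * cmod (x n)" 0 _ "\<lambda>n. w n * cmod (y n)" 0]
      by (simp add: c0_def)
  qed simp
  then show "x + y \<in> c0 w" using xy by (simp add: c0_def)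
next
  fix c x assume x: "x \<in> c0 w"
  have "(\<lambda>n. cmod c * (w n * cmod (x n))) \<longlonglongrightarrow> 0"
    using x tendsto_mult_right_zero by (auto simp: c0_def)
  then show "c *\<^sub>C x \<in> c0 w"
    using x by (simp add: c0_def smul_def norm_mult mult_ac)
qed


lemma Metric_space_c0_dist:
  assumes w: "\<And>n. n \<ge> 1 \<Longrightarrow> w n > 0"
  shows "Metric_space (c0 w) (c0_dist w)"
proof
  note sub = c0_subspace[of w, OF w]
  have diff: "x - y \<in> c0 w" if "x \<in> c0 w" "y \<in> c0 w" for x y
    using cseq.subspace_diff[OF sub that] by simp
  have nonneg: "0 \<le> c0_norm w x" if "x \<in> c0 w" for x
  proof -
    have "0 \<le> w 1 * cmod (x 1)" using w[of 1] by simp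
    also have "\<dots> \<le> c0_norm w x" by (rule c0_norm_upper[OF that]) simp
    finally show ?thesis .
  qed
  fix x y
  show "0 \<le> c0_dist w x y"
    by (simp add: c0_dist_def nonneg diff)
  show "c0_dist w x y = c0_dist w y x"
    by (simp add: c0_dist_def c0_norm_def norm_minus_commute)
  show "c0_dist w x y = 0 \<longleftrightarrow> x = y" if xy: "x \<in> c0 w" "y \<in> c0 w"
  proof
    assume "c0_dist w x y = 0"
    then have 0: "c0_norm w (x - y) = 0" using xy by (simp add: c0_dist_def)
    have "x n = y n" for n
    proof (cases "n \<ge> 1")
      case True
      then have "w n * cmod ((x - y) n) \<le> 0"
        using c0_norm_upper[OF diff[OF xy] True] 0 by simp
      then show ?thesis using w[OF True] by (simp add: mult_le_0_iff)
    next
      case False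
      then have "n = 0" by simp
      then show ?thesis using xy by (simp add: c0_def)
    qed
    then show "x = y" by blast
  qed (simp add: c0_dist_def c0_norm_def)
  fix z
  show "c0_dist w x z \<le> c0_dist w x y + c0_dist w y z"
    if xyz: "x \<in> c0 w" "y \<in> c0 w" "z \<in> c0 w"
  proof -
    have "c0_norm w (x - z) \<le> c0_norm w (x - y) + c0_norm w (y - z)"
      unfolding c0_norm_def[of w "x - z"]
    proof (rule cSUP_least)
      fix n :: nat assume "n \<in> {1..}"
      then have n: "n \<ge> 1" by simp
      have "w n * cmod ((x - z) n) \<le> w n * (cmod ((x - y) n) + cmod ((y - z) n))"
        using w[OF n] norm_triangle_ineq[of "x n - y n" "y n - z n"] by simp
      also have "\<dots> \<le> c0_norm w (x - y) + c0_norm w (y - z)"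
        using c0_norm_upper[OF diff[OF xyz(1,2)] n] c0_norm_upper[OF diff[OF xyz(2,3)] n]
        by (simp add: distrib_left)
      finally show "w n * cmod ((x - z) n) \<le> c0_norm w (x - y) + c0_norm w (y - z)" .
    qed auto
    then show ?thesis using xyz by (simp add: c0_dist_def)
  qed
qed

definition compatible_lc_topology :: "(nat \<Rightarrow> nat \<Rightarrow> real) \<Rightarrow> (nat \<Rightarrow> complex) topology \<Rightarrow> bool"
  where "compatible_lc_topology v T \<longleftrightarrow>
    topspace T = (\<Union>k. c0 (v k)) \<and> lc_hausdorff T \<and>
    (\<forall>k. continuous_map (c0_topology (v k)) T (\<lambda>x. x))"

text \<open>
  The supremum of all compatible topologies; by \<open>ind_c0_finest\<close> below it is itself compatible,
  hence the finest one, as soon as the weights are positive and the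
  union of the steps is a vector space.
\<close>

definition ind_c0 :: "(nat \<Rightarrow> nat \<Rightarrow> real) \<Rightarrow> (nat \<Rightarrow> complex) topology"
  where "ind_c0 v = topology_generated_by {U. \<exists>T. compatible_lc_topology v T \<and> openin T U}"

lemma c0_topology_pointwise:
  assumes w: "\<And>n. n \<ge> 1 \<Longrightarrow> w n > 0" and E: "c0 w \<subseteq> E"
  shows "continuous_map (c0_topology w) (subtopology euclidean E) (\<lambda>x. x)"
proof -
  interpret M: Metric_space "c0 w" "c0_dist w" by (rule Metric_space_c0_dist[OF w])
  have coord: "continuous_map M.mtopology euclidean (\<lambda>x. x n)" for n
  proof (cases "n \<ge> 1")
    case False
    then have "n = 0" by simp
    have "0 = x n" if "x \<in> c0 w" for x
      using that \<open>n = 0\<close> by (simp add: c0_def)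
    moreover have "continuous_map M.mtopology euclidean (\<lambda>_. 0 :: complex)" by simp
    ultimately show ?thesis
      by (elim continuous_map_eq) simp
  next
    case n: True
    have "\<exists>d>0. \<forall>y. y \<in> c0 w \<and> c0_dist w x y < d \<longrightarrow> dist (x n) (y n) < e"
      if x: "x \<in> c0 w" and e: "e > 0" for x e
    proof (intro exI conjI allI impI)
      show "e * w n > 0" using e w[OF n] by simp
      fix y assume y: "y \<in> c0 w \<and> c0_dist w x y < e * w n"
      have "x - y \<in> c0 w" using cseq.subspace_diff[OF c0_subspace[of w, OF w]] x y by simp
      then have "w n * cmod ((x - y) n) < e * w n"
        using c0_norm_upper[of "x - y" w n] n x y by (auto simp: c0_dist_def)
      then show "dist (x n) (y n) < e" using w[OF n] by (simp add: dist_norm mult.commute)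
    qed
    then have "continuous_map M.mtopology Met_TC.mtopology (\<lambda>x. x n)"
      by (subst M.metric_continuous_map[OF Met_TC.Metric_space_axioms]) auto
    then show ?thesis by simp
  qed
  have "continuous_map M.mtopology euclidean (\<lambda>x. x)"
    unfolding euclidean_product_topology[symmetric] continuous_map_componentwise_UNIV
    using coord by blast
  then show ?thesis
    using E by (auto simp: c0_topology_def continuous_map_in_subtopology)
qed

lemma lc_hausdorff_pointwise:
  assumes E: "cseq.subspace E"
  shows "lc_hausdorff (subtopology euclidean E)"
proof -
  let ?X = "subtopology (euclidean :: (nat \<Rightarrow> complex) topology) E"
  have add: "continuous_map (prod_topology ?X ?X) ?X (\<lambda>(x, y). x + y)"
  proof -
    have "continuous_on (E \<times> E) (\<lambda>z::(nat \<Rightarrow> complex) \<times> (nat \<Rightarrow> complex). fst z + snd z)"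
    proof (rule continuous_on_coordinatewise_then_product)
      fix i
      have "continuous_on (E \<times> E) (\<lambda>z::(nat \<Rightarrow> complex) \<times> (nat \<Rightarrow> complex). fst z i)"
        by (rule continuous_on_product_then_coordinatewise[OF continuous_on_fst[OF continuous_on_id]])
      moreover have "continuous_on (E \<times> E) (\<lambda>z::(nat \<Rightarrow> complex) \<times> (nat \<Rightarrow> complex). snd z i)"
        by (rule continuous_on_product_then_coordinatewise[OF continuous_on_snd[OF continuous_on_id]])
      ultimately show "continuous_on (E \<times> E) (\<lambda>z. (fst z + snd z) i)"
        by (simp add: continuous_on_add)
    qed
    moreover have "prod_topology ?X ?X = subtopology euclidean (E \<times> E)"
      using subtopology_Times[of euclidean euclidean E E] by simp
    ultimately show ?thesis
      using E by (auto simp: continuous_map_in_subtopology case_prod_beta cseq.subspace_add)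
  qed
  have mult: "continuous_map (prod_topology euclidean ?X) ?X (\<lambda>(c, x). c *\<^sub>C x)"
  proof -
    have "continuous_on (UNIV \<times> E) (\<lambda>z::complex \<times> (nat \<Rightarrow> complex). fst z *\<^sub>C snd z)"
    proof (rule continuous_on_coordinatewise_then_product)
      fix i
      have "continuous_on (UNIV \<times> E) (\<lambda>z::complex \<times> (nat \<Rightarrow> complex). snd z i)"
        by (rule continuous_on_product_then_coordinatewise[OF continuous_on_snd[OF continuous_on_id]])
      then show "continuous_on (UNIV \<times> E) (\<lambda>z. (fst z *\<^sub>C snd z) i)"
        by (auto simp: smul_def intro!: continuous_intros)
    qed
    moreover have "prod_topology (euclidean :: complex topology) ?X = subtopology euclidean (UNIV \<times> E)"
      using subtopology_Times[of euclidean euclidean UNIV E, symmetric] by simp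
    ultimately show ?thesis
      using E by (auto simp: continuous_map_in_subtopology case_prod_beta cseq.subspace_scale)
  qed
  have conv: "\<exists>V. openin ?X V \<and> 0 \<in> V \<and> convex_cset V \<and> V \<subseteq> U" if U: "openin ?X U" "0 \<in> U" for U
  proof -
    obtain W where W: "open W" "U = W \<inter> E" using U(1) by (auto simp: openin_subtopology)
    have "openin (product_topology (\<lambda>i::nat. euclidean) UNIV) W" "0 \<in> W"
      using W U by (auto simp: euclidean_product_topology)
    then obtain B where B: "finite {i. B i \<noteq> topspace (euclidean :: complex topology)}"
        "\<And>i. open (B i)" "0 \<in> PiE UNIV B" "PiE UNIV B \<subseteq> W"
      using product_topology_open_contains_basis[of "\<lambda>i::nat. euclidean :: complex topology" UNIV W 0]
      by auto
    have "\<exists>e>0. ball 0 e \<subseteq> B i" for i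
      using B(2)[of i] B(3) by (auto simp: open_contains_ball PiE_def Pi_def)
    then obtain e where e: "\<And>i. e i > 0" "\<And>i. ball 0 (e i) \<subseteq> B i" by metis
    define C where "C i = (if B i = UNIV then UNIV else ball 0 (e i) :: complex set)" for i
    have C: "open (C i)" "convex (C i)" "0 \<in> C i" "C i \<subseteq> B i" for i
      using e[of i] by (auto simp: C_def)
    have "openin (product_topology (\<lambda>i::nat. euclidean) UNIV) (PiE UNIV C)"
    proof (rule product_topology_basis)
      show "finite {i. C i \<noteq> topspace euclidean}"
        by (rule finite_subset[OF _ B(1)]) (auto simp: C_def)
    qed (use C in auto)
    then have "openin ?X (PiE UNIV C \<inter> E)"
      by (auto simp: euclidean_product_topology openin_subtopology)
    moreover have "0 \<in> PiE UNIV C \<inter> E" using C E cseq.subspace_0 by auto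
    moreover have "PiE UNIV C \<inter> E \<subseteq> U" using B(4) C(4) W(2) by fastforce
    moreover have "convex_cset (PiE UNIV C \<inter> E)"
      unfolding convex_cset_def
    proof (intro ballI allI impI)
      fix x y and t :: real
      assume xy: "x \<in> PiE UNIV C \<inter> E" "y \<in> PiE UNIV C \<inter> E" and t: "0 \<le> t" "t \<le> 1"
      have "(complex_of_real (1 - t) *\<^sub>C x + complex_of_real t *\<^sub>C y) i \<in> C i" for i
      proof -
        have "(1 - t) *\<^sub>R x i + t *\<^sub>R y i \<in> C i"
          using C(2)[of i] xy t by (intro convexD) auto
        then show ?thesis by (simp add: smul_def scaleR_conv_of_real)
      qed
      moreover have "complex_of_real (1 - t) *\<^sub>C x + complex_of_real t *\<^sub>C y \<in> E"
        using xy E by (intro cseq.subspace_add cseq.subspace_scale) auto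
      ultimately show "complex_of_real (1 - t) *\<^sub>C x + complex_of_real t *\<^sub>C y \<in> PiE UNIV C \<inter> E"
        by auto
    qed
    ultimately show ?thesis by blast
  qed
  have "Hausdorff_space (euclidean :: (nat \<Rightarrow> complex) topology)"
    by simp
  then have "Hausdorff_space ?X" by (rule Hausdorff_space_subtopology)
  with add mult conv E show ?thesis
    by (auto simp: lc_hausdorff_def)
qed

lemma ind_c0_finest:
  assumes pos: "\<And>k n. n \<ge> 1 \<Longrightarrow> v k n > 0"
    and sub: "cseq.subspace (\<Union>k. c0 (v k))"
  shows "compatible_lc_topology v (ind_c0 v)"
    and "compatible_lc_topology v T \<Longrightarrow> openin T U \<Longrightarrow> openin (ind_c0 v) U"
proof -
  define E where "E = (\<Union>k. c0 (v k))"
  let ?G = "ind_c0 v"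
  have finer: "openin ?G U" if "compatible_lc_topology v T" "openin T U" for T U
    unfolding ind_c0_def by (rule topology_generated_by_Basis) (use that in blast)
  then show "compatible_lc_topology v T \<Longrightarrow> openin T U \<Longrightarrow> openin ?G U" .
  have comp: "compatible_lc_topology v (subtopology euclidean E)"
    using lc_hausdorff_pointwise[OF sub] c0_topology_pointwise[of "v _" E] pos
    by (auto simp: compatible_lc_topology_def E_def)
  have top: "topspace ?G = E"
  proof
    show "topspace ?G \<subseteq> E"
      unfolding ind_c0_def topology_generated_by_topspace
      by (fastforce simp: compatible_lc_topology_def E_def dest: openin_subset)
    show "E \<subseteq> topspace ?G"
      using finer[OF comp, of E] openin_subset by auto
  qed
  have idc: "continuous_map ?G T (\<lambda>x. x)" if "compatible_lc_topology v T" for T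
    unfolding continuous_map_alt
  proof (intro conjI allI impI)
    fix U assume U: "openin T U"
    then have "(\<lambda>x. x) -` U \<inter> topspace ?G = U"
      using that openin_subset[OF U] top by (auto simp: compatible_lc_topology_def E_def)
    then show "openin ?G ((\<lambda>x. x) -` U \<inter> topspace ?G)" using finer[OF that U] by simp
  qed (use that top in \<open>auto simp: compatible_lc_topology_def E_def\<close>)
  have into: "continuous_map Y ?G f"
    if "\<And>T. compatible_lc_topology v T \<Longrightarrow> continuous_map Y T f" for Y and f :: "'b \<Rightarrow> _"
    unfolding ind_c0_def continuous_on_generated_topo_iff
  proof (intro conjI allI impI)
    fix U assume "U \<in> {U. \<exists>T. compatible_lc_topology v T \<and> openin T U}"
    then obtain T where "compatible_lc_topology v T" "openin T U" by blast
    then show "openin Y (f -` U \<inter> topspace Y)"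
      using that[of T] by (auto simp: continuous_map_alt)
  next
    have "f ` topspace Y \<subseteq> E"
      using that[OF comp] continuous_map_image_subset_topspace by fastforce
    then show "f ` topspace Y \<subseteq> \<Union> {U. \<exists>T. compatible_lc_topology v T \<and> openin T U}"
      using top unfolding ind_c0_def topology_generated_by_topspace by simp
  qed
  have add: "continuous_map (prod_topology ?G ?G) ?G (\<lambda>(x, y). x + y)"
  proof (rule into)
    fix T assume T: "compatible_lc_topology v T"
    then have "continuous_map (prod_topology T T) T (\<lambda>(x, y). x + y)"
      by (simp add: compatible_lc_topology_def lc_hausdorff_def)
    moreover have "continuous_map (prod_topology ?G ?G) (prod_topology T T) (\<lambda>z. (fst z, snd z))"
      using continuous_map_compose[OF continuous_map_fst idc[OF T]] continuous_map_compose[OF continuous_map_snd idc[OF T]]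
      unfolding o_def by (rule continuous_map_pairedI)
    ultimately have "continuous_map (prod_topology ?G ?G) T ((\<lambda>(x, y). x + y) \<circ> (\<lambda>z. (fst z, snd z)))"
      using continuous_map_compose by blast
    then show "continuous_map (prod_topology ?G ?G) T (\<lambda>(x, y). x + y)"
      by (simp add: o_def)
  qed
  have mult: "continuous_map (prod_topology euclidean ?G) ?G (\<lambda>(c, x). c *\<^sub>C x)"
  proof (rule into)
    fix T assume T: "compatible_lc_topology v T"
    then have "continuous_map (prod_topology euclidean T) T (\<lambda>(c, x). c *\<^sub>C x)"
      by (simp add: compatible_lc_topology_def lc_hausdorff_def)
    moreover have "continuous_map (prod_topology euclidean ?G) (prod_topology euclidean T) (\<lambda>z. (fst z, snd z))"
      using continuous_map_fst continuous_map_compose[OF continuous_map_snd idc[OF T]]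
      unfolding o_def by (rule continuous_map_pairedI)
    ultimately have "continuous_map (prod_topology euclidean ?G) T ((\<lambda>(c, x). c *\<^sub>C x) \<circ> (\<lambda>z. (fst z, snd z)))"
      using continuous_map_compose by blast
    then show "continuous_map (prod_topology euclidean ?G) T (\<lambda>(c, x). c *\<^sub>C x)"
      by (simp add: o_def)
  qed
  have conv: "\<exists>V. openin ?G V \<and> 0 \<in> V \<and> convex_cset V \<and> V \<subseteq> U"
    if U: "openin ?G U" "0 \<in> U" for U
  proof -
    have "generate_topology_on {U. \<exists>T. compatible_lc_topology v T \<and> openin T U} U"
      using U(1) unfolding ind_c0_def openin_topology_generated_by_iff .
    then show ?thesis using U(2)
    proof induction
      case (Int a b)
      have "0 \<in> a" "0 \<in> b" using IntD1[OF Int.prems] IntD2[OF Int.prems] .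
      from Int.IH(1)[OF this(1)] obtain V where
        V: "openin ?G V" "0 \<in> V" "convex_cset V" "V \<subseteq> a" by blast
      from Int.IH(2)[OF \<open>0 \<in> b\<close>] obtain W where
        W: "openin ?G W" "0 \<in> W" "convex_cset W" "W \<subseteq> b" by blast
      have "openin ?G (V \<inter> W)" "0 \<in> V \<inter> W" "convex_cset (V \<inter> W)" "V \<inter> W \<subseteq> a \<inter> b"
        subgoal using V(1) W(1) by (rule openin_Int)
        subgoal using V(2) W(2) by (rule IntI)
        subgoal using V(3) W(3) by (simp add: convex_cset_def)
        subgoal using V(4) W(4) by (rule Int_mono)
        done
      then show ?case by blast
    next
      case (UN K)
      from UN.prems obtain k where k: "k \<in> K" "0 \<in> k" by (rule UnionE)
      from UN.IH[OF k] obtain V where "openin ?G V" "0 \<in> V" "convex_cset V" "V \<subseteq> k"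
        by (elim exE conjE)
      moreover from this(4) k(1) have "V \<subseteq> \<Union>K" by (rule order_trans[OF _ Union_upper])
      ultimately show ?case by (intro exI conjI)
    next
      case (Basis U)
      then obtain T where T: "compatible_lc_topology v T" "openin T U" by blast
      have "\<exists>V. openin T V \<and> 0 \<in> V \<and> convex_cset V \<and> V \<subseteq> U"
        using T Basis(2) unfolding compatible_lc_topology_def lc_hausdorff_def by blast
      then show ?case using finer[OF T(1)] by blast
    next
      case Empty
      then show ?case by (elim emptyE)
    qed
  qed
  have "Hausdorff_space ?G"
    unfolding Hausdorff_space_def
  proof (intro allI impI)
    fix x y assume xy: "x \<in> topspace ?G \<and> y \<in> topspace ?G \<and> x \<noteq> y"
    have "Hausdorff_space (subtopology euclidean E)"
      using comp unfolding compatible_lc_topology_def lc_hausdorff_def by blast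
    then have "\<exists>U V. openin (subtopology euclidean E) U \<and> openin (subtopology euclidean E) V \<and>
        x \<in> U \<and> y \<in> V \<and> disjnt U V"
      unfolding Hausdorff_space_def by (elim allE impE) (use xy top in simp)
    then obtain U V where "openin (subtopology euclidean E) U"
        "openin (subtopology euclidean E) V" "x \<in> U" "y \<in> V" "disjnt U V"
      by (elim exE conjE)
    then show "\<exists>U V. openin ?G U \<and> openin ?G V \<and> x \<in> U \<and> y \<in> V \<and> disjnt U V"
      using finer[OF comp] by (intro exI conjI)
  qed
  then have "lc_hausdorff ?G"
    using add mult conv sub unfolding lc_hausdorff_def top E_def by blast
  moreover have "continuous_map (c0_topology (v k)) ?G (\<lambda>x. x)" for k
    by (rule into) (simp add: compatible_lc_topology_def)
  ultimately show "compatible_lc_topology v ?G"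
    using top by (simp add: compatible_lc_topology_def E_def)
qed

definition E_space :: "(nat \<Rightarrow> real) \<Rightarrow> (nat \<Rightarrow> real) \<Rightarrow> (nat \<Rightarrow> complex) topology"
  where "E_space s \<alpha> = ind_c0 (\<lambda>k n. s k powr (- \<alpha> n))"

lemma E_space_finest:
  assumes "\<And>n. n \<ge> 1 \<Longrightarrow> 0 < \<alpha> n" "\<And>k. 1 < s k" "strict_mono s"
  shows "compatible_lc_topology (\<lambda>k n. s k powr (- \<alpha> n)) (E_space s \<alpha>)"
    and "compatible_lc_topology (\<lambda>k n. s k powr (- \<alpha> n)) T \<Longrightarrow> openin T U \<Longrightarrow> openin (E_space s \<alpha>) U"
proof -
  let ?v = "\<lambda>k n. s k powr (- \<alpha> n)"
  have s_pos: "0 < s k" for k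
    using assms(2)[of k] by simp
  have pos: "?v k n > 0" for k n
    using s_pos[of k] by simp
  have mono: "c0 (?v j) \<subseteq> c0 (?v k)" if "j \<le> k" for j k
  proof
    fix x assume x: "x \<in> c0 (?v j)"
    have "(\<lambda>n. ?v k n * cmod (x n)) \<longlonglongrightarrow> 0"
    proof (rule tendsto_sandwich[of "\<lambda>_. 0"])
      show "\<forall>\<^sub>F n in sequentially. ?v k n * cmod (x n) \<le> ?v j n * cmod (x n)"
        using eventually_ge_at_top[of 1]
      proof eventually_elim
        case (elim n)
        have "s j \<le> s k" using assms(3) that by (simp add: strict_mono_less_eq)
        then have "?v k n \<le> ?v j n"
          using assms(1)[OF elim] s_pos[of j] by (intro powr_mono2') auto
        then show ?case by (simp add: mult_right_mono)
      qed
      show "(\<lambda>n. ?v j n * cmod (x n)) \<longlonglongrightarrow> 0" using x by (simp add: c0_def)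
    qed auto
    then show "x \<in> c0 (?v k)" using x by (simp add: c0_def)
  qed
  have sub: "cseq.subspace (c0 (?v k))" for k
    by (rule c0_subspace) (rule pos)
  have "cseq.subspace (\<Union>k. c0 (?v k))"
  proof (rule cseq.subspaceI)
    show "0 \<in> (\<Union>k. c0 (?v k))" using cseq.subspace_0[OF sub] by blast
  next
    fix x y assume "x \<in> (\<Union>k. c0 (?v k))" "y \<in> (\<Union>k. c0 (?v k))"
    then obtain i j where "x \<in> c0 (?v i)" "y \<in> c0 (?v j)" by blast
    then have "x \<in> c0 (?v (max i j))" "y \<in> c0 (?v (max i j))"
      using mono[of i "max i j"] mono[of j "max i j"] by auto
    then show "x + y \<in> (\<Union>k. c0 (?v k))" using cseq.subspace_add[OF sub] by blast
  next
    fix c x assume "x \<in> (\<Union>k. c0 (?v k))"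
    then show "c *\<^sub>C x \<in> (\<Union>k. c0 (?v k))" using cseq.subspace_scale[OF sub] by blast
  qed
  from ind_c0_finest[of ?v, OF pos this]
  show "compatible_lc_topology ?v (E_space s \<alpha>)"
    and "compatible_lc_topology ?v T \<Longrightarrow> openin T U \<Longrightarrow> openin (E_space s \<alpha>) U"
    by (simp_all add: E_space_def)
qed

text \<open>At the index \<open>0\<close> this is \<open>0 / 0 = 0\<close>, in accordance with the convention \<open>x 0 = 0\<close>.\<close>

definition cesaro :: "(nat \<Rightarrow> complex) \<Rightarrow> nat \<Rightarrow> complex"
  where "cesaro x = (\<lambda>n. (\<Sum>i = 1..n. x i) / of_nat n)"

end

theory Submission
  imports Defs
begin

text \<open>
  Put \<open>z = 1 / \<lambda>\<close> and let \<open>S n\<close> be the partial sums of \<open>x\<close>. The equation \<open>\<lambda> x - C x = y\<close> is the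
  first-order recurrence \<open>(n - z) S n = n (S (n - 1) + z y n)\<close> together with
  \<open>x n = z (y n + S n / n)\<close>. Hence, apart from the contribution of \<open>y\<close>, the moduli of
  the averages \<open>S n / n\<close> are multiplied in each step by \<open>(n - 1) / \<bar>n - z\<bar>\<close>, and what happens
  depends on how \<open>Re z\<close> compares with \<open>1\<close>. The open disc \<open>D(1)\<close> is \<open>Re z > 1\<close>, and the points other
  than \<open>0\<close> of its boundary are \<open>Re z = 1\<close>.

  If \<open>Re z < 1\<close>, then \<open>\<bar>x n\<bar>\<close> is at most a constant times the largest \<open>\<bar>y m\<bar>\<close> with \<open>m \<le> n\<close>, and the
  constant is a continuous function of \<open>\<lambda>\<close> (\<open>cesaro_resolvent_bound_outside\<close>). The weights are
  monotone, so the resolvent maps every step of \<open>E\<close> into itself with locally uniform bounds, which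
  puts \<open>\<lambda>\<close> into \<open>\<rho>*\<close>.

  If \<open>Re z = 1\<close> and \<open>z \<noteq> 1\<close>, the averages can accumulate a factor \<open>log n\<close>, and no more
  (\<open>cesaro_resolvent_bound_circle\<close>). This factor is absorbed by a later step exactly when
  \<open>log log n = O(\<alpha> n)\<close>. Otherwise a bounded \<open>y\<close> whose phases follow those of \<open>S\<close> makes the factor
  appear (\<open>cesaro_equation_growth_circle\<close>), and the solution leaves \<open>E\<close>.

  If \<open>z\<close> is a positive integer \<open>m\<close>, the diagonal entry \<open>\<lambda> - 1 / m\<close> vanishes and the \<open>m\<close>-th unit
  vector has no preimage at all. If \<open>Re z > 1\<close> otherwise, the preimage of the first unit vector grows
  at least like a power of \<open>n\<close> (\<open>cesaro_equation_growth_inside\<close>). For \<open>\<lambda> = 0\<close> an alternating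
  sequence has a preimage of linear growth. A sequence of power growth lies in \<open>E\<close> only if
  \<open>log n = O(\<alpha> n)\<close>, and this would make \<open>E\<close> nuclear (\<open>nuclear_if_log_bounded\<close>).

  Two facts connect these estimates with the topology. The neighbourhoods of zero in \<open>E\<close> are
  generated by the absolutely convex sets that contain a ball of every step (\<open>openin_E\<close>), so a
  family of operators that is uniformly bounded from each step into some other step is
  equicontinuous. Moreover \<open>\<rho>*\<close> is open and contained in \<open>\<rho>\<close>, so that \<open>\<sigma>*\<close> contains the closure of
  the disc in both cases.
\<close>

section \<open>The Cesaro equation in terms of partial sums\<close>

definition partial_sum :: "(nat \<Rightarrow> complex) \<Rightarrow> nat \<Rightarrow> complex"
  where "partial_sum x n = (\<Sum>i = 1..n. x i)"

lemma partial_sum_0 [simp]: "partial_sum x 0 = 0"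
  by (simp add: partial_sum_def)

lemma partial_sum_Suc: "partial_sum x (Suc n) = partial_sum x n + x (Suc n)"
  by (simp add: partial_sum_def)

lemma cesaro_equation_iff:
  "l *\<^sub>C x - cesaro x = y \<longleftrightarrow> (\<forall>n. l * x n - partial_sum x n / of_nat n = y n)"
  by (auto simp: fun_eq_iff smul_def cesaro_def partial_sum_def)

lemma cesaro_equation_value:
  assumes "l \<noteq> 0" and "l *\<^sub>C x - cesaro x = y"
  shows "x n = (y n + partial_sum x n / of_nat n) / l"
proof -
  have "l * x n - partial_sum x n / of_nat n = y n"
    using assms(2) by (simp add: cesaro_equation_iff)
  then have "l * x n = y n + partial_sum x n / of_nat n"
    by (simp add: algebra_simps)
  then show ?thesis using assms(1) by (metis nonzero_mult_div_cancel_left)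
qed

text \<open>
  The recurrence for the partial sums that replaces the equation: \<open>x (n + 1)\<close> is the difference of
  two partial sums, so \<open>x\<close> can be eliminated. All estimates below are estimates of \<open>S n\<close>.
\<close>

lemma cesaro_equation_recurrence:
  assumes "l \<noteq> 0" and "l *\<^sub>C x - cesaro x = y"
  shows "(of_nat (Suc n) - 1 / l) * partial_sum x (Suc n) =
         of_nat (Suc n) * (partial_sum x n + y (Suc n) / l)"
proof -
  let ?N = "of_nat (Suc n) :: complex" and ?S = "partial_sum x (Suc n)"
  have N: "?N \<noteq> 0" using of_nat_neq_0 by blast
  have "x (Suc n) = (y (Suc n) + ?S / ?N) / l"
    by (rule cesaro_equation_value[OF assms])
  then have "?S = partial_sum x n + (y (Suc n) + ?S / ?N) / l"
    using partial_sum_Suc[of x n] by simp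
  then have "?N * ?S = ?N * (partial_sum x n + (y (Suc n) + ?S / ?N) / l)" by simp
  also have "\<dots> = ?N * (partial_sum x n + y (Suc n) / l) + ?S / l"
    using N assms(1) by (simp add: field_simps del: of_nat_Suc)
  finally show ?thesis by (simp add: algebra_simps del: of_nat_Suc)
qed

lemma cesaro_equation_solvable:
  assumes l: "l \<noteq> 0" "\<And>n. n \<ge> 1 \<Longrightarrow> 1 / l \<noteq> of_nat n" and y: "y 0 = 0"
  shows "\<exists>x. x 0 = 0 \<and> l *\<^sub>C x - cesaro x = y"
proof -
  define S where "S = rec_nat 0 (\<lambda>n t. of_nat (Suc n) * (t + y (Suc n) / l) / (of_nat (Suc n) - 1 / l))"
  define x where "x n = (y n + S n / of_nat n) / l" for n
  have S0: "S 0 = 0" by (simp add: S_def)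
  have SS: "(of_nat (Suc n) - 1 / l) * S (Suc n) = of_nat (Suc n) * (S n + y (Suc n) / l)" for n
    using l(2)[of "Suc n"] by (simp add: S_def del: of_nat_Suc)
  have "partial_sum x n = S n" for n
  proof (induction n)
    case (Suc n)
    have "S (Suc n) = S n + x (Suc n)"
    proof -
      have N: "(of_nat (Suc n) :: complex) \<noteq> 0" using of_nat_neq_0 by blast
      have "of_nat (Suc n) * S (Suc n) = of_nat (Suc n) * (S n + x (Suc n))"
        using SS[of n] N l(1) unfolding x_def by (simp add: field_simps del: of_nat_Suc)
      then show ?thesis using N by (simp del: of_nat_Suc)
    qed
    then show ?case using Suc by (simp add: partial_sum_Suc)
  qed (simp add: S0)
  then have "l *\<^sub>C x - cesaro x = y"
    unfolding cesaro_equation_iff using l(1) by (simp add: x_def)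
  moreover have "x 0 = 0" by (simp add: x_def y)
  ultimately show ?thesis by blast
qed

text \<open>
  The bound \<open>\<bar>S n\<bar> \<le> K n g n\<close> reproduces itself: since \<open>\<bar>n - z\<bar> \<ge> n - Re z\<close>, the recurrence preserves
  it as soon as \<open>K (n - 1) + \<bar>z\<bar> \<le> K (n - Re z)\<close>, that is \<open>\<bar>z\<bar> \<le> K (1 - Re z)\<close>. This is where
  \<open>Re z < 1\<close> enters, and it gives a constant that is continuous in \<open>\<lambda>\<close>.
\<close>

lemma cesaro_resolvent_bound_outside:
  assumes l: "l \<noteq> 0" "Re (1 / l) < 1" and eq: "l *\<^sub>C x - cesaro x = y"
    and mono: "\<And>m n. 1 \<le> m \<Longrightarrow> m \<le> n \<Longrightarrow> g m \<le> g n"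
    and y: "\<And>n. n \<ge> 1 \<Longrightarrow> cmod (y n) \<le> g n" and n: "n \<ge> 1"
  shows "cmod (x n) \<le> cmod (1 / l) * (1 + cmod (1 / l) / (1 - Re (1 / l))) * g n"
proof -
  define z where "z = 1 / l"
  define K where "K = cmod z / (1 - Re z)"
  have K: "cmod z = K * (1 - Re z)" "K \<ge> 0" using l(2) by (simp_all add: K_def z_def)
  have g: "0 \<le> g m" if "m \<ge> 1" for m using y[OF that] norm_ge_zero order_trans by blast
  have S: "cmod (partial_sum x m) \<le> K * (of_nat m * g m)" if "m \<ge> 1" for m
  proof -
    have "cmod (partial_sum x m) \<le> K * (of_nat m * g (max m 1))"
    proof (induction m)
      case (Suc m)
      let ?G = "g (Suc m)"
      have G: "0 \<le> ?G" "cmod (y (Suc m)) \<le> ?G" using g y by auto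
      have "cmod (partial_sum x m) \<le> K * (of_nat m * ?G)"
        using Suc mono[of "max m 1" "Suc m"] K(2)
        by (smt (verit) mult_left_mono of_nat_0_le_iff max.cobounded2 max.bounded_iff le_SucI le_refl not_less_eq_eq zero_le One_nat_def Suc_le_mono)
      moreover have "cmod (y (Suc m) / l) \<le> K * (1 - Re z) * ?G"
        using mult_left_mono[OF G(2), of "cmod z"] unfolding K(1)[symmetric]
        by (simp add: z_def norm_divide)
      ultimately have "cmod (partial_sum x m + y (Suc m) / l) \<le> K * (of_nat m * ?G) + K * (1 - Re z) * ?G"
        by (rule order_trans[OF norm_triangle_ineq add_mono])
      also have "\<dots> = K * ?G * (of_nat (Suc m) - Re z)" by (simp add: algebra_simps)
      finally have b: "cmod (partial_sum x m + y (Suc m) / l) \<le> K * ?G * (of_nat (Suc m) - Re z)" .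
      have pos: "0 < of_nat (Suc m) - Re z" using l(2) by (simp add: z_def)
      have "(of_nat (Suc m) - Re z) * cmod (partial_sum x (Suc m)) \<le>
          cmod (of_nat (Suc m) - z) * cmod (partial_sum x (Suc m))"
        using complex_Re_le_cmod[of "of_nat (Suc m) - z"] by (intro mult_right_mono) auto
      also have "\<dots> = of_nat (Suc m) * cmod (partial_sum x m + y (Suc m) / l)"
        using arg_cong[OF cesaro_equation_recurrence[OF l(1) eq, of m], of cmod]
        by (simp add: norm_mult z_def del: of_nat_Suc)
      also have "\<dots> \<le> of_nat (Suc m) * (K * ?G * (of_nat (Suc m) - Re z))"
        using b by (intro mult_left_mono) auto
      finally have "(of_nat (Suc m) - Re z) * cmod (partial_sum x (Suc m)) \<le>
         (of_nat (Suc m) - Re z) * (K * (of_nat (Suc m) * ?G))"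
        by (simp add: mult_ac del: of_nat_Suc)
      then show ?case using pos by (simp del: of_nat_Suc)
    qed simp
    then show ?thesis using that by (simp add: max_def)
  qed
  have "cmod (partial_sum x n / of_nat n) \<le> K * g n"
    using S[OF n] n by (simp add: norm_divide divide_simps mult_ac)
  then have "cmod (y n + partial_sum x n / of_nat n) \<le> g n + K * g n"
    using y[OF n] by (rule_tac order_trans[OF norm_triangle_ineq]) simp
  then have "cmod z * cmod (y n + partial_sum x n / of_nat n) \<le> cmod z * (g n + K * g n)"
    by (intro mult_left_mono) auto
  moreover have "cmod (x n) = cmod z * cmod (y n + partial_sum x n / of_nat n)"
    using cesaro_equation_value[OF l(1) eq, of n] by (simp add: z_def norm_divide)
  ultimately show ?thesis by (simp add: K_def z_def algebra_simps)
qed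

text \<open>
  Now \<open>\<bar>n - z\<bar> \<ge> n - 1\<close>, so the averages \<open>S n / n\<close> increase by at most \<open>\<bar>z\<bar> g n / (n - 1)\<close> in each step.
  These increments add up to a logarithm.
\<close>

lemma cesaro_resolvent_bound_circle:
  assumes l: "l \<noteq> 0" "Re (1 / l) = 1" "l \<noteq> 1" and eq: "l *\<^sub>C x - cesaro x = y"
    and mono: "\<And>m n. 1 \<le> m \<Longrightarrow> m \<le> n \<Longrightarrow> g m \<le> g n"
    and y: "\<And>n. n \<ge> 1 \<Longrightarrow> cmod (y n) \<le> g n" and n: "n \<ge> 1"
  shows "cmod (x n) \<le> cmod (1 / l) * (1 + cmod (1 / l) * (1 / cmod (1 - 1 / l) + 2 * ln (real n))) * g n"
proof -
  define z where "z = 1 / l"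
  define c where "c = 1 / cmod (1 - z)"
  have z1: "z \<noteq> 1" using l by (auto simp: z_def)
  have g: "0 \<le> g m" if "m \<ge> 1" for m using y[OF that] norm_ge_zero order_trans by blast
  note rec = arg_cong[OF cesaro_equation_recurrence[OF l(1) eq], of cmod, folded z_def, unfolded norm_mult]
  have S: "cmod (partial_sum x (Suc m)) / real (Suc m) \<le> cmod z * (c + 2 * ln (real (Suc m))) * g (Suc m)" for m
  proof (induction m)
    case 0
    have "cmod (1 - z) * cmod (partial_sum x (Suc 0)) = cmod (y 1 / l)"
      using rec[of 0] by simp
    also have "\<dots> \<le> cmod z * g 1"
      using y[of 1] mult_left_mono[of "cmod (y 1)" "g 1" "cmod z"] by (simp add: z_def norm_divide)
    finally show ?case using z1 by (simp add: c_def field_simps)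
  next
    case (Suc m)
    let ?M = "real (Suc m)" and ?G = "g (Suc (Suc m))"
    have G: "0 \<le> ?G" "cmod (y (Suc (Suc m))) \<le> ?G" "g (Suc m) \<le> ?G" using g y mono by auto
    have c0: "0 \<le> cmod z * (c + 2 * ln ?M)" by (simp add: c_def)
    have "cmod (partial_sum x (Suc m)) \<le> ?M * (cmod z * (c + 2 * ln ?M) * g (Suc m))"
      using Suc by (simp add: field_simps)
    also have "\<dots> \<le> ?M * (cmod z * (c + 2 * ln ?M) * ?G)"
      using G(3) c0 by (intro mult_left_mono) auto
    finally have "cmod (partial_sum x (Suc m)) \<le> ?M * (cmod z * (c + 2 * ln ?M) * ?G)" .
    moreover have "cmod (y (Suc (Suc m)) / l) \<le> cmod z * ?G"
      using mult_left_mono[OF G(2), of "cmod z"] by (simp add: z_def norm_divide)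
    ultimately have b: "cmod (partial_sum x (Suc m) + y (Suc (Suc m)) / l)
        \<le> ?M * (cmod z * (c + 2 * ln ?M) * ?G) + cmod z * ?G"
      by (rule order_trans[OF norm_triangle_ineq add_mono])
    \<comment> \<open>twice the logarithm grows by at least \<open>1 / M\<close> from \<open>M\<close> to \<open>M + 1\<close>, which covers the increment\<close>
    have lnb: "1 \<le> ?M * (2 * ln (?M + 1) - 2 * ln ?M)"
    proof -
      have "ln (?M / (?M + 1)) \<le> ?M / (?M + 1) - 1" by (rule ln_le_minus_one) simp
      then have "ln (?M + 1) - ln ?M \<ge> 1 / (?M + 1)" by (simp add: ln_div field_simps)
      then have "?M * (2 * (ln (?M + 1) - ln ?M)) \<ge> ?M * (2 * (1 / (?M + 1)))"
        by (intro mult_left_mono) auto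
      moreover have "?M * (2 * (1 / (?M + 1))) \<ge> 1" by (simp add: field_simps)
      ultimately show ?thesis unfolding right_diff_distrib by linarith
    qed
    have "Re (of_nat (Suc (Suc m)) - z) = ?M" using l(2) by (simp add: z_def)
    then have "?M \<le> cmod (of_nat (Suc (Suc m)) - z)" using complex_Re_le_cmod by metis
    then have "?M * cmod (partial_sum x (Suc (Suc m))) \<le>
        cmod (of_nat (Suc (Suc m)) - z) * cmod (partial_sum x (Suc (Suc m)))"
      by (intro mult_right_mono) auto
    also have "\<dots> = (?M + 1) * cmod (partial_sum x (Suc m) + y (Suc (Suc m)) / l)"
      using rec[of "Suc m"] unfolding norm_of_nat by (simp add: add.commute)
    also have "\<dots> \<le> (?M + 1) * (?M * (cmod z * (c + 2 * ln ?M) * ?G) + cmod z * ?G)"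
      using b by (intro mult_left_mono) auto
    also have "\<dots> \<le> (?M + 1) * (?M * (cmod z * (c + 2 * ln (?M + 1)) * ?G))"
    proof (intro mult_left_mono)
      have "cmod z * ?G * 1 \<le> cmod z * ?G * (?M * (2 * ln (?M + 1) - 2 * ln ?M))"
        using lnb G(1) by (intro mult_left_mono) auto
      then show "?M * (cmod z * (c + 2 * ln ?M) * ?G) + cmod z * ?G \<le> ?M * (cmod z * (c + 2 * ln (?M + 1)) * ?G)"
        by (simp add: algebra_simps)
    qed auto
    finally have "?M * cmod (partial_sum x (Suc (Suc m))) \<le>
       ?M * ((?M + 1) * (cmod z * (c + 2 * ln (?M + 1)) * ?G))"
      by (simp add: mult_ac)
    then have "cmod (partial_sum x (Suc (Suc m))) \<le> (?M + 1) * (cmod z * (c + 2 * ln (?M + 1)) * ?G)"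
      by (subst (asm) mult_le_cancel_left_pos) auto
    moreover have "?M + 1 = real (Suc (Suc m))" by simp
    ultimately show ?case by (simp add: field_simps)
  qed
  obtain m where m: "n = Suc m" using n by (cases n) auto
  have "cmod (partial_sum x n / of_nat n) \<le> cmod z * (c + 2 * ln (real n)) * g n"
    using S[of m] m by (simp add: norm_divide del: of_nat_Suc)
  then have "cmod (y n + partial_sum x n / of_nat n) \<le> g n + cmod z * (c + 2 * ln (real n)) * g n"
    using y[OF n] by (rule_tac order_trans[OF norm_triangle_ineq]) simp
  then have "cmod z * cmod (y n + partial_sum x n / of_nat n) \<le>
      cmod z * (g n + cmod z * (c + 2 * ln (real n)) * g n)"
    by (intro mult_left_mono) auto
  moreover have "cmod (x n) = cmod z * cmod (y n + partial_sum x n / of_nat n)"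
    using cesaro_equation_value[OF l(1) eq, of n] by (simp add: z_def norm_divide)
  ultimately show ?thesis by (simp add: c_def z_def algebra_simps)
qed


text \<open>
  A form of \<open>(1 + 1 / n)\<^sup>e \<le> exp (e / n) \<le> 1 / (1 - e / n)\<close> for \<open>n > e\<close>. It says that a positive
  sequence with \<open>(n - e) t (n + 1) \<ge> n t n\<close> grows at least like \<open>n\<^sup>e\<close>.
\<close>

lemma powr_successor_le:
  assumes "0 < e" "n \<ge> 1"
  shows "real (Suc n) powr e * (real n - e) \<le> real n * real n powr e"
proof -
  have n: "0 < real n" using assms(2) by simp
  have "real (Suc n) = real n * (1 + 1 / real n)" using n by (simp add: field_simps)
  then have "real (Suc n) powr e = real n powr e * (1 + 1 / real n) powr e"
    using n by (simp add: powr_mult del: of_nat_Suc)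
  also have "(1 + 1 / real n) powr e = exp (e * ln (1 + 1 / real n))"
  proof -
    have "0 < 1 + 1 / real n" using n by (simp add: add_pos_pos)
    then show ?thesis by (simp add: powr_def)
  qed
  also have "\<dots> \<le> exp (e * (1 / real n))"
    using assms(1) ln_add_one_self_le_self[of "1 / real n"] n
    unfolding exp_le_cancel_iff by (intro mult_left_mono) auto
  finally have a: "real (Suc n) powr e \<le> real n powr e * exp (e / real n)"
    by (simp add: mult_left_mono)
  have "1 - e / real n \<le> exp (- (e / real n))"
    using exp_ge_add_one_self[of "- (e / real n)"] by simp
  then have "real n * (1 - e / real n) \<le> real n * exp (- (e / real n))"
    using n by (intro mult_left_mono) auto
  then have "real n - e \<le> real n * exp (- (e / real n))"
    using n by (simp add: right_diff_distrib)
  then have "real (Suc n) powr e * (real n - e) \<le> real (Suc n) powr e * (real n * exp (- (e / real n)))"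
    by (intro mult_left_mono) auto
  also have "\<dots> \<le> (real n powr e * exp (e / real n)) * (real n * exp (- (e / real n)))"
    using a by (intro mult_right_mono) auto
  also have "\<dots> = real n * real n powr e"
    by (simp add: exp_minus field_simps)
  finally show ?thesis .
qed

text \<open>
  From the second index on, the recurrence is homogeneous, and \<open>\<bar>n + 1 - z\<bar>\<close> is asymptotically
  \<open>n + 1 - Re z\<close>. So eventually \<open>\<bar>n + 1 - z\<bar> \<le> n - e\<close> for any \<open>e < Re z - 1\<close>, and the averages grow
  at least like \<open>n\<^sup>e\<close>.
\<close>

lemma cesaro_equation_growth_inside:
  assumes l: "l \<noteq> 0" "1 < Re (1 / l)" "\<And>n. n \<ge> 1 \<Longrightarrow> 1 / l \<noteq> of_nat n"
    and eq: "l *\<^sub>C x - cesaro x = (\<lambda>n. if n = 1 then 1 else 0)"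
  shows "\<exists>c>0. \<exists>e>0. \<exists>N. \<forall>n\<ge>N. c * real n powr e \<le> cmod (x n)"
proof -
  define z where "z = 1 / l"
  \<comment> \<open>any \<open>e\<close> strictly between \<open>0\<close> and \<open>Re z - 1\<close> would do\<close>
  define e where "e = (Re z - 1) / 2"
  have e: "0 < e" "1 + e < Re z" "Re z = 1 + 2 * e" using l(2) by (simp_all add: e_def z_def[symmetric] field_simps)
  have z0: "z \<noteq> 0" using l(1) by (simp add: z_def)
  define T where "T n = cmod (partial_sum x n) / real n" for n
  note rec0 = cesaro_equation_recurrence[OF l(1) eq, folded z_def]
  have nz: "(of_nat (Suc n) :: complex) - z \<noteq> 0" for n
    using l(3)[of "Suc n"] by (auto simp: z_def simp del: of_nat_Suc)
  have recS: "(of_nat (Suc n) - z) * partial_sum x (Suc n) = of_nat (Suc n) * partial_sum x n" if "n \<ge> 1" for n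
    using rec0[of n] that by (simp del: of_nat_Suc)
  have S_nz: "partial_sum x (Suc n) \<noteq> 0" for n
  proof (induction n)
    case 0
    show ?case using rec0[of 0] l(1) by auto
  next
    case (Suc n)
    then show ?case using recS[of "Suc n"] of_nat_neq_0 by (metis Suc_le_mono le0 mult_eq_0_iff One_nat_def)
  qed
  have recT: "cmod (of_nat (Suc n) - z) * T (Suc n) = real n * T n" if "n \<ge> 1" for n
  proof -
    have "cmod (of_nat (Suc n) - z) * cmod (partial_sum x (Suc n)) = real (Suc n) * cmod (partial_sum x n)"
      using arg_cong[OF recS[OF that], of cmod] by (simp add: norm_mult del: of_nat_Suc)
    then show ?thesis using that by (simp add: T_def field_simps)
  qed
  \<comment> \<open>beyond this threshold \<open>\<bar>n - z\<bar>\<^sup>2 \<le> (n - 1 - e)\<^sup>2\<close>, an inequality that is linear in \<open>n\<close>\<close>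
  obtain N0 where N0: "real N0 \<ge> ((cmod z)\<^sup>2 - (1 + e)\<^sup>2) / (2 * (Re z - (1 + e))) + e"
    using real_arch_simple by blast
  define N where "N = N0 + nat \<lceil>e\<rceil> + 2"
  have Ne: "real n > e" "n \<ge> 2" if "n \<ge> N" for n
    using that e(1) by (auto simp: N_def) linarith
  have dist: "cmod (of_nat (Suc n) - z) \<le> real n - e" if n: "n \<ge> N" for n
  proof (rule power2_le_imp_le)
    have "((cmod z)\<^sup>2 - (1 + e)\<^sup>2) / (2 * (Re z - (1 + e))) \<le> real (Suc n)"
      using N0 n e(1) by (simp add: N_def)
    then have *: "(cmod z)\<^sup>2 - (1 + e)\<^sup>2 \<le> real (Suc n) * (2 * (Re z - (1 + e)))"
      using e(2) by (simp add: pos_divide_le_eq del: of_nat_Suc)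
    have "(cmod (of_nat (Suc n) - z))\<^sup>2 = (real (Suc n))\<^sup>2 - 2 * real (Suc n) * Re z + (cmod z)\<^sup>2"
      by (simp add: cmod_power2 power2_diff algebra_simps del: of_nat_Suc)
    also have "\<dots> \<le> (real (Suc n) - (1 + e))\<^sup>2"
      using * by (simp add: power2_diff algebra_simps del: of_nat_Suc)
    finally show "(cmod (of_nat (Suc n) - z))\<^sup>2 \<le> (real n - e)\<^sup>2" by simp
    show "0 \<le> real n - e" using Ne(1)[OF n] by simp
  qed
  define c where "c = T N / real N powr e"
  have T0: "T n > 0" if "n \<ge> 1" for n
    using S_nz[of "n - 1"] that by (simp add: T_def)
  have Npos: "N \<ge> 1" using Ne(2)[of N] by simp
  have c: "c > 0" using T0[OF Npos] Npos by (simp add: c_def)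
  have grow: "c * real n powr e \<le> T n" if "n \<ge> N" for n
    using that
  proof (induction n rule: dec_induct)
    case base
    then show ?case using Npos by (simp add: c_def)
  next
    case (step n)
    have n1: "n \<ge> 1" using step(1) Npos by simp
    have "c * real (Suc n) powr e * (real n - e) \<le> c * (real n * real n powr e)"
      using mult_left_mono[OF powr_successor_le[OF e(1) n1], of c] c by (simp add: mult_ac del: of_nat_Suc)
    also have "\<dots> \<le> real n * T n" using mult_left_mono[OF step(3), of "real n"] by (simp add: mult_ac)
    also have "\<dots> = cmod (of_nat (Suc n) - z) * T (Suc n)" using recT[OF n1] by simp
    also have "\<dots> \<le> (real n - e) * T (Suc n)"
      using dist[OF step(1)] T0[of "Suc n"] by (intro mult_right_mono) auto
    finally show ?case using Ne(1)[OF step(1)] by (simp add: mult.commute del: of_nat_Suc)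
  qed
  have "c * cmod z * real n powr e \<le> cmod (x n)" if "n \<ge> N" for n
  proof -
    have "x n = z * (partial_sum x n / of_nat n)"
      using cesaro_equation_value[OF l(1) eq, of n] Ne(2)[OF that] by (simp add: z_def)
    then have "cmod (x n) = cmod z * T n" by (simp add: T_def norm_mult norm_divide)
    then show ?thesis using mult_left_mono[OF grow[OF that], of "cmod z"] by (simp add: mult_ac)
  qed
  moreover have "c * cmod z > 0" using c z0 by simp
  ultimately show ?thesis using e(1) by blast
qed

text \<open>
  The sequence \<open>y\<close> is built together with its partial sums \<open>u\<close>: each \<open>z y (n + 1)\<close> points in the
  direction of \<open>u n\<close>, so that the two moduli add up. With \<open>t = (Im z)\<^sup>2 / 2\<close> one has
  \<open>\<bar>n + 1 - z\<bar> \<le> n + t / n\<close>, and the correction \<open>t / n\<close> is too small to prevent the averages from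
  growing like the logarithm.
\<close>

lemma cesaro_equation_growth_circle:
  assumes l: "l \<noteq> 0" "Re (1 / l) = 1" "l \<noteq> 1"
  shows "\<exists>y. y 0 = 0 \<and> (\<forall>n. cmod (y n) \<le> 1) \<and>
    (\<forall>x. l *\<^sub>C x - cesaro x = y \<longrightarrow> (\<exists>c>0. \<exists>d. \<forall>n\<ge>1. c * ln (real n) \<le> cmod (x n) + d))"
proof -
  define z where "z = 1 / l"
  have z0: "z \<noteq> 0" and zR: "Re z = 1" and z1: "z \<noteq> 1"
    using l by (auto simp: z_def)
  \<comment> \<open>the default \<open>1\<close> makes the phase a unit vector also when a partial sum vanishes\<close>
  define phase where "phase w = (if w = 0 then 1 else sgn w)" for w :: complex
  have phase: "cmod (phase w) = 1" "w + cmod z * phase w = (cmod w + cmod z) * phase w" for w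
    by (auto simp: phase_def norm_sgn) (auto simp: sgn_div_norm scaleR_conv_of_real field_simps)
  define u where "u = rec_nat 0 (\<lambda>n t. of_nat (Suc n) * (t + cmod z * phase t) / (of_nat (Suc n) - z))"
  define y where "y n = (case n of 0 \<Rightarrow> 0 | Suc m \<Rightarrow> cmod z / z * phase (u m))" for n
  have y1: "cmod (y n) \<le> 1" for n
    using z0 by (auto simp: y_def norm_mult norm_divide phase split: nat.split)
  have nz: "(of_nat (Suc n) :: complex) - z \<noteq> 0" for n
  proof
    assume "(of_nat (Suc n) :: complex) - z = 0"
    then have "z = of_nat (Suc n)" by simp
    then show False using zR z1 by (cases n) auto
  qed
  have u0: "u 0 = 0" by (simp add: u_def)
  have uS: "(of_nat (Suc n) - z) * u (Suc n) = of_nat (Suc n) * (u n + cmod z * phase (u n))" for n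
    using nz[of n] by (simp add: u_def del: of_nat_Suc)
  define T where "T n = cmod (u n) / real n" for n
  define t where "t = (Im z)\<^sup>2 / 2"
  \<comment> \<open>so that \<open>e (1 + t) = \<bar>z\<bar>\<close>: the source pays for the logarithm, at most \<open>e\<close>, and for the correction, at most \<open>e t\<close>\<close>
  define e where "e = cmod z / (1 + t)"
  have t0: "0 \<le> t" by (simp add: t_def)
  have e: "e > 0" "e * (1 + t) = cmod z" using z0 t0 by (auto simp: e_def intro!: divide_pos_pos)
  have recT: "cmod (of_nat (Suc n) - z) * T (Suc n) = real n * T n + cmod z" if "n \<ge> 1" for n
  proof -
    have "cmod (of_nat (Suc n) - z) * cmod (u (Suc n)) =
        real (Suc n) * cmod (u n + cmod z * phase (u n))"
      using arg_cong[OF uS[of n], of cmod] by (simp add: norm_mult del: of_nat_Suc)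
    also have "cmod (u n + cmod z * phase (u n)) = cmod (u n) + cmod z"
      unfolding phase(2) norm_mult phase(1)
      using norm_of_real[of "cmod (u n) + cmod z", where 'a = complex] by simp
    finally show ?thesis using that by (simp add: T_def field_simps)
  qed
  have grow: "e * ln (real (Suc n)) \<le> T (Suc n)" for n
  proof (induction n)
    case 0
    show ?case by (simp add: T_def)
  next
    case (Suc m)
    define n where "n = Suc m"
    have n: "n \<ge> 1" "real n > 0" by (simp_all add: n_def)
    have IH: "e * ln (real n) \<le> T n" using Suc by (simp add: n_def)
    have dist: "cmod (of_nat (Suc n) - z) \<le> real n + t / real n"
    proof (rule power2_le_imp_le)
      have "(cmod (of_nat (Suc n) - z))\<^sup>2 = (real n)\<^sup>2 + 2 * t"
        using zR by (simp add: cmod_power2 t_def)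
      also have "\<dots> \<le> (real n + t / real n)\<^sup>2"
        using n by (simp add: power2_sum)
      finally show "(cmod (of_nat (Suc n) - z))\<^sup>2 \<le> (real n + t / real n)\<^sup>2" .
      show "0 \<le> real n + t / real n" using t0 by simp
    qed
    have a1: "real n * ln (real (Suc n)) \<le> real n * ln (real n) + 1"
    proof -
      have "ln (real (Suc n)) - ln (real n) = ln (1 + 1 / real n)"
        using ln_div[of "real (Suc n)" "real n"] n by (simp add: add_divide_distrib add.commute)
      also have "\<dots> \<le> 1 / real n" by (rule ln_add_one_self_le_self) simp
      finally have "real n * (ln (real (Suc n)) - ln (real n)) \<le> real n * (1 / real n)"
        using n by (intro mult_left_mono) auto
      then show ?thesis using n by (simp add: algebra_simps)
    qed
    have a2: "t / real n * ln (real (Suc n)) \<le> t"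
    proof -
      have "ln (real (Suc n)) \<le> real n" using ln_add_one_self_le_self[of "real n"] by (simp add: add.commute)
      then have "t / real n * ln (real (Suc n)) \<le> t / real n * real n"
        using t0 by (intro mult_left_mono) auto
      then show ?thesis using n by simp
    qed
    have pos: "0 < real n + t / real n" using n t0 by (simp add: add_pos_nonneg)
    have "(real n + t / real n) * (e * ln (real (Suc n))) =
        e * (real n * ln (real (Suc n)) + t / real n * ln (real (Suc n)))"
      by (simp add: algebra_simps)
    also have "\<dots> \<le> e * (real n * ln (real n) + 1 + t)"
      using a1 a2 e(1) by (intro mult_left_mono) auto
    also have "\<dots> = real n * (e * ln (real n)) + cmod z"
      using e(2) by (simp add: algebra_simps)
    also have "\<dots> \<le> real n * T n + cmod z" using IH n by simp
    also have "\<dots> = cmod (of_nat (Suc n) - z) * T (Suc n)" using recT[OF n(1)] by simp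
    also have "\<dots> \<le> (real n + t / real n) * T (Suc n)"
      using dist by (intro mult_right_mono) (auto simp: T_def)
    finally show ?case using pos by (simp add: n_def del: of_nat_Suc)
  qed
  have "\<exists>c>0. \<exists>d. \<forall>n\<ge>1. c * ln (real n) \<le> cmod (x n) + d" if eq: "l *\<^sub>C x - cesaro x = y" for x
  proof -
    have S: "partial_sum x n = u n" for n
    proof (induction n)
      case (Suc n)
      have "(of_nat (Suc n) - z) * partial_sum x (Suc n) = of_nat (Suc n) * (partial_sum x n + y (Suc n) / l)"
        using cesaro_equation_recurrence[OF l(1) eq, of n] by (simp add: z_def)
      also have "y (Suc n) / l = cmod z * phase (u n)" using z0 l(1) by (simp add: y_def z_def)
      finally have "(of_nat (Suc n) - z) * partial_sum x (Suc n) = (of_nat (Suc n) - z) * u (Suc n)"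
        using Suc uS[of n] by simp
      then show ?case using nz[of n] by (simp del: of_nat_Suc)
    qed (simp add: u0)
    have "cmod z * e * ln (real n) \<le> cmod (x n) + cmod z" if n: "n \<ge> 1" for n
    proof -
      have "cmod (x n) = cmod z * cmod (y n + u n / of_nat n)"
        using cesaro_equation_value[OF l(1) eq, of n] S by (simp add: z_def norm_divide)
      moreover have "T n - 1 \<le> cmod (y n + u n / of_nat n)"
        using norm_diff_ineq[of "u n / of_nat n" "y n"] y1[of n]
        by (simp add: T_def norm_divide add.commute)
      ultimately have "cmod z * (T n - 1) \<le> cmod (x n)" by (simp add: mult_left_mono)
      moreover have "e * ln (real n) \<le> T n" using grow[of "n - 1"] n by simp
      then have "cmod z * (e * ln (real n)) \<le> cmod z * T n" by (intro mult_left_mono) auto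
      ultimately show ?thesis by (simp add: algebra_simps)
    qed
    moreover have "cmod z * e > 0" using e z0 by simp
    ultimately show ?thesis by blast
  qed
  moreover have "y 0 = 0" by (simp add: y_def)
  ultimately show ?thesis using y1 by blast
qed

text \<open>
  At \<open>n = m\<close> the factor of \<open>S n\<close> in the recurrence vanishes, which imposes a linear condition on the
  first \<open>m\<close> entries of the right-hand side. The \<open>m\<close>-th unit vector violates it.
\<close>

lemma cesaro_equation_unsolvable_at_diagonal:
  assumes m: "m \<ge> 1" "1 / l = of_nat m"
  shows "l *\<^sub>C x - cesaro x \<noteq> (\<lambda>n. if n = m then 1 else 0)"
proof
  assume eq: "l *\<^sub>C x - cesaro x = (\<lambda>n. if n = m then 1 else 0)"
  have l: "l \<noteq> 0" using m by auto
  note rec = cesaro_equation_recurrence[OF l eq, unfolded m(2)]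
  have zero: "partial_sum x n = 0" if "n < m" for n
    using that
  proof (induction n)
    case (Suc n)
    then have "(of_nat (Suc n) - of_nat m :: complex) * partial_sum x (Suc n) = 0"
      using rec[of n] by simp
    then show ?case using Suc.prems by (simp del: of_nat_Suc)
  qed simp
  obtain k where k: "m = Suc k" using m(1) by (cases m) auto
  have "of_nat (Suc k) * (1 / l) = (0::complex)"
    using rec[of k] zero[of k] k by (simp del: of_nat_Suc)
  then show False using l by (simp del: of_nat_Suc)
qed

text \<open>
  Here the partial sums are \<open>n\<close> times an alternating sign, and two consecutive ones differ by
  \<open>2 n - 1\<close> in modulus.
\<close>

lemma cesaro_equation_growth_zero:
  assumes eq: "0 *\<^sub>C x - cesaro x = (\<lambda>n. if n = 0 then 0 else (-1) ^ n)" and n: "n \<ge> 1"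
  shows "real n \<le> cmod (x n)"
proof -
  have S: "partial_sum x k = - (of_nat k * (-1) ^ k)" for k
  proof (cases "k = 0")
    case False
    then have "- (partial_sum x k / of_nat k) = (-1) ^ k"
      using eq[unfolded cesaro_equation_iff, rule_format, of k] by simp
    then have "partial_sum x k / of_nat k = - ((-1) ^ k)" by (metis minus_minus)
    then show ?thesis using False by (simp add: field_simps)
  qed simp
  obtain k where k: "n = Suc k" using n by (cases n) auto
  have "x n = (-1) ^ k * of_nat (2 * k + 1)"
    using partial_sum_Suc[of x k] S[of k] S[of "Suc k"] k by (simp add: algebra_simps)
  then have "cmod (x n) = real (2 * k + 1)"
    by (simp only: norm_mult norm_power norm_minus_cancel norm_one power_one mult_1 norm_of_nat)
  then show ?thesis using k by simp
qed

section \<open>Neighbourhoods of zero in the inductive limit\<close>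

definition absolutely_convex :: "(nat \<Rightarrow> complex) set \<Rightarrow> bool"
  where "absolutely_convex V \<longleftrightarrow>
    (\<forall>x\<in>V. \<forall>y\<in>V. \<forall>a b. cmod a + cmod b \<le> 1 \<longrightarrow> a *\<^sub>C x + b *\<^sub>C y \<in> V)"

lemma absolutely_convexD:
  "absolutely_convex V \<Longrightarrow> x \<in> V \<Longrightarrow> y \<in> V \<Longrightarrow> cmod a + cmod b \<le> 1 \<Longrightarrow> a *\<^sub>C x + b *\<^sub>C y \<in> V"
  by (simp add: absolutely_convex_def)

lemma smul_0 [simp]: "0 *\<^sub>C x = 0" "c *\<^sub>C 0 = 0" "1 *\<^sub>C x = x"
  by (simp_all add: smul_def fun_eq_iff)

lemma smul_smul [simp]: "a *\<^sub>C (b *\<^sub>C x) = (a * b) *\<^sub>C x"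
  by (simp add: smul_def fun_eq_iff)

lemma smul_rescaled_sum:
  assumes "q \<noteq> 0"
  shows "of_real q *\<^sub>C (of_real (a / q) *\<^sub>C x + of_real (b / q) *\<^sub>C y) = of_real a *\<^sub>C x + of_real b *\<^sub>C y"
proof -
  have "complex_of_real q * of_real (a / q) = of_real a" for a
    using assms by simp
  then show ?thesis
    by (simp add: smul_def fun_eq_iff distrib_left mult.assoc[symmetric] del: of_real_divide)
qed

lemma absolutely_convex_smul:
  "absolutely_convex V \<Longrightarrow> x \<in> V \<Longrightarrow> cmod a \<le> 1 \<Longrightarrow> a *\<^sub>C x \<in> V"
  using absolutely_convexD[of V x x a 0] by simp

locale growth_space =
  fixes \<alpha> s :: "nat \<Rightarrow> real"
  assumes \<alpha>_pos: "\<And>n. n \<ge> 1 \<Longrightarrow> 0 < \<alpha> n"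
    and \<alpha>_mono: "strict_mono_on {1..} \<alpha>"
    and \<alpha>_lim: "filterlim \<alpha> at_top sequentially"
    and s_gt_1: "\<And>k. 1 < s k"
    and s_mono: "strict_mono s"
    and s_lim: "filterlim s at_top sequentially"
begin

text \<open>
  Bounds in the weighted sup-norm without the requirement that the weighted sequence tends to \<open>0\<close>. This
  set lies in the next step of the inductive limit and in general not in the step of its own weight. The
  limit is the same, and no estimate has to deal with null sequences. The index \<open>0\<close> is kept out of the bound because nothing is known about
  \<open>\<alpha> 0\<close>.
\<close>

definition step_ball :: "nat \<Rightarrow> real \<Rightarrow> (nat \<Rightarrow> complex) set"
  where "step_ball k r = {x. x 0 = 0 \<and> (\<forall>n\<ge>1. cmod (x n) \<le> r * s k powr \<alpha> n)}"

definition carrier :: "(nat \<Rightarrow> complex) set"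
  where "carrier = (\<Union>k. c0 (\<lambda>n. s k powr (- \<alpha> n)))"

definition zero_neighbourhoods :: "(nat \<Rightarrow> complex) set set"
  where "zero_neighbourhoods =
    {V. V \<subseteq> carrier \<and> absolutely_convex V \<and> (\<forall>k. \<exists>r>0. step_ball k r \<subseteq> V)}"

definition neighbourhood_topology :: "(nat \<Rightarrow> complex) topology"
  where "neighbourhood_topology =
    topology (\<lambda>U. U \<subseteq> carrier \<and> (\<forall>x\<in>U. \<exists>V\<in>zero_neighbourhoods. \<forall>v\<in>V. x + v \<in> U))"

lemma s_pos: "0 < s k"
  using s_gt_1[of k] by simp

lemma s_le: "k \<le> l \<Longrightarrow> s k \<le> s l"
  using s_mono by (simp add: strict_mono_less_eq)

lemma step_ballD: "x \<in> step_ball k r \<Longrightarrow> n \<ge> 1 \<Longrightarrow> cmod (x n) \<le> r * s k powr \<alpha> n"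
  by (simp add: step_ball_def)

lemma step_ball_radius_nonneg: "x \<in> step_ball k r \<Longrightarrow> 0 \<le> r"
proof -
  assume "x \<in> step_ball k r"
  then have "cmod (x 1) \<le> r * s k powr \<alpha> 1" by (simp add: step_ball_def)
  then have "0 \<le> r * s k powr \<alpha> 1" using norm_ge_zero order_trans by blast
  then show ?thesis using s_pos[of k] by (simp add: zero_le_mult_iff)
qed

lemma step_ball_mono:
  assumes "x \<in> step_ball k r" "k \<le> l" "r \<le> r'"
  shows "x \<in> step_ball l r'"
proof -
  have "r * s k powr \<alpha> n \<le> r' * s l powr \<alpha> n" if "n \<ge> 1" for n
  proof (intro mult_mono powr_mono2)
    show "0 \<le> \<alpha> n" using \<alpha>_pos[OF that] by simp
    show "0 \<le> r'" using step_ball_radius_nonneg[OF assms(1)] assms(3) by simp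
  qed (use assms s_pos[of k] s_le in auto)
  then show ?thesis using assms(1) order_trans by (fastforce simp: step_ball_def)
qed

lemma step_ball_add:
  assumes "x \<in> step_ball k r" "y \<in> step_ball k r'"
  shows "x + y \<in> step_ball k (r + r')"
  using assms by (auto simp: step_ball_def distrib_right intro: order_trans[OF norm_triangle_ineq add_mono])

lemma step_ball_smul:
  assumes "x \<in> step_ball k r"
  shows "c *\<^sub>C x \<in> step_ball k (cmod c * r)"
  using assms by (auto simp: step_ball_def smul_def norm_mult mult.assoc intro: mult_left_mono)

lemma zero_in_step_ball: "0 \<le> r \<Longrightarrow> 0 \<in> step_ball k r"
  by (simp add: step_ball_def)

text \<open>
  The steps are interlaced: \<open>(s k / s (k + 1)) powr \<alpha> n\<close> tends to \<open>0\<close> because \<open>\<alpha> n\<close> tends to infinity.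
\<close>

lemma step_ball_subset_c0: "step_ball k r \<subseteq> c0 (\<lambda>n. s (Suc k) powr (- \<alpha> n))"
proof
  fix x assume x: "x \<in> step_ball k r"
  have r: "0 \<le> r" by (rule step_ball_radius_nonneg[OF x])
  define q where "q = ln (s k) - ln (s (Suc k))"
  have "s k < s (Suc k)" using s_mono by (simp add: strict_mono_Suc_iff)
  then have q: "q < 0" using s_pos[of k] by (simp add: q_def)
  have "(\<lambda>n. r * exp (q * \<alpha> n)) \<longlonglongrightarrow> 0"
  proof -
    have "filterlim (\<lambda>n. q * \<alpha> n) at_bot sequentially"
      using filterlim_tendsto_neg_mult_at_bot[OF tendsto_const q \<alpha>_lim] .
    then have "(\<lambda>n. exp (q * \<alpha> n)) \<longlonglongrightarrow> 0"
      using exp_at_bot filterlim_compose by blast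
    then show ?thesis using tendsto_mult_right_zero by blast
  qed
  then have "(\<lambda>n. s (Suc k) powr (- \<alpha> n) * cmod (x n)) \<longlonglongrightarrow> 0"
  proof (rule tendsto_sandwich[of "\<lambda>_. 0", rotated 3])
    show "\<forall>\<^sub>F n in sequentially. s (Suc k) powr (- \<alpha> n) * cmod (x n) \<le> r * exp (q * \<alpha> n)"
      using eventually_ge_at_top[of 1]
    proof eventually_elim
      case (elim n)
      have "s (Suc k) powr (- \<alpha> n) * cmod (x n) \<le> s (Suc k) powr (- \<alpha> n) * (r * s k powr \<alpha> n)"
        using x elim by (intro mult_left_mono) (auto simp: step_ball_def)
      also have "\<dots> = r * exp (q * \<alpha> n)"
        using s_pos[of k] s_pos[of "Suc k"]
        by (simp add: powr_def q_def exp_diff exp_minus left_diff_distrib field_simps)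
      finally show ?case .
    qed
  qed auto
  then show "x \<in> c0 (\<lambda>n. s (Suc k) powr (- \<alpha> n))"
    using x by (simp add: c0_def step_ball_def)
qed

lemma c0_norm_le_imp_step_ball:
  assumes "x \<in> c0 (\<lambda>n. s k powr (- \<alpha> n))" "c0_norm (\<lambda>n. s k powr (- \<alpha> n)) x \<le> r"
  shows "x \<in> step_ball k r"
proof -
  have "cmod (x n) \<le> r * s k powr \<alpha> n" if "n \<ge> 1" for n
  proof -
    have "s k powr (- \<alpha> n) * cmod (x n) \<le> r"
      using c0_norm_upper[OF assms(1) that] assms(2) by simp
    then show ?thesis using s_pos[of k] by (simp add: powr_minus field_simps)
  qed
  then show ?thesis using assms(1) by (simp add: step_ball_def c0_def)
qed

lemma c0_norm_step_ball:
  assumes "x \<in> step_ball k r"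
  shows "c0_norm (\<lambda>n. s (Suc k) powr (- \<alpha> n)) x \<le> r"
  unfolding c0_norm_def
proof (rule cSUP_least)
  fix n :: nat assume n: "n \<in> {1..}"
  have "cmod (x n) \<le> r * s (Suc k) powr \<alpha> n"
    using step_ball_mono[OF assms, of "Suc k" r] n by (simp add: step_ball_def)
  then show "s (Suc k) powr (- \<alpha> n) * cmod (x n) \<le> r"
    using s_pos[of "Suc k"] by (simp add: powr_minus field_simps)
qed simp

lemma carrier_iff: "x \<in> carrier \<longleftrightarrow> (\<exists>k r. x \<in> step_ball k r)"
  using step_ball_subset_c0 c0_norm_le_imp_step_ball[OF _ order_refl] unfolding carrier_def by blast

lemma step_ball_subset_carrier: "step_ball k r \<subseteq> carrier"
  using carrier_iff by blast

lemma carrier_smul: "x \<in> carrier \<Longrightarrow> c *\<^sub>C x \<in> carrier"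
  using step_ball_smul carrier_iff by blast

lemma carrier_add: "x \<in> carrier \<Longrightarrow> y \<in> carrier \<Longrightarrow> x + y \<in> carrier"
proof -
  assume "x \<in> carrier" "y \<in> carrier"
  then obtain k r l r' where "x \<in> step_ball k r" "y \<in> step_ball l r'" by (auto simp: carrier_iff)
  then have "x \<in> step_ball (max k l) r" "y \<in> step_ball (max k l) r'"
    using step_ball_mono by (meson max.cobounded1 max.cobounded2 order_refl)+
  then show ?thesis using step_ball_add carrier_iff by blast
qed

lemma carrier_at_0: "x \<in> carrier \<Longrightarrow> x 0 = 0"
  by (auto simp: carrier_def c0_def)

lemma zero_in_carrier: "0 \<in> carrier"
  using zero_in_step_ball[of 1] carrier_iff by fastforce

lemma carrier_subspace: "cseq.subspace carrier"
  by (rule cseq.subspaceI) (auto intro: zero_in_carrier carrier_add carrier_smul)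

lemma carrier_diff: "x \<in> carrier \<Longrightarrow> y \<in> carrier \<Longrightarrow> x - y \<in> carrier"
  using cseq.subspace_diff[OF carrier_subspace] by blast

lemma zero_neighbourhoodsD:
  assumes "V \<in> zero_neighbourhoods"
  shows "V \<subseteq> carrier" "absolutely_convex V" "0 \<in> V" "\<exists>r>0. step_ball k r \<subseteq> V"
  using assms zero_in_step_ball unfolding zero_neighbourhoods_def by (blast, blast, fastforce, blast)

lemma zero_neighbourhoods_Int:
  assumes "V \<in> zero_neighbourhoods" "W \<in> zero_neighbourhoods"
  shows "V \<inter> W \<in> zero_neighbourhoods"
proof -
  have "\<exists>r>0. step_ball k r \<subseteq> V \<inter> W" for k
  proof -
    obtain r r' where "r > 0" "step_ball k r \<subseteq> V" "r' > 0" "step_ball k r' \<subseteq> W"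
      using zero_neighbourhoodsD(4)[OF assms(1), of k] zero_neighbourhoodsD(4)[OF assms(2), of k] by blast
    then show ?thesis
      using step_ball_mono[of _ k "min r r'"] by (intro exI[of _ "min r r'"]) auto
  qed
  then show ?thesis using assms by (auto simp: zero_neighbourhoods_def absolutely_convex_def)
qed

lemma zero_neighbourhoods_smul:
  assumes V: "V \<in> zero_neighbourhoods" and c: "c \<noteq> 0"
  shows "(\<lambda>x. c *\<^sub>C x) ` V \<in> zero_neighbourhoods"
proof -
  have "\<exists>r>0. step_ball k r \<subseteq> (\<lambda>x. c *\<^sub>C x) ` V" for k
  proof -
    obtain r where r: "r > 0" "step_ball k r \<subseteq> V" using zero_neighbourhoodsD(4)[OF V] by blast
    have "x \<in> (\<lambda>x. c *\<^sub>C x) ` V" if "x \<in> step_ball k (cmod c * r)" for x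
    proof
      show "x = c *\<^sub>C ((1 / c) *\<^sub>C x)" using c by simp
      show "(1 / c) *\<^sub>C x \<in> V"
        using step_ball_smul[OF that, of "1 / c"] r c by (auto simp: norm_divide)
    qed
    then show ?thesis using r c by (intro exI[of _ "cmod c * r"]) auto
  qed
  moreover have "absolutely_convex ((\<lambda>x. c *\<^sub>C x) ` V)"
    unfolding absolutely_convex_def
  proof (clarify)
    fix x y a b assume *: "x \<in> V" "y \<in> V" "cmod a + cmod b \<le> 1"
    have "a *\<^sub>C c *\<^sub>C x + b *\<^sub>C c *\<^sub>C y = c *\<^sub>C (a *\<^sub>C x + b *\<^sub>C y)"
      by (simp add: smul_def fun_eq_iff algebra_simps)
    then show "a *\<^sub>C c *\<^sub>C x + b *\<^sub>C c *\<^sub>C y \<in> (\<lambda>x. c *\<^sub>C x) ` V"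
      using absolutely_convexD[OF zero_neighbourhoodsD(2)[OF V] *] by blast
  qed
  moreover have "(\<lambda>x. c *\<^sub>C x) ` V \<subseteq> carrier"
    using zero_neighbourhoodsD(1)[OF V] carrier_smul by blast
  ultimately show ?thesis by (simp add: zero_neighbourhoods_def)
qed

lemma openin_neighbourhood_topology:
  "openin neighbourhood_topology U \<longleftrightarrow>
    U \<subseteq> carrier \<and> (\<forall>x\<in>U. \<exists>V\<in>zero_neighbourhoods. \<forall>v\<in>V. x + v \<in> U)"
proof -
  let ?P = "\<lambda>U x. \<exists>V\<in>zero_neighbourhoods. \<forall>v\<in>V. x + v \<in> U"
  have Int: "?P (S \<inter> T) x" if "?P S x" "?P T x" for S T x
  proof -
    from that obtain V W where "V \<in> zero_neighbourhoods" "\<forall>v\<in>V. x + v \<in> S"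
      "W \<in> zero_neighbourhoods" "\<forall>v\<in>W. x + v \<in> T" by blast
    then show ?thesis
      using zero_neighbourhoods_Int by (intro bexI[of _ "V \<inter> W"]) auto
  qed
  have Union: "?P (\<Union>K) x" if "S \<in> K" "?P S x" for S K x
    using that by blast
  have "istopology (\<lambda>U. U \<subseteq> carrier \<and> (\<forall>x\<in>U. ?P U x))"
    unfolding istopology_def
  proof (intro conjI allI impI)
    fix S T assume S: "S \<subseteq> carrier \<and> (\<forall>x\<in>S. ?P S x)" and T: "T \<subseteq> carrier \<and> (\<forall>x\<in>T. ?P T x)"
    show "S \<inter> T \<subseteq> carrier" using S by blast
    show "\<forall>x\<in>S \<inter> T. ?P (S \<inter> T) x"
      by (intro ballI Int bspec[OF conjunct2[OF S]] bspec[OF conjunct2[OF T]]; erule IntE)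
  next
    fix K assume K: "\<forall>S\<in>K. S \<subseteq> carrier \<and> (\<forall>x\<in>S. ?P S x)"
    show "\<Union>K \<subseteq> carrier" by (intro Sup_least conjunct1[OF bspec[OF K]])
    show "\<forall>x\<in>\<Union>K. ?P (\<Union>K) x"
    proof (intro ballI, erule UnionE)
      fix x S assume "x \<in> S" "S \<in> K"
      then show "?P (\<Union>K) x" by (intro Union[of S] bspec[OF conjunct2[OF bspec[OF K]]])
    qed
  qed
  then show ?thesis unfolding neighbourhood_topology_def by (simp add: topology_inverse')
qed

lemma carrier_zero_neighbourhood: "carrier \<in> zero_neighbourhoods"
proof -
  have "absolutely_convex carrier"
    unfolding absolutely_convex_def by (intro ballI allI impI carrier_add carrier_smul)
  then show ?thesis
    using step_ball_subset_carrier zero_less_one unfolding zero_neighbourhoods_def by blast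
qed

lemma topspace_neighbourhood_topology: "topspace neighbourhood_topology = carrier"
proof (rule antisym)
  show "topspace neighbourhood_topology \<subseteq> carrier"
    by (auto simp: topspace_def openin_neighbourhood_topology)
  have "openin neighbourhood_topology carrier"
    unfolding openin_neighbourhood_topology using carrier_zero_neighbourhood carrier_add by blast
  then show "carrier \<subseteq> topspace neighbourhood_topology" by (rule openin_subset)
qed

text \<open>
  The translate of the union of the sets \<open>t V\<close> with \<open>t < 1\<close>. For \<open>V\<close> in the base this is an open
  convex set between the point and the translate of \<open>V\<close>; it turns neighbourhoods into open
  neighbourhoods.
\<close>

definition open_hull :: "(nat \<Rightarrow> complex) \<Rightarrow> (nat \<Rightarrow> complex) set \<Rightarrow> (nat \<Rightarrow> complex) set"
  where "open_hull x V = {x + of_real t *\<^sub>C v | t v. 0 \<le> t \<and> t < 1 \<and> v \<in> V}"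

lemma open_hull:
  assumes V: "V \<in> zero_neighbourhoods" and x: "x \<in> carrier"
  shows "openin neighbourhood_topology (open_hull x V)" "x \<in> open_hull x V"
    "open_hull x V \<subseteq> (\<lambda>v. x + v) ` V" "convex_cset (open_hull x V)"
proof -
  note ac = zero_neighbourhoodsD(2)[OF V]
  have t: "of_real t *\<^sub>C v \<in> V" if "0 \<le> t" "t < 1" "v \<in> V" for t v
    using absolutely_convex_smul[OF ac that(3), of "of_real t"] that by simp
  show "open_hull x V \<subseteq> (\<lambda>v. x + v) ` V" using t by (auto simp: open_hull_def)
  show "x \<in> open_hull x V"
    unfolding open_hull_def using zero_neighbourhoodsD(3)[OF V]
    by (auto intro!: exI[of _ 0])
  show "openin neighbourhood_topology (open_hull x V)"
    unfolding openin_neighbourhood_topology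
  proof (intro conjI ballI)
    show "open_hull x V \<subseteq> carrier"
      using t zero_neighbourhoodsD(1)[OF V] carrier_add[OF x] by (auto simp: open_hull_def)
    fix y assume "y \<in> open_hull x V"
    then obtain r v where y: "y = x + of_real r *\<^sub>C v" "0 \<le> r" "r < 1" "v \<in> V"
      by (auto simp: open_hull_def)
    define q where "q = (1 + r) / 2"
    have q: "0 < q" "q < 1" using y by (auto simp: q_def)
    have "r + (1 - r) / 2 = q" by (simp add: q_def field_simps)
    then have sum_q: "r / q + (1 - r) / 2 / q = 1"
      using q(1) by (metis add_divide_distrib divide_self less_numeral_extra(3))
    show "\<exists>W\<in>zero_neighbourhoods. \<forall>w\<in>W. y + w \<in> open_hull x V"
    proof (intro bexI ballI)
      show "(\<lambda>x. of_real ((1 - r) / 2) *\<^sub>C x) ` V \<in> zero_neighbourhoods"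
        using y by (intro zero_neighbourhoods_smul[OF V]) (simp del: of_real_divide of_real_diff)
      fix w assume "w \<in> (\<lambda>x. of_real ((1 - r) / 2) *\<^sub>C x) ` V"
      then obtain u where u: "u \<in> V" "w = of_real ((1 - r) / 2) *\<^sub>C u" by blast
      have "of_real (r / q) *\<^sub>C v + of_real ((1 - r) / 2 / q) *\<^sub>C u \<in> V"
        using q y sum_q
        by (intro absolutely_convexD[OF ac y(4) u(1)]) (simp del: of_real_divide of_real_diff)
      moreover have "y + w = x + of_real q *\<^sub>C (of_real (r / q) *\<^sub>C v + of_real ((1 - r) / 2 / q) *\<^sub>C u)"
        using q(1) by (subst smul_rescaled_sum) (simp_all add: y u add.assoc)
      ultimately show "y + w \<in> open_hull x V"
        unfolding open_hull_def using q by (auto intro!: exI[of _ q])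
    qed
  qed
  show "convex_cset (open_hull x V)"
    unfolding convex_cset_def
  proof (intro ballI allI impI)
    fix y y' and t :: real
    assume "y \<in> open_hull x V" "y' \<in> open_hull x V" and t: "0 \<le> t" "t \<le> 1"
    then obtain r v r' v' where y: "y = x + of_real r *\<^sub>C v" "0 \<le> r" "r < 1" "v \<in> V"
      and y': "y' = x + of_real r' *\<^sub>C v'" "0 \<le> r'" "r' < 1" "v' \<in> V"
      by (auto simp: open_hull_def)
    define q where "q = max (max r r') (1/2)"
    have q: "0 < q" "q < 1" "r / q \<le> 1" "r' / q \<le> 1" using y y' by (auto simp: q_def max_def)
    have "(1 - t) * (r / q) + t * (r' / q) \<le> (1 - t) * 1 + t * 1"
      using q t by (intro add_mono mult_left_mono) auto
    then have "of_real ((1 - t) * r / q) *\<^sub>C v + of_real (t * r' / q) *\<^sub>C v' \<in> V"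
      using q y y' t
      by (intro absolutely_convexD[OF ac y(4) y'(4)]) (simp del: of_real_divide of_real_diff of_real_mult add: abs_mult)
    moreover have "of_real (1 - t) *\<^sub>C y + of_real t *\<^sub>C y' =
      x + of_real q *\<^sub>C (of_real ((1 - t) * r / q) *\<^sub>C v + of_real (t * r' / q) *\<^sub>C v')"
      using q(1) by (subst smul_rescaled_sum) (simp_all add: y y' smul_def fun_eq_iff algebra_simps)
    ultimately show "of_real (1 - t) *\<^sub>C y + of_real t *\<^sub>C y' \<in> open_hull x V"
      unfolding open_hull_def using q by (auto intro!: exI[of _ q])
  qed
qed

text \<open>
  Absolute convexity gives continuity of the addition (halve \<open>V\<close>) and, together with the absorption of
  each step, continuity of the scalar multiplication. Coordinate functionals separate points.
\<close>

lemma lc_hausdorff_neighbourhood_topology: "lc_hausdorff neighbourhood_topology"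
proof -
  let ?T = neighbourhood_topology
  have add: "continuous_map (prod_topology ?T ?T) ?T (\<lambda>(x, y). x + y)"
    unfolding continuous_map_def
  proof (intro conjI allI impI)
    show "(\<lambda>(x, y). x + y) \<in> topspace (prod_topology ?T ?T) \<rightarrow> topspace ?T"
      by (auto simp: topspace_neighbourhood_topology carrier_add)
    fix U assume U: "openin ?T U"
    show "openin (prod_topology ?T ?T) {z \<in> topspace (prod_topology ?T ?T). (case z of (x, y) \<Rightarrow> x + y) \<in> U}"
      unfolding openin_prod_topology_alt
    proof (intro allI impI)
      fix x y assume "(x, y) \<in> {z \<in> topspace (prod_topology ?T ?T). (case z of (x, y) \<Rightarrow> x + y) \<in> U}"
      then have xy: "x \<in> carrier" "y \<in> carrier" "x + y \<in> U"
        by (auto simp: topspace_neighbourhood_topology)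
      then obtain V where V: "V \<in> zero_neighbourhoods" "\<And>v. v \<in> V \<Longrightarrow> x + y + v \<in> U"
        using U by (auto simp: openin_neighbourhood_topology)
      let ?W = "(\<lambda>x. (1/2) *\<^sub>C x) ` V"
      have W: "?W \<in> zero_neighbourhoods" by (rule zero_neighbourhoods_smul[OF V(1)]) simp
      note hx = open_hull[OF W xy(1)] and hy = open_hull[OF W xy(2)]
      have "open_hull x ?W \<times> open_hull y ?W \<subseteq>
          {z \<in> topspace (prod_topology ?T ?T). (case z of (x, y) \<Rightarrow> x + y) \<in> U}"
      proof
        fix z assume "z \<in> open_hull x ?W \<times> open_hull y ?W"
        then obtain a b where z: "z = (a, b)" "a \<in> open_hull x ?W" "b \<in> open_hull y ?W" by blast
        then obtain v w where vw: "v \<in> V" "w \<in> V" "a = x + (1/2) *\<^sub>C v" "b = y + (1/2) *\<^sub>C w"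
          using hx(3) hy(3) by blast
        have "(1/2) *\<^sub>C v + (1/2) *\<^sub>C w \<in> V"
          by (rule absolutely_convexD[OF zero_neighbourhoodsD(2)[OF V(1)] vw(1,2)]) (simp add: norm_divide)
        then have "x + y + ((1/2) *\<^sub>C v + (1/2) *\<^sub>C w) \<in> U" by (rule V(2))
        moreover have "a + b = x + y + ((1/2) *\<^sub>C v + (1/2) *\<^sub>C w)" by (simp add: vw add_ac)
        moreover have "a \<in> carrier" "b \<in> carrier"
          using openin_subset[OF hx(1)] openin_subset[OF hy(1)] z by (auto simp: topspace_neighbourhood_topology)
        ultimately show "z \<in> {z \<in> topspace (prod_topology ?T ?T). (case z of (x, y) \<Rightarrow> x + y) \<in> U}"
          by (simp add: z topspace_neighbourhood_topology)
      qed
      then show "\<exists>A B. openin ?T A \<and> openin ?T B \<and> x \<in> A \<and> y \<in> B \<and> A \<times> B \<subseteq>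
          {z \<in> topspace (prod_topology ?T ?T). (case z of (x, y) \<Rightarrow> x + y) \<in> U}"
        using hx(1,2) hy(1,2) by blast
    qed
  qed
  have mult: "continuous_map (prod_topology euclidean ?T) ?T (\<lambda>(c, x). c *\<^sub>C x)"
    unfolding continuous_map_def
  proof (intro conjI allI impI)
    show "(\<lambda>(c, x). c *\<^sub>C x) \<in> topspace (prod_topology euclidean ?T) \<rightarrow> topspace ?T"
      by (auto simp: topspace_neighbourhood_topology carrier_smul)
    fix U assume U: "openin ?T U"
    show "openin (prod_topology euclidean ?T)
       {z \<in> topspace (prod_topology euclidean ?T). (case z of (c, x) \<Rightarrow> c *\<^sub>C x) \<in> U}"
      unfolding openin_prod_topology_alt
    proof (intro allI impI)
      fix c x assume "(c, x) \<in> {z \<in> topspace (prod_topology euclidean ?T). (case z of (c, x) \<Rightarrow> c *\<^sub>C x) \<in> U}"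
      then have cx: "x \<in> carrier" "c *\<^sub>C x \<in> U" by (auto simp: topspace_neighbourhood_topology)
      then obtain V where V: "V \<in> zero_neighbourhoods" "\<And>v. v \<in> V \<Longrightarrow> c *\<^sub>C x + v \<in> U"
        using U by (auto simp: openin_neighbourhood_topology)
      obtain k r where xkr: "x \<in> step_ball k r" using cx(1) by (auto simp: carrier_iff)
      obtain e where e: "e > 0" "step_ball k e \<subseteq> V" using zero_neighbourhoodsD(4)[OF V(1)] by blast
      \<comment> \<open>a change of the scalar by \<open>d\<close> and of the vector by \<open>m V\<close> each cost at most half of \<open>V\<close>\<close>
      define d where "d = e / (2 * (r + 1))"
      have r: "0 \<le> r" by (rule step_ball_radius_nonneg[OF xkr])
      have d: "d > 0" using e(1) r by (simp add: d_def)
      have dr: "2 * d * r \<le> e" using e(1) r by (simp add: d_def field_simps)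
      define m where "m = 1 / (2 * (cmod c + d))"
      have m: "m > 0" using d by (simp add: m_def add_nonneg_pos)
      let ?W = "(\<lambda>x. of_real m *\<^sub>C x) ` V"
      have W: "?W \<in> zero_neighbourhoods" using m by (intro zero_neighbourhoods_smul[OF V(1)]) simp
      note h = open_hull[OF W cx(1)]
      have "ball c d \<times> open_hull x ?W \<subseteq>
         {z \<in> topspace (prod_topology euclidean ?T). (case z of (c, x) \<Rightarrow> c *\<^sub>C x) \<in> U}"
      proof
        fix z assume "z \<in> ball c d \<times> open_hull x ?W"
        then obtain b y where z: "z = (b, y)" "b \<in> ball c d" "y \<in> open_hull x ?W" by blast
        then obtain v where v: "v \<in> V" "y = x + of_real m *\<^sub>C v" using h(3) by blast
        have bc: "cmod (b - c) \<le> d" using z(2) by (simp add: dist_norm norm_minus_commute)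
        have "(2 * (b - c)) *\<^sub>C x \<in> step_ball k (cmod (2 * (b - c)) * r)" by (rule step_ball_smul[OF xkr])
        moreover have "cmod (2 * (b - c)) * r \<le> e"
          using mult_right_mono[OF bc, of "2 * r"] r dr unfolding norm_mult by simp
        ultimately have "(2 * (b - c)) *\<^sub>C x \<in> V" using step_ball_mono e(2) by blast
        moreover have "cmod b \<le> cmod c + d" using bc norm_triangle_sub[of b c] by simp
        then have "cmod b * m \<le> (cmod c + d) * m" using m by (intro mult_right_mono) auto
        then have "cmod (b * of_real m) \<le> 1 / 2"
        proof -
          have "cmod (b * of_real m) = cmod b * m" using m by (simp add: norm_mult)
          moreover have "0 < cmod c + d" using d by (simp add: add_nonneg_pos)
          then have "(cmod c + d) * m = 1 / 2" by (simp add: m_def)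
          ultimately show ?thesis using \<open>cmod b * m \<le> (cmod c + d) * m\<close> by linarith
        qed
        ultimately have "(1/2) *\<^sub>C ((2 * (b - c)) *\<^sub>C x) + (b * of_real m) *\<^sub>C v \<in> V"
          using v(1) by (intro absolutely_convexD[OF zero_neighbourhoodsD(2)[OF V(1)]]) auto
        then have "c *\<^sub>C x + ((1/2) *\<^sub>C ((2 * (b - c)) *\<^sub>C x) + (b * of_real m) *\<^sub>C v) \<in> U" by (rule V(2))
        moreover have "b *\<^sub>C y = c *\<^sub>C x + ((1/2) *\<^sub>C ((2 * (b - c)) *\<^sub>C x) + (b * of_real m) *\<^sub>C v)"
          by (simp add: v smul_def fun_eq_iff algebra_simps)
        moreover have "y \<in> carrier"
          using openin_subset[OF h(1)] z by (auto simp: topspace_neighbourhood_topology)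
        ultimately show "z \<in> {z \<in> topspace (prod_topology euclidean ?T). (case z of (c, x) \<Rightarrow> c *\<^sub>C x) \<in> U}"
          by (simp add: z topspace_neighbourhood_topology)
      qed
      then show "\<exists>A B. openin euclidean A \<and> openin ?T B \<and> c \<in> A \<and> x \<in> B \<and> A \<times> B \<subseteq>
         {z \<in> topspace (prod_topology euclidean ?T). (case z of (c, x) \<Rightarrow> c *\<^sub>C x) \<in> U}"
        using h(1,2) d by (intro exI[of _ "ball c d"] exI[of _ "open_hull x ?W"]) auto
    qed
  qed
  have conv: "\<exists>V. openin ?T V \<and> 0 \<in> V \<and> convex_cset V \<and> V \<subseteq> U" if U: "openin ?T U \<and> 0 \<in> U" for U
  proof -
    obtain V where V: "V \<in> zero_neighbourhoods" "\<And>v. v \<in> V \<Longrightarrow> 0 + v \<in> U"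
      using U unfolding openin_neighbourhood_topology by blast
    then show ?thesis
      using open_hull[OF V(1) zero_in_carrier] by (intro exI[of _ "open_hull 0 V"]) auto
  qed
  have "Hausdorff_space ?T"
    unfolding Hausdorff_space_def
  proof (intro allI impI)
    fix x y assume "x \<in> topspace ?T \<and> y \<in> topspace ?T \<and> x \<noteq> y"
    then obtain n where xy: "x \<in> carrier" "y \<in> carrier" "x n \<noteq> y n"
      by (auto simp: topspace_neighbourhood_topology fun_eq_iff)
    then have "n \<noteq> 0" using carrier_at_0[of x] carrier_at_0[of y] by metis
    define d where "d = cmod (x n - y n) / 3"
    have d: "d > 0" using xy by (simp add: d_def)
    define V where "V = {v \<in> carrier. cmod (v n) \<le> d}"
    have V: "V \<in> zero_neighbourhoods"
    proof -
      have "absolutely_convex V"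
        unfolding absolutely_convex_def
      proof (intro ballI allI impI)
        fix v w a b assume *: "v \<in> V" "w \<in> V" "cmod a + cmod b \<le> 1"
        have "cmod (a * v n + b * w n) \<le> cmod a * d + cmod b * d"
          using * by (intro order_trans[OF norm_triangle_ineq] add_mono) (auto simp: norm_mult V_def intro: mult_left_mono)
        also have "\<dots> \<le> d" using mult_right_mono[OF *(3), of d] d by (simp add: distrib_right)
        finally show "a *\<^sub>C v + b *\<^sub>C w \<in> V"
          using * by (auto simp: V_def smul_def[of a] smul_def[of b] intro!: carrier_add carrier_smul)
             (auto simp: smul_def[symmetric] intro!: carrier_add carrier_smul)
      qed
      moreover have "\<exists>r>0. step_ball k r \<subseteq> V" for k
      proof (intro exI conjI subsetI)
        show "0 < d / s k powr \<alpha> n" using d s_pos[of k] by simp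
        fix v assume v: "v \<in> step_ball k (d / s k powr \<alpha> n)"
        then have "cmod (v n) \<le> d / s k powr \<alpha> n * s k powr \<alpha> n"
          by (rule step_ballD) (use \<open>n \<noteq> 0\<close> in simp)
        then show "v \<in> V"
          using v step_ball_subset_carrier s_pos[of k] by (auto simp: V_def)
      qed
      ultimately show ?thesis by (auto simp: zero_neighbourhoods_def V_def)
    qed
    note hx = open_hull[OF V xy(1)] and hy = open_hull[OF V xy(2)]
    have "disjnt (open_hull x V) (open_hull y V)"
    proof (rule ccontr)
      assume "\<not> disjnt (open_hull x V) (open_hull y V)"
      then obtain v where "v \<in> open_hull x V" "v \<in> open_hull y V" by (auto simp: disjnt_def)
      then obtain u w where uw: "u \<in> V" "w \<in> V" "x + u = y + w"
        using subsetD[OF hx(3)] subsetD[OF hy(3)] by (metis imageE)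
      then have "x n + u n = y n + w n" by (metis plus_fun_apply)
      then have "x n - y n = w n - u n" by (simp add: algebra_simps)
      then have "cmod (x n - y n) \<le> d + d"
        using uw norm_triangle_ineq4[of "w n" "u n"] by (simp add: V_def)
      then show False using d by (simp add: d_def)
    qed
    then show "\<exists>U V. openin ?T U \<and> openin ?T V \<and> x \<in> U \<and> y \<in> V \<and> disjnt U V"
      using hx hy by blast
  qed
  then show ?thesis
    using carrier_subspace add mult conv by (simp add: lc_hausdorff_def topspace_neighbourhood_topology)
qed

lemma compatible_neighbourhood_topology:
  "compatible_lc_topology (\<lambda>k n. s k powr (- \<alpha> n)) neighbourhood_topology"
proof -
  have "continuous_map (c0_topology (\<lambda>n. s k powr (- \<alpha> n))) neighbourhood_topology (\<lambda>x. x)" for k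
  proof -
    let ?w = "\<lambda>n. s k powr (- \<alpha> n)"
    have w: "?w n > 0" for n using s_pos[of k] by simp
    interpret M: Metric_space "c0 ?w" "c0_dist ?w" by (rule Metric_space_c0_dist) (rule w)
    have sub: "c0 ?w \<subseteq> carrier" by (auto simp: carrier_def)
    show ?thesis
      unfolding c0_topology_def continuous_map_def
    proof (intro conjI allI impI)
      show "(\<lambda>x. x) \<in> topspace M.mtopology \<rightarrow> topspace neighbourhood_topology"
        using sub by (auto simp: topspace_neighbourhood_topology)
      fix U assume U: "openin neighbourhood_topology U"
      show "openin M.mtopology {x \<in> topspace M.mtopology. x \<in> U}"
        unfolding M.openin_mtopology
      proof (intro conjI allI impI)
        fix x assume "x \<in> {x \<in> topspace M.mtopology. x \<in> U}"
        then have x: "x \<in> c0 ?w" "x \<in> U" by auto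
        then obtain V where V: "V \<in> zero_neighbourhoods" "\<And>v. v \<in> V \<Longrightarrow> x + v \<in> U"
          using U by (auto simp: openin_neighbourhood_topology)
        obtain r where r: "r > 0" "step_ball k r \<subseteq> V" using zero_neighbourhoodsD(4)[OF V(1)] by blast
        have "y \<in> U" if "y \<in> M.mball x r" for y
        proof -
          have y: "y \<in> c0 ?w" "c0_dist ?w y x < r" using that by (auto simp: M.commute)
          have "y - x \<in> step_ball k r"
            using y x cseq.subspace_diff[OF c0_subspace[of ?w, OF w] y(1) x(1)]
            by (intro c0_norm_le_imp_step_ball) (auto simp: c0_dist_def)
          then have "x + (y - x) \<in> U" using V(2) r(2) by blast
          then show ?thesis by simp
        qed
        then show "\<exists>r>0. M.mball x r \<subseteq> {x \<in> topspace M.mtopology. x \<in> U}" using r(1) by auto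
      qed auto
    qed
  qed
  then show ?thesis
    using lc_hausdorff_neighbourhood_topology
    by (simp add: compatible_lc_topology_def topspace_neighbourhood_topology carrier_def)
qed

abbreviation "E \<equiv> E_space s \<alpha>"

lemma E_compatible: "compatible_lc_topology (\<lambda>k n. s k powr (- \<alpha> n)) E"
  by (rule E_space_finest(1)) (use \<alpha>_pos s_gt_1 s_mono in auto)

lemma topspace_E: "topspace E = carrier"
  using E_compatible by (simp add: compatible_lc_topology_def carrier_def)

text \<open>
  Every neighbourhood of zero contains a convex one, whose balanced core is absolutely convex. The core
  still contains a ball of every step, because balls are balanced and the inclusions of the steps are
  continuous.
\<close>

lemma E_neighbourhood_of_zero:
  assumes U: "openin E U" "0 \<in> U"
  shows "\<exists>V\<in>zero_neighbourhoods. V \<subseteq> U"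
proof -
  obtain W where W: "openin E W" "0 \<in> W" "convex_cset W" "W \<subseteq> U"
    using E_compatible U unfolding compatible_lc_topology_def lc_hausdorff_def by blast
  define V where "V = {x. \<forall>c. cmod c \<le> 1 \<longrightarrow> c *\<^sub>C x \<in> W}"
  have VW: "x \<in> W" if "x \<in> V" for x using that[unfolded V_def mem_Collect_eq, rule_format, of 1] by simp
  have "absolutely_convex V"
    unfolding absolutely_convex_def
  proof (intro ballI allI impI)
    fix x y a b assume *: "x \<in> V" "y \<in> V" "cmod a + cmod b \<le> 1"
    show "a *\<^sub>C x + b *\<^sub>C y \<in> V"
      unfolding V_def
    proof (intro CollectI allI impI)
      fix c :: complex assume c: "cmod c \<le> 1"
      define t where "t = cmod b"
      have t: "0 \<le> t" "t \<le> 1" "cmod a \<le> 1 - t" using *(3) norm_ge_zero[of a] norm_ge_zero[of b] unfolding t_def by linarith+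
      have p: "\<exists>u\<in>W. (c * d) *\<^sub>C v = of_real q *\<^sub>C u" if "v \<in> V" "cmod d \<le> q" for v d q
      proof (cases "q = 0")
        case True
        then show ?thesis using that W(2) by (intro bexI[of _ 0]) auto
      next
        case False
        then have q: "q > 0" using that(2) norm_ge_zero[of d] by linarith
        have "cmod (c * d) \<le> 1 * q" using c that(2) unfolding norm_mult by (intro mult_mono) auto
        then have "cmod (c * d / of_real q) \<le> 1" using q by (simp add: norm_divide)
        then have "(c * d / of_real q) *\<^sub>C v \<in> W" using that(1) by (simp add: V_def)
        then show ?thesis using False by (intro bexI[of _ "(c * d / of_real q) *\<^sub>C v"]) auto
      qed
      obtain u w where uw: "u \<in> W" "w \<in> W" "(c * a) *\<^sub>C x = of_real (1 - t) *\<^sub>C u" "(c * b) *\<^sub>C y = of_real t *\<^sub>C w"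
        using p[OF *(1) t(3)] p[OF *(2), of b t] by (auto simp: t_def)
      have "c *\<^sub>C (a *\<^sub>C x + b *\<^sub>C y) = (c * a) *\<^sub>C x + (c * b) *\<^sub>C y"
        by (simp add: smul_def fun_eq_iff algebra_simps)
      then show "c *\<^sub>C (a *\<^sub>C x + b *\<^sub>C y) \<in> W"
        using W(3) uw t(1,2) by (simp add: convex_cset_def)
    qed
  qed
  moreover have "\<exists>r>0. step_ball k r \<subseteq> V" for k
  proof -
    let ?w = "\<lambda>n. s (Suc k) powr (- \<alpha> n)"
    have w: "?w n > 0" for n using s_pos[of "Suc k"] by simp
    interpret M: Metric_space "c0 ?w" "c0_dist ?w" by (rule Metric_space_c0_dist) (rule w)
    have z: "0 \<in> c0 ?w" by (simp add: c0_def)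
    let ?X = "{x \<in> topspace M.mtopology. x \<in> W}"
    have "continuous_map M.mtopology E (\<lambda>x. x)"
      using E_compatible unfolding compatible_lc_topology_def c0_topology_def by blast
    then have "openin M.mtopology ?X"
      by (rule openin_continuous_map_preimage[OF _ W(1)])
    then have "\<forall>x. x \<in> ?X \<longrightarrow> (\<exists>r>0. M.mball x r \<subseteq> ?X)" unfolding M.openin_mtopology by (elim conjunct2)
    moreover have "0 \<in> ?X" by (simp add: W(2) z)
    ultimately obtain r where r: "r > 0" "M.mball 0 r \<subseteq> ?X" by blast
    have "x \<in> V" if x: "x \<in> step_ball k (r / 2)" for x
      unfolding V_def
    proof (intro CollectI allI impI)
      fix c :: complex assume c: "cmod c \<le> 1"
      have "cmod c * (r / 2) \<le> 1 * (r / 2)" using c r(1) by (intro mult_right_mono) auto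
      then have cx: "c *\<^sub>C x \<in> step_ball k (r / 2)"
        using step_ball_mono[OF step_ball_smul[OF x, of c], of k "r / 2"] by simp
      have "c0_norm ?w (c *\<^sub>C x) \<le> r / 2" by (rule c0_norm_step_ball[OF cx])
      moreover have "c0_norm ?w (0 - c *\<^sub>C x) = c0_norm ?w (c *\<^sub>C x)" by (simp add: c0_norm_def)
      ultimately have "c *\<^sub>C x \<in> M.mball 0 r"
        using cx step_ball_subset_c0[of k "r / 2"] r(1) z by (auto simp: c0_dist_def)
      then show "c *\<^sub>C x \<in> W" using r(2) by blast
    qed
    then show ?thesis using r(1) by (intro exI[of _ "r / 2"]) auto
  qed
  moreover have "V \<subseteq> carrier" using VW openin_subset[OF W(1)] by (auto simp: topspace_E)
  ultimately have "V \<in> zero_neighbourhoods" by (simp add: zero_neighbourhoods_def)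
  then show ?thesis using VW W(4) by blast
qed

text \<open>
  The topology of \<open>E\<close> is the one given by the absolutely convex sets that contain a ball of every step:
  this topology is compatible with the inductive limit, so \<open>E\<close> is finer, and the preceding lemma gives
  the converse.
\<close>

lemma openin_E:
  "openin E U \<longleftrightarrow> U \<subseteq> carrier \<and> (\<forall>x\<in>U. \<exists>V\<in>zero_neighbourhoods. \<forall>v\<in>V. x + v \<in> U)"
proof
  assume "U \<subseteq> carrier \<and> (\<forall>x\<in>U. \<exists>V\<in>zero_neighbourhoods. \<forall>v\<in>V. x + v \<in> U)"
  then have "openin neighbourhood_topology U" by (simp add: openin_neighbourhood_topology)
  then show "openin E U"
    by (rule E_space_finest(2)[rotated -1, OF _ _ _ _ compatible_neighbourhood_topology])
      (use \<alpha>_pos s_gt_1 s_mono in auto)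
next
  assume U: "openin E U"
  have sub: "U \<subseteq> carrier" using openin_subset[OF U] by (simp add: topspace_E)
  have "\<exists>V\<in>zero_neighbourhoods. \<forall>v\<in>V. x + v \<in> U" if x: "x \<in> U" for x
  proof -
    have "continuous_map (prod_topology E E) E (\<lambda>(x, y). x + y)"
      using E_compatible unfolding compatible_lc_topology_def lc_hausdorff_def by blast
    moreover have "continuous_map E (prod_topology E E) (\<lambda>v. (x, v))"
      by (rule continuous_map_pairedI) (use x sub in \<open>auto simp: topspace_E\<close>)
    ultimately have "continuous_map E E ((\<lambda>(x, y). x + y) \<circ> (\<lambda>v. (x, v)))"
      by (metis continuous_map_compose)
    then have "openin E {v \<in> topspace E. ((\<lambda>(x, y). x + y) \<circ> (\<lambda>v. (x, v))) v \<in> U}"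
      by (rule openin_continuous_map_preimage[OF _ U])
    moreover have "0 \<in> {v \<in> topspace E. ((\<lambda>(x, y). x + y) \<circ> (\<lambda>v. (x, v))) v \<in> U}"
      using x zero_in_carrier by (simp add: topspace_E)
    ultimately obtain V where V: "V \<in> zero_neighbourhoods" "V \<subseteq> {v \<in> topspace E. ((\<lambda>(x, y). x + y) \<circ> (\<lambda>v. (x, v))) v \<in> U}"
      using E_neighbourhood_of_zero by blast
    have "x + v \<in> U" if "v \<in> V" for v using subsetD[OF V(2) that] by simp
    then show ?thesis using V(1) by blast
  qed
  then show "U \<subseteq> carrier \<and> (\<forall>x\<in>U. \<exists>V\<in>zero_neighbourhoods. \<forall>v\<in>V. x + v \<in> U)"
    using sub by blast
qed

end

section \<open>Equicontinuity and resolvents from estimates on the steps\<close>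

lemma cesaro_add: "cesaro (x + y) = cesaro x + cesaro y"
  by (simp add: cesaro_def fun_eq_iff sum.distrib add_divide_distrib)

lemma cesaro_smul: "cesaro (c *\<^sub>C x) = c *\<^sub>C cesaro x"
  by (simp add: cesaro_def fun_eq_iff smul_def sum_distrib_left)

lemma cesaro_equation_add: "l *\<^sub>C (x + y) - cesaro (x + y) = (l *\<^sub>C x - cesaro x) + (l *\<^sub>C y - cesaro y)"
  unfolding cesaro_add by (simp add: fun_eq_iff smul_def algebra_simps)

lemma cesaro_equation_smul: "l *\<^sub>C (c *\<^sub>C x) - cesaro (c *\<^sub>C x) = c *\<^sub>C (l *\<^sub>C x - cesaro x)"
  unfolding cesaro_smul by (simp add: fun_eq_iff smul_def algebra_simps)

lemma sum_seq_apply: "(\<Sum>n<N. (f :: nat \<Rightarrow> nat \<Rightarrow> complex) n) j = (\<Sum>n<N. f n j)"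
  by (induction N) auto

context growth_space
begin

text \<open>
  The target step and the bound are common to the whole family; equicontinuity rests on this uniformity.
\<close>

definition step_bounded_family :: "((nat \<Rightarrow> complex) \<Rightarrow> nat \<Rightarrow> complex) set \<Rightarrow> bool"
  where "step_bounded_family F \<longleftrightarrow>
    (\<forall>k. \<exists>l B. \<forall>A\<in>F. \<forall>r. \<forall>x\<in>step_ball k r. A x \<in> step_ball l (B * r))"

text \<open>
  A common preimage of an absolutely convex set under linear maps is absolutely convex, and uniform
  boundedness on the steps provides the balls. Continuity and equicontinuity both follow from this.
\<close>

lemma preimage_zero_neighbourhood:
  assumes F: "\<And>A. A \<in> F \<Longrightarrow> linear_operator_on carrier A" "step_bounded_family F"
    and V: "V \<in> zero_neighbourhoods"
  shows "{x \<in> carrier. \<forall>A\<in>F. A x \<in> V} \<in> zero_neighbourhoods"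
proof -
  let ?W = "{x \<in> carrier. \<forall>A\<in>F. A x \<in> V}"
  have "absolutely_convex ?W"
    unfolding absolutely_convex_def
  proof (intro ballI allI impI)
    fix x y a b assume *: "x \<in> ?W" "y \<in> ?W" "cmod a + cmod b \<le> 1"
    then have c: "x \<in> carrier" "y \<in> carrier" by auto
    have "A (a *\<^sub>C x + b *\<^sub>C y) \<in> V" if A: "A \<in> F" for A
    proof -
      have "A (a *\<^sub>C x + b *\<^sub>C y) = a *\<^sub>C A x + b *\<^sub>C A y"
        using F(1)[OF A] c carrier_smul unfolding linear_operator_on_def by metis
      then show ?thesis
        using absolutely_convexD[OF zero_neighbourhoodsD(2)[OF V] _ _ *(3), of "A x" "A y"] * A by simp
    qed
    then show "a *\<^sub>C x + b *\<^sub>C y \<in> ?W" using c carrier_add carrier_smul by simp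
  qed
  moreover have "\<exists>r>0. step_ball k r \<subseteq> ?W" for k
  proof -
    obtain l B where B: "\<And>A r x. A \<in> F \<Longrightarrow> x \<in> step_ball k r \<Longrightarrow> A x \<in> step_ball l (B * r)"
      using F(2) unfolding step_bounded_family_def by metis
    obtain e where e: "e > 0" "step_ball l e \<subseteq> V" using zero_neighbourhoodsD(4)[OF V] by blast
    define r where "r = e / (\<bar>B\<bar> + 1)"
    have r: "r > 0" using e(1) by (simp add: r_def)
    have "B * r \<le> (\<bar>B\<bar> + 1) * r" using r by (intro mult_right_mono) auto
    then have Br: "B * r \<le> e" by (simp add: r_def)
    have "step_ball k r \<subseteq> ?W"
    proof
      fix x assume x: "x \<in> step_ball k r"
      have "A x \<in> V" if "A \<in> F" for A
        using step_ball_mono[OF B[OF that x] order_refl Br] e(2) by blast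
      then show "x \<in> ?W" using x step_ball_subset_carrier by blast
    qed
    then show ?thesis using r by blast
  qed
  ultimately show ?thesis by (simp add: zero_neighbourhoods_def)
qed

lemma step_bounded_imp_carrier:
  assumes "step_bounded_family F" "A \<in> F" "x \<in> carrier"
  shows "A x \<in> carrier"
  using assms unfolding step_bounded_family_def carrier_iff by metis

lemma step_bounded_continuous:
  assumes F: "\<And>A. A \<in> F \<Longrightarrow> linear_operator_on carrier A" "step_bounded_family F" and A: "A \<in> F"
  shows "A \<in> \<L> E"
proof -
  have "continuous_map E E A"
    unfolding continuous_map_def
  proof (intro conjI allI impI)
    show "A \<in> topspace E \<rightarrow> topspace E"
      using step_bounded_imp_carrier[OF F(2) A] by (simp add: topspace_E)
    fix U assume U: "openin E U"
    show "openin E {x \<in> topspace E. A x \<in> U}"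
      unfolding openin_E
    proof (intro conjI ballI)
      show "{x \<in> topspace E. A x \<in> U} \<subseteq> carrier" by (auto simp: topspace_E)
      fix x assume "x \<in> {x \<in> topspace E. A x \<in> U}"
      then have x: "x \<in> carrier" "A x \<in> U" by (auto simp: topspace_E)
      then obtain V where V: "V \<in> zero_neighbourhoods" "\<And>v. v \<in> V \<Longrightarrow> A x + v \<in> U"
        using U unfolding openin_E by metis
      have "x + v \<in> {x \<in> topspace E. A x \<in> U}" if "v \<in> {x \<in> carrier. \<forall>A\<in>F. A x \<in> V}" for v
      proof -
        have v: "v \<in> carrier" "A v \<in> V" using that A by auto
        have "A (x + v) = A x + A v"
          using F(1)[OF A] x(1) v(1) by (simp add: linear_operator_on_def)
        then show ?thesis using V(2)[OF v(2)] carrier_add[OF x(1) v(1)] by (simp add: topspace_E)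
      qed
      then show "\<exists>V\<in>zero_neighbourhoods. \<forall>v\<in>V. x + v \<in> {x \<in> topspace E. A x \<in> U}"
        using preimage_zero_neighbourhood[OF F V(1)] by blast
    qed
  qed
  then show ?thesis using F(1)[OF A] by (simp add: continuous_operators_def topspace_E)
qed

lemma step_bounded_equicontinuous:
  assumes F: "\<And>A. A \<in> F \<Longrightarrow> linear_operator_on carrier A" "step_bounded_family F"
  shows "equicontinuous_ops E F"
  unfolding equicontinuous_ops_def
proof (intro conjI allI impI)
  show "F \<subseteq> \<L> E" using step_bounded_continuous[OF F] by blast
  fix U assume U: "openin E U \<and> 0 \<in> U"
  then obtain V where V: "V \<in> zero_neighbourhoods" "V \<subseteq> U" using E_neighbourhood_of_zero by blast
  let ?W = "{x \<in> carrier. \<forall>A\<in>F. A x \<in> V}"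
  have W: "?W \<in> zero_neighbourhoods" by (rule preimage_zero_neighbourhood[OF F V(1)])
  have op: "openin E (open_hull 0 ?W)"
    using open_hull(1)[OF W zero_in_carrier] unfolding openin_neighbourhood_topology openin_E .
  have sub: "open_hull 0 ?W \<subseteq> ?W" using open_hull(3)[OF W zero_in_carrier] by simp
  have "\<forall>A\<in>F. A ` open_hull 0 ?W \<subseteq> U"
  proof (intro ballI image_subsetI)
    fix A x assume "A \<in> F" "x \<in> open_hull 0 ?W"
    then show "A x \<in> U" using subsetD[OF sub] V(2) by blast
  qed
  then show "\<exists>V. openin E V \<and> 0 \<in> V \<and> (\<forall>A\<in>F. A ` V \<subseteq> U)"
    using op open_hull(2)[OF W zero_in_carrier] by blast
qed

lemma powr_s_mono:
  assumes "1 \<le> m" "m \<le> n"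
  shows "s k powr \<alpha> m \<le> s k powr \<alpha> n"
proof (intro powr_mono)
  show "\<alpha> m \<le> \<alpha> n"
    using strict_mono_onD[OF \<alpha>_mono, of m n] assms by (cases "m = n") auto
  show "1 \<le> s k" using s_gt_1[of k] by simp
qed

lemma cesaro_step_ball:
  assumes x: "x \<in> step_ball k r"
  shows "cesaro x \<in> step_ball k r"
proof -
  have "cmod (cesaro x n) \<le> r * s k powr \<alpha> n" if n: "n \<ge> 1" for n
  proof -
    have "cmod (\<Sum>i = 1..n. x i) \<le> (\<Sum>i = 1..n. r * s k powr \<alpha> n)"
    proof (rule sum_norm_le)
      fix i assume i: "i \<in> {1..n}"
      then have "cmod (x i) \<le> r * s k powr \<alpha> i" using step_ballD[OF x] by simp
      also have "\<dots> \<le> r * s k powr \<alpha> n"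
        using powr_s_mono[of i n k] i step_ball_radius_nonneg[OF x] by (intro mult_left_mono) auto
      finally show "cmod (x i) \<le> r * s k powr \<alpha> n" .
    qed
    then show ?thesis using n by (simp add: cesaro_def norm_divide divide_le_eq mult_ac)
  qed
  then show ?thesis by (simp add: step_ball_def cesaro_def)
qed

lemma cesaro_equation_carrier: "x \<in> carrier \<Longrightarrow> l *\<^sub>C x - cesaro x \<in> carrier"
  using cesaro_step_ball carrier_iff carrier_diff carrier_smul by metis

text \<open>
  An a priori estimate for all solutions \<open>x\<close> of the equation, without the assumption \<open>x \<in> E\<close>, yields
  everything at once: the formal solution lies in \<open>E\<close>, the case \<open>r = 0\<close> gives injectivity, and the
  estimate itself is the bound for the resolvent, uniform over the parameters \<open>Z\<close>.
\<close>

lemma resolvent_of_step_estimate: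
  assumes Z: "\<And>l. l \<in> Z \<Longrightarrow> l \<noteq> 0" "\<And>l n. l \<in> Z \<Longrightarrow> n \<ge> 1 \<Longrightarrow> 1 / l \<noteq> of_nat n"
    and est: "\<And>k. \<exists>m B. \<forall>l\<in>Z. \<forall>r. \<forall>y\<in>step_ball k r. \<forall>x. x 0 = 0 \<longrightarrow>
        l *\<^sub>C x - cesaro x = y \<longrightarrow> x \<in> step_ball m (B * r)"
  shows "Z \<subseteq> resolvent_set E cesaro" "equicontinuous_ops E (resolvent_op E cesaro ` Z)"
proof -
  let ?T = "\<lambda>l x. l *\<^sub>C x - cesaro x" and ?R = "resolvent_op E cesaro"
  have inj: "inj_on (?T l) carrier" if l: "l \<in> Z" for l
  proof (rule inj_onI)
    fix x x' assume x: "x \<in> carrier" "x' \<in> carrier" "?T l x = ?T l x'"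
    obtain m B where mB: "\<And>y x. y \<in> step_ball 0 0 \<Longrightarrow> x 0 = 0 \<Longrightarrow> ?T l x = y \<Longrightarrow> x \<in> step_ball m (B * 0)"
      using est[of 0] l by metis
    have "?T l (x + (-1) *\<^sub>C x') = 0"
      unfolding cesaro_equation_add cesaro_equation_smul x(3) by (simp add: smul_def fun_eq_iff)
    then have "x + (-1) *\<^sub>C x' \<in> step_ball m (B * 0)"
      using zero_in_step_ball[of 0 0] carrier_at_0[OF x(1)] carrier_at_0[OF x(2)]
      by (intro mB[OF _ _ refl]) (simp_all add: smul_def[of "-1" x'])
    then have "x n = x' n" for n
      using step_ballD[of "x + (-1) *\<^sub>C x'" m 0 n] carrier_at_0[OF x(1)] carrier_at_0[OF x(2)]
      by (cases "n = 0") (simp_all add: smul_def)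
    then show "x = x'" by blast
  qed
  have surj: "?T l ` carrier = carrier" if l: "l \<in> Z" for l
  proof (intro equalityI subsetI)
    fix y assume "y \<in> ?T l ` carrier"
    then show "y \<in> carrier" using cesaro_equation_carrier by blast
  next
    fix y assume y: "y \<in> carrier"
    obtain x where x: "x 0 = 0" "?T l x = y"
      using cesaro_equation_solvable[of l y] Z l carrier_at_0[OF y] by blast
    obtain k r where "y \<in> step_ball k r" using y carrier_iff by blast
    then have "x \<in> carrier" using est[of k] l x carrier_iff by metis
    then show "y \<in> ?T l ` carrier" using x(2) by blast
  qed
  have R: "?R l y \<in> carrier" "?T l (?R l y) = y" if "l \<in> Z" "y \<in> carrier" for l y
    using that surj[OF that(1)] inv_into_into[of y "?T l" carrier] f_inv_into_f[of y "?T l" carrier]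
    by (simp_all add: resolvent_op_def topspace_E)
  have RI: "?R l y = x" if "l \<in> Z" "x \<in> carrier" "?T l x = y" for l x y
    using inv_into_f_eq[of "?T l" carrier x y] inj that by (simp add: resolvent_op_def topspace_E)
  have lin: "linear_operator_on carrier A" if "A \<in> ?R ` Z" for A
  proof -
    from that obtain l where l: "l \<in> Z" "A = ?R l" by blast
    have "?R l (x + y) = ?R l x + ?R l y" if "x \<in> carrier" "y \<in> carrier" for x y
      by (rule RI[OF l(1)]) (simp_all only: cesaro_equation_add R[OF l(1)] carrier_add that)
    moreover have "?R l (c *\<^sub>C x) = c *\<^sub>C ?R l x" if "x \<in> carrier" for x c
      by (rule RI[OF l(1)]) (simp_all only: cesaro_equation_smul R[OF l(1)] carrier_smul that)
    ultimately show ?thesis by (simp add: linear_operator_on_def l(2))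
  qed
  have bd: "step_bounded_family (?R ` Z)"
    unfolding step_bounded_family_def
  proof
    fix k
    obtain m B where mB: "\<And>l r y x. l \<in> Z \<Longrightarrow> y \<in> step_ball k r \<Longrightarrow> x 0 = 0 \<Longrightarrow> ?T l x = y \<Longrightarrow> x \<in> step_ball m (B * r)"
      using est[of k] by metis
    have "?R l y \<in> step_ball m (B * r)" if "l \<in> Z" "y \<in> step_ball k r" for l r y
      using subsetD[OF step_ball_subset_carrier that(2)] R that carrier_at_0 mB by metis
    then show "\<exists>l B. \<forall>A\<in>?R ` Z. \<forall>r. \<forall>x\<in>step_ball k r. A x \<in> step_ball l (B * r)" by blast
  qed
  show "equicontinuous_ops E (?R ` Z)" by (rule step_bounded_equicontinuous[OF lin bd])
  show "Z \<subseteq> resolvent_set E cesaro"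
  proof
    fix l assume "l \<in> Z"
    then show "l \<in> resolvent_set E cesaro"
      using step_bounded_continuous[OF lin bd, of "?R l"] inj[of l] surj[of l]
      unfolding resolvent_set_def bij_betw_def topspace_E by blast
  qed
qed

lemma unsolvable_imp_spectrum:
  assumes "y \<in> carrier" "\<And>x. x \<in> carrier \<Longrightarrow> l *\<^sub>C x - cesaro x = y \<Longrightarrow> False"
  shows "l \<in> spectrum E cesaro"
proof -
  have "y \<notin> (\<lambda>x. l *\<^sub>C x - cesaro x) ` carrier" using assms(2) by blast
  then show ?thesis
    using assms(1) unfolding spectrum_def resolvent_set_def bij_betw_def topspace_E by blast
qed

section \<open>Nuclearity\<close>

lemma step_bounded_seminorm_continuous:
  assumes nonneg: "\<And>x. x \<in> carrier \<Longrightarrow> 0 \<le> q x"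
    and add: "\<And>x y. x \<in> carrier \<Longrightarrow> y \<in> carrier \<Longrightarrow> q (x + y) \<le> q x + q y"
    and smul: "\<And>c x. x \<in> carrier \<Longrightarrow> q (c *\<^sub>C x) = cmod c * q x"
    and bd: "\<And>k. \<exists>B. \<forall>r. \<forall>x\<in>step_ball k r. q x \<le> B * r"
  shows "continuous_seminorm E q"
proof -
  have V: "{x \<in> carrier. q x \<le> e} \<in> zero_neighbourhoods" if e: "e > 0" for e
  proof -
    have "absolutely_convex {x \<in> carrier. q x \<le> e}"
      unfolding absolutely_convex_def
    proof (intro ballI allI impI)
      fix x y a b assume *: "x \<in> {x \<in> carrier. q x \<le> e}" "y \<in> {x \<in> carrier. q x \<le> e}" "cmod a + cmod b \<le> 1"
      have "q (a *\<^sub>C x + b *\<^sub>C y) \<le> q (a *\<^sub>C x) + q (b *\<^sub>C y)"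
        using * by (intro add carrier_smul) auto
      also have "\<dots> = cmod a * q x + cmod b * q y" using * smul by simp
      also have "\<dots> \<le> cmod a * e + cmod b * e" using * by (intro add_mono mult_left_mono) auto
      also have "\<dots> \<le> e" using mult_right_mono[OF *(3), of e] e by (simp add: distrib_right)
      finally show "a *\<^sub>C x + b *\<^sub>C y \<in> {x \<in> carrier. q x \<le> e}"
        using * carrier_add carrier_smul by simp
    qed
    moreover have "\<exists>r>0. step_ball k r \<subseteq> {x \<in> carrier. q x \<le> e}" for k
    proof -
      obtain B where B: "\<And>r x. x \<in> step_ball k r \<Longrightarrow> q x \<le> B * r" using bd by metis
      define r where "r = e / (\<bar>B\<bar> + 1)"
      have r: "r > 0" using e by (simp add: r_def)
      have "B * r \<le> (\<bar>B\<bar> + 1) * r" using r by (intro mult_right_mono) auto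
      then have "B * r \<le> e" by (simp add: r_def)
      then have "step_ball k r \<subseteq> {x \<in> carrier. q x \<le> e}"
        using B step_ball_subset_carrier by fastforce
      then show ?thesis using r by blast
    qed
    ultimately show ?thesis by (simp add: zero_neighbourhoods_def)
  qed
  have "continuous_map E euclideanreal q"
    unfolding continuous_map_def
  proof (intro conjI allI impI)
    fix U :: "real set" assume "openin euclideanreal U"
    then have U: "open U" by simp
    show "openin E {x \<in> topspace E. q x \<in> U}"
      unfolding openin_E
    proof (intro conjI ballI)
      show "{x \<in> topspace E. q x \<in> U} \<subseteq> carrier" by (auto simp: topspace_E)
      fix x assume "x \<in> {x \<in> topspace E. q x \<in> U}"
      then have x: "x \<in> carrier" "q x \<in> U" by (auto simp: topspace_E)
      obtain e where e: "e > 0" "cball (q x) e \<subseteq> U" using U x(2) open_contains_cball by blast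
      have "x + v \<in> {x \<in> topspace E. q x \<in> U}" if "v \<in> {x \<in> carrier. q x \<le> e}" for v
      proof -
        have v: "v \<in> carrier" "q v \<le> e" using that by auto
        have xv: "x + v \<in> carrier" by (rule carrier_add[OF x(1) v(1)])
        have "x = (x + v) + (-1) *\<^sub>C v" by (simp add: smul_def fun_eq_iff)
        then have "q x \<le> q (x + v) + q v"
          using add[OF xv carrier_smul[OF v(1)], of "-1"] smul[OF v(1), of "-1"] by simp
        then have "q (x + v) \<in> cball (q x) e"
          using add[OF x(1) v(1)] v(2) by (simp add: dist_real_def abs_le_iff)
        then show ?thesis using e(2) xv by (auto simp: topspace_E)
      qed
      then show "\<exists>V\<in>zero_neighbourhoods. \<forall>v\<in>V. x + v \<in> {x \<in> topspace E. q x \<in> U}"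
        using V[OF e(1)] by blast
    qed
  qed simp
  then show ?thesis using nonneg add smul by (simp add: continuous_seminorm_def topspace_E)
qed

lemma continuous_seminormD:
  assumes "continuous_seminorm E p" "x \<in> carrier"
  shows "0 \<le> p x" "y \<in> carrier \<Longrightarrow> p (x + y) \<le> p x + p y" "p (c *\<^sub>C x) = cmod c * p x"
  using assms by (simp_all add: continuous_seminorm_def topspace_E del: plus_fun_apply)

text \<open>
  By homogeneity a bound on a single ball of the step is a bound on all of them.
\<close>

lemma continuous_seminorm_step_bounded:
  assumes p: "continuous_seminorm E p"
  shows "\<exists>B. \<forall>r. \<forall>x\<in>step_ball k r. p x \<le> B * r"
proof -
  have smul: "p (c *\<^sub>C x) = cmod c * p x" if "x \<in> carrier" for c x
    using p that by (simp add: continuous_seminorm_def topspace_E)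
  have p0: "p 0 = 0" using smul[OF zero_in_carrier, of 0] by simp
  have "continuous_map E euclideanreal p" using p by (simp add: continuous_seminorm_def)
  then have "openin E {x \<in> topspace E. p x \<in> {..<1}}"
    by (rule openin_continuous_map_preimage) simp
  moreover have "0 \<in> {x \<in> topspace E. p x \<in> {..<1}}" using p0 zero_in_carrier by (simp add: topspace_E)
  ultimately obtain V where V: "V \<in> zero_neighbourhoods" "V \<subseteq> {x \<in> topspace E. p x \<in> {..<1}}"
    using E_neighbourhood_of_zero by blast
  obtain e where e: "e > 0" "step_ball k e \<subseteq> V" using zero_neighbourhoodsD(4)[OF V(1)] by blast
  have "p x \<le> 1 / e * r" if x: "x \<in> step_ball k r" for x r
  proof (cases "r = 0")
    case True
    have "x n = 0" for n
      using x True by (cases "n = 0") (simp_all add: step_ball_def)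
    then have "x = 0" by (simp add: fun_eq_iff)
    then show ?thesis using p0 True by simp
  next
    case False
    then have r: "r > 0" using step_ball_radius_nonneg[OF x] by simp
    have "of_real (e / r) *\<^sub>C x \<in> step_ball k e"
      using step_ball_smul[OF x, of "of_real (e / r)"] e r
      unfolding norm_of_real by simp
    then have "p (of_real (e / r) *\<^sub>C x) < 1" using e(2) V(2) by blast
    then have "e / r * p x < 1"
      using smul[OF subsetD[OF step_ball_subset_carrier x], of "of_real (e / r)"] e r
      by (simp del: of_real_divide)
    then show ?thesis using e r by (simp add: field_simps)
  qed
  then show ?thesis by blast
qed

text \<open>
  The unit vectors, with the zero sequence in place of the one with index \<open>0\<close>, which is not in \<open>E\<close>. In
  this way sums over initial segments of the indices need no exception.
\<close>

definition unit_seq :: "nat \<Rightarrow> nat \<Rightarrow> complex"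
  where "unit_seq n = (\<lambda>j. if j = n \<and> n \<noteq> 0 then 1 else 0)"

lemma unit_seq_step_ball: "unit_seq n \<in> step_ball k (s k powr (- \<alpha> n))"
  using s_pos[of k] by (auto simp: unit_seq_def step_ball_def powr_minus)

lemma unit_seq_carrier: "unit_seq n \<in> carrier"
  using unit_seq_step_ball step_ball_subset_carrier by blast

definition tail_seq :: "nat \<Rightarrow> (nat \<Rightarrow> complex) \<Rightarrow> nat \<Rightarrow> complex"
  where "tail_seq N x = (\<lambda>j. if j < N then 0 else x j)"

lemma tail_seq_decomposition:
  assumes "x 0 = 0"
  shows "x = tail_seq N x + (\<Sum>n<N. x n *\<^sub>C unit_seq n)"
proof
  fix j
  have "(\<Sum>n<N. x n *\<^sub>C unit_seq n) j = (\<Sum>n<N. if n = j then x j else 0)"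
    unfolding sum_seq_apply by (intro sum.cong) (auto simp: smul_def unit_seq_def assms)
  also have "\<dots> = (if j < N then x j else 0)" by simp
  finally show "x j = (tail_seq N x + (\<Sum>n<N. x n *\<^sub>C unit_seq n)) j"
    by (simp add: tail_seq_def)
qed

lemma tail_seq_step_ball:
  assumes x: "x \<in> step_ball k r" and N: "N \<ge> 1"
  shows "tail_seq N x \<in> step_ball (Suc k) (r * (s k / s (Suc k)) powr \<alpha> N)"
proof -
  note r = step_ball_radius_nonneg[OF x]
  have lt: "s k < s (Suc k)" using s_mono by (simp add: strict_mono_Suc_iff)
  have "cmod (tail_seq N x j) \<le> r * (s k / s (Suc k)) powr \<alpha> N * s (Suc k) powr \<alpha> j" if j: "j \<ge> 1" for j
  proof (cases "j < N")
    case True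
    then show ?thesis using r by (simp add: tail_seq_def)
  next
    case False
    have "\<alpha> N \<le> \<alpha> j"
      using strict_mono_onD[OF \<alpha>_mono, of N j] N False by (cases "j = N") auto
    then have le: "(s k / s (Suc k)) powr \<alpha> j \<le> (s k / s (Suc k)) powr \<alpha> N"
      using lt s_pos[of k] s_pos[of "Suc k"] by (intro powr_mono') auto
    have "cmod (x j) \<le> r * s k powr \<alpha> j" by (rule step_ballD[OF x j])
    also have "\<dots> = r * (s k / s (Suc k)) powr \<alpha> j * s (Suc k) powr \<alpha> j"
      using s_pos[of k] s_pos[of "Suc k"] by (simp add: powr_divide)
    also have "\<dots> \<le> r * (s k / s (Suc k)) powr \<alpha> N * s (Suc k) powr \<alpha> j"
      using r le by (intro mult_right_mono mult_left_mono) auto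
    finally show ?thesis using False by (simp add: tail_seq_def)
  qed
  then show ?thesis using x by (simp add: step_ball_def tail_seq_def)
qed

text \<open>
  The unit vectors form a basis of \<open>E\<close>: in the next step the norm of the tail from \<open>N\<close> on is at most a
  multiple of \<open>(s k / s (k + 1)) powr \<alpha> N\<close>.
\<close>

lemma seminorm_tail_tendsto:
  assumes p: "continuous_seminorm E p" and x: "x \<in> carrier"
  shows "(\<lambda>N. p (tail_seq N x)) \<longlonglongrightarrow> 0"
proof -
  obtain k r where x: "x \<in> step_ball k r" using x carrier_iff by blast
  obtain B where B: "\<And>r x. x \<in> step_ball (Suc k) r \<Longrightarrow> p x \<le> B * r"
    using continuous_seminorm_step_bounded[OF p] by metis
  define q where "q = ln (s k / s (Suc k))"
  have lt: "s k < s (Suc k)" using s_mono by (simp add: strict_mono_Suc_iff)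
  then have q: "q < 0" using s_pos[of k] s_pos[of "Suc k"] by (simp add: q_def)
  have "filterlim (\<lambda>n. q * \<alpha> n) at_bot sequentially"
    using filterlim_tendsto_neg_mult_at_bot[OF tendsto_const q \<alpha>_lim] .
  then have "(\<lambda>n. exp (q * \<alpha> n)) \<longlonglongrightarrow> 0" using exp_at_bot filterlim_compose by blast
  then have "(\<lambda>N. B * r * exp (q * \<alpha> N)) \<longlonglongrightarrow> 0" by (rule tendsto_mult_right_zero)
  then show ?thesis
  proof (rule tendsto_sandwich[of "\<lambda>_. 0", rotated 3])
    show "\<forall>\<^sub>F N in sequentially. p (tail_seq N x) \<le> B * r * exp (q * \<alpha> N)"
      using eventually_ge_at_top[of 1]
    proof eventually_elim
      case (elim N)
      have "(s k / s (Suc k)) powr \<alpha> N = exp (q * \<alpha> N)"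
        using s_pos[of k] s_pos[of "Suc k"] by (simp add: powr_def q_def mult.commute)
      then show ?case using B[OF tail_seq_step_ball[OF x elim]] by (simp add: mult_ac)
    qed
    show "\<forall>\<^sub>F N in sequentially. 0 \<le> p (tail_seq N x)"
      using eventually_ge_at_top[of 1]
    proof eventually_elim
      case (elim N)
      have "tail_seq N x \<in> carrier" using tail_seq_step_ball[OF x elim] carrier_iff by blast
      then show ?case using p by (simp add: continuous_seminorm_def topspace_E)
    qed
  qed simp
qed

lemma seminorm_add_sum_le:
  assumes p: "continuous_seminorm E p" and z: "z \<in> carrier"
  shows "z + (\<Sum>n<N. c n *\<^sub>C unit_seq n) \<in> carrier"
    "p (z + (\<Sum>n<N. c n *\<^sub>C unit_seq n)) \<le> p z + (\<Sum>n<N. cmod (c n) * p (unit_seq n))"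
proof (induction N)
  case (Suc N)
  let ?a = "z + (\<Sum>n<N. c n *\<^sub>C unit_seq n)" and ?b = "c N *\<^sub>C unit_seq N"
  have e: "z + (\<Sum>n<Suc N. c n *\<^sub>C unit_seq n) = ?a + ?b" by (simp add: add.assoc)
  have b: "?b \<in> carrier" by (rule carrier_smul[OF unit_seq_carrier])
  {
    case 1
    show ?case unfolding e by (rule carrier_add[OF Suc(1) b])
  next
    case 2
    have "p (?a + ?b) \<le> p ?a + p ?b"
      by (rule continuous_seminormD(2)[OF p Suc(1) b])
    also have "p ?b = cmod (c N) * p (unit_seq N)"
      by (rule continuous_seminormD(3)[OF p unit_seq_carrier])
    finally show ?case unfolding e using Suc(2) by simp
  }
qed (use z in simp_all)

lemma completion_norm_const: "completion_norm p (\<lambda>k. v) = p v"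
  by (simp add: completion_norm_def)

text \<open>
  If \<open>n \<le> exp (A \<alpha> n)\<close>, then a fixed power of \<open>n\<close> is absorbed by passing to another step. Hence, for a
  continuous seminorm \<open>p\<close> and the unit vectors \<open>e n\<close>, also \<open>q x = (\<Sum>n. n\<^sup>2 p (e n) \<bar>x n\<bar>)\<close> is a continuous
  seminorm. The expansion of \<open>x\<close> in unit vectors then represents the canonical map as a sum of rank-one
  maps with functionals \<open>n\<^sup>2 p (e n) x n\<close> of \<open>q\<close>-norm at most \<open>1\<close> and vectors of \<open>p\<close>-norm at most
  \<open>1 / n\<^sup>2\<close>.
\<close>

lemma nuclear_if_log_bounded:
  assumes A: "\<And>n. n \<ge> 1 \<Longrightarrow> ln (real n) \<le> A * \<alpha> n"
  shows "nuclear_space E"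
  unfolding nuclear_space_def
proof (intro allI impI)
  fix p assume p: "continuous_seminorm E p"
  have p_nonneg: "0 \<le> p x" and p_smul: "p (c *\<^sub>C x) = cmod c * p x"
    if "x \<in> carrier" for x c
    using p that by (simp_all add: continuous_seminorm_def topspace_E)
  have p0: "p 0 = 0" using p_smul[OF zero_in_carrier, of 0] by simp
  define w where "w n = (real n)\<^sup>2 * p (unit_seq n)" for n
  have w: "w n \<ge> 0" for n using p_nonneg[OF unit_seq_carrier] by (simp add: w_def)
  define q where "q x = (\<Sum>n. w n * cmod (x n))" for x :: "nat \<Rightarrow> complex"
  have sq: "summable (\<lambda>n. 1 / (real n)\<^sup>2)"
    using inverse_power_summable[of 2, where 'a = real] by (simp add: inverse_eq_divide)
  have w_bound: "\<exists>B. \<forall>r. \<forall>x\<in>step_ball k r. \<forall>n. w n * cmod (x n) \<le> B * r * (1 / (real n)\<^sup>2)" for k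
  proof -
    \<comment> \<open>the exponent \<open>4\<close> pays for the weight \<open>n\<^sup>2\<close> and leaves \<open>1 / n\<^sup>2\<close> for summability\<close>
    obtain j where j: "s j \<ge> s k * exp (4 * A)"
      using s_lim unfolding filterlim_at_top eventually_sequentially by (meson order_refl)
    obtain B where B: "\<And>r x. x \<in> step_ball j r \<Longrightarrow> p x \<le> B * r"
      using continuous_seminorm_step_bounded[OF p] by metis
    have "w n * cmod (x n) \<le> \<bar>B\<bar> * r * (1 / (real n)\<^sup>2)" if x: "x \<in> step_ball k r" for r x n
    proof (cases "n = 0")
      case True
      then show ?thesis by (simp add: w_def)
    next
      case False
      then have n: "n \<ge> 1" "real n > 0" by auto
      note r = step_ball_radius_nonneg[OF x]
      have "real n ^ 4 = exp (4 * ln (real n))"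
        using exp_of_nat_mult[of 4 "ln (real n)"] n by simp
      also have "\<dots> \<le> exp (4 * A * \<alpha> n)" using A[OF n(1)] by simp
      finally have n4: "(real n) ^ 4 \<le> exp (4 * A * \<alpha> n)" .
      have "s j powr (- \<alpha> n) \<le> (s k * exp (4 * A)) powr (- \<alpha> n)"
        using j \<alpha>_pos[OF n(1)] s_pos[of k] by (intro powr_mono2') auto
      also have "\<dots> = s k powr (- \<alpha> n) * exp (- (4 * A * \<alpha> n))"
        using s_pos[of k] by (simp add: powr_mult exp_powr_real)
      finally have sj: "s j powr (- \<alpha> n) * s k powr \<alpha> n \<le> exp (- (4 * A * \<alpha> n))"
        using s_pos[of k] by (simp add: powr_minus field_simps)
      have "p (unit_seq n) \<le> B * s j powr (- \<alpha> n)" by (rule B[OF unit_seq_step_ball])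
      also have "\<dots> \<le> \<bar>B\<bar> * s j powr (- \<alpha> n)" by (intro mult_right_mono) auto
      finally have "p (unit_seq n) * cmod (x n) \<le> (\<bar>B\<bar> * s j powr (- \<alpha> n)) * (r * s k powr \<alpha> n)"
        using step_ballD[OF x n(1)] by (intro mult_mono) auto
      also have "\<dots> = \<bar>B\<bar> * r * (s j powr (- \<alpha> n) * s k powr \<alpha> n)" by (simp add: mult_ac)
      also have "\<dots> \<le> \<bar>B\<bar> * r * exp (- (4 * A * \<alpha> n))" using sj r by (intro mult_left_mono) auto
      also have "\<dots> \<le> \<bar>B\<bar> * r * (1 / (real n) ^ 4)"
        using n4 n r by (intro mult_left_mono) (auto simp: exp_minus field_simps)
      finally have "(real n)\<^sup>2 * (p (unit_seq n) * cmod (x n)) \<le> (real n)\<^sup>2 * (\<bar>B\<bar> * r * (1 / (real n) ^ 4))"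
        by (intro mult_left_mono) auto
      also have "\<dots> = \<bar>B\<bar> * r * (1 / (real n)\<^sup>2)"
        using n by (simp add: power2_eq_square power4_eq_xxxx)
      finally show ?thesis by (simp add: w_def mult_ac)
    qed
    then show ?thesis by blast
  qed
  have summable_q: "summable (\<lambda>n. w n * cmod (x n))" if x: "x \<in> carrier" for x
  proof -
    obtain k r where "x \<in> step_ball k r" using x carrier_iff by blast
    then obtain B where "\<And>n. w n * cmod (x n) \<le> B * r * (1 / (real n)\<^sup>2)" using w_bound by metis
    then show ?thesis
      using w by (intro summable_comparison_test'[OF summable_mult[OF sq]]) auto
  qed
  have q: "continuous_seminorm E q"
  proof (rule step_bounded_seminorm_continuous)
    show "0 \<le> q x" if "x \<in> carrier" for x
      unfolding q_def using summable_q[OF that] w by (intro suminf_nonneg) auto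
    show "q (x + y) \<le> q x + q y" if "x \<in> carrier" "y \<in> carrier" for x y
    proof -
      have "w n * cmod ((x + y) n) \<le> w n * cmod (x n) + w n * cmod (y n)" for n
        using mult_left_mono[OF norm_triangle_ineq[of "x n" "y n"] w[of n]] by (simp add: distrib_left)
      then have "q (x + y) \<le> (\<Sum>n. w n * cmod (x n) + w n * cmod (y n))"
        unfolding q_def
        by (intro suminf_le summable_add summable_q[OF carrier_add[OF that]] summable_q that)
      then show ?thesis using summable_q that by (simp add: q_def suminf_add)
    qed
    show "q (c *\<^sub>C x) = cmod c * q x" if "x \<in> carrier" for c x
      using suminf_mult[OF summable_q[OF that], of "cmod c"]
      by (simp add: q_def smul_def norm_mult mult_ac)
    fix k
    obtain B where B: "\<And>r x n. x \<in> step_ball k r \<Longrightarrow> w n * cmod (x n) \<le> B * r * (1 / (real n)\<^sup>2)"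
      using w_bound by metis
    have "q x \<le> (B * (\<Sum>n. 1 / (real n)\<^sup>2)) * r" if x: "x \<in> step_ball k r" for x r
    proof -
      have "q x \<le> (\<Sum>n. B * r * (1 / (real n)\<^sup>2))"
        unfolding q_def using B[OF x] summable_q[OF subsetD[OF step_ball_subset_carrier x]] summable_mult[OF sq]
        by (intro suminf_le) auto
      also have "\<dots> = B * r * (\<Sum>n. 1 / (real n)\<^sup>2)" by (rule suminf_mult[OF sq])
      finally show ?thesis by (simp add: mult_ac)
    qed
    then show "\<exists>B. \<forall>r. \<forall>x\<in>step_ball k r. q x \<le> B * r" by blast
  qed
  have term_le_q: "w n * cmod (x n) \<le> q x" if "x \<in> carrier" for n x
    unfolding q_def using sum_le_suminf[OF summable_q[OF that], of "{n}"] w by simp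
  have p_le_q: "p x \<le> q x" if x: "x \<in> carrier" for x
  proof (rule LIMSEQ_le_const)
    show "(\<lambda>N. p (tail_seq N x) + q x) \<longlonglongrightarrow> q x"
      using tendsto_add[OF seminorm_tail_tendsto[OF p x] tendsto_const[of "q x"]] by simp
    have "p x \<le> p (tail_seq N x) + q x" if N: "N \<ge> 1" for N
    proof -
      obtain k r where xr: "x \<in> step_ball k r" using x carrier_iff by blast
      have t: "tail_seq N x \<in> carrier" using tail_seq_step_ball[OF xr N] carrier_iff by blast
      have "p x \<le> p (tail_seq N x) + (\<Sum>n<N. cmod (x n) * p (unit_seq n))"
        using seminorm_add_sum_le(2)[OF p t, of x N]
        unfolding tail_seq_decomposition[of x N, OF carrier_at_0[OF x], symmetric] .
      also have "(\<Sum>n<N. cmod (x n) * p (unit_seq n)) \<le> (\<Sum>n<N. w n * cmod (x n))"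
      proof (rule sum_mono)
        fix n
        show "cmod (x n) * p (unit_seq n) \<le> w n * cmod (x n)"
        proof (cases "n = 0")
          case True
          then show ?thesis using carrier_at_0[OF x] by simp
        next
          case False
          then have "1 \<le> (real n)\<^sup>2" by simp
          then have "1 * p (unit_seq n) \<le> w n"
            unfolding w_def using p_nonneg[OF unit_seq_carrier] by (intro mult_right_mono) auto
          then show ?thesis using mult_left_mono[of "p (unit_seq n)" "w n" "cmod (x n)"] by (simp add: mult_ac)
        qed
      qed
      also have "\<dots> \<le> q x"
        unfolding q_def using w by (intro sum_le_suminf summable_q[OF x]) auto
      finally show ?thesis by simp
    qed
    then show "\<exists>N. \<forall>n\<ge>N. p x \<le> p (tail_seq n x) + q x" by blast
  qed
  define f where "f n x = of_real (w n) * x n" for n and x :: "nat \<Rightarrow> complex"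
  \<comment> \<open>where \<open>w n = 0\<close>, division by zero makes \<open>y n\<close> vanish; these coordinates are invisible to \<open>p\<close>\<close>
  define y where "y n = of_real (1 / w n) *\<^sub>C unit_seq n" for n
  have y: "y n \<in> carrier" for n by (simp add: y_def carrier_smul unit_seq_carrier)
  have py: "p (y n) \<le> 1 / (real n)\<^sup>2" "0 \<le> p (y n)" for n
  proof -
    have "p (y n) = 1 / w n * p (unit_seq n)"
      using p_smul[OF unit_seq_carrier, of "of_real (1 / w n)" n] w[of n] by (simp add: y_def norm_divide)
    then show "p (y n) \<le> 1 / (real n)\<^sup>2" by (auto simp: w_def)
    show "0 \<le> p (y n)" by (rule p_nonneg[OF y])
  qed
  have "canonical_map_nuclear (topspace E) q p"
    unfolding canonical_map_nuclear_def topspace_E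
  proof (intro exI conjI allI ballI)
    fix n
    show "linear_functional_on carrier (f n)"
      by (simp add: linear_functional_on_def f_def smul_def algebra_simps)
    show "0 \<le> (1 :: real)" by simp
    show "cmod (f n x) \<le> 1 * q x" if "x \<in> carrier" for x
      using term_le_q[OF that, of n] w[of n] by (simp add: f_def norm_mult)
    show "seminorm_Cauchy carrier p (\<lambda>k. y n)"
      using y p0 by (auto simp: seminorm_Cauchy_def)
  next
    show "summable (\<lambda>n. 1 * completion_norm p (\<lambda>k. y n))"
      unfolding completion_norm_const using py by (intro summable_comparison_test'[OF sq]) auto
  next
    fix x assume x: "x \<in> carrier"
    obtain k r where xr: "x \<in> step_ball k r" using x carrier_iff by blast
    \<comment> \<open>the coordinates that the functionals do not see, all of them null for \<open>p\<close>\<close>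
    define c where "c n = (if w n = 0 then x n else 0)" for n
    have fy: "x n *\<^sub>C unit_seq n = c n *\<^sub>C unit_seq n + f n x *\<^sub>C y n" for n
      by (auto simp: c_def f_def y_def)
    have eq: "x - (\<Sum>n<N. f n x *\<^sub>C y n) = tail_seq N x + (\<Sum>n<N. c n *\<^sub>C unit_seq n)" for N
    proof -
      have "x = tail_seq N x + (\<Sum>n<N. x n *\<^sub>C unit_seq n)"
        by (rule tail_seq_decomposition[of x N, OF carrier_at_0[OF x]])
      also have "(\<Sum>n<N. x n *\<^sub>C unit_seq n) = (\<Sum>n<N. c n *\<^sub>C unit_seq n) + (\<Sum>n<N. f n x *\<^sub>C y n)"
        unfolding fy by (rule sum.distrib)
      finally show ?thesis unfolding diff_eq_eq add.assoc .
    qed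
    have c0: "cmod (c n) * p (unit_seq n) = 0" for n
      using carrier_at_0[OF x] by (auto simp: c_def w_def)
    have "p (x - (\<Sum>n<N. f n x *\<^sub>C y n)) \<le> p (tail_seq N x)" "0 \<le> p (x - (\<Sum>n<N. f n x *\<^sub>C y n))"
      if N: "N \<ge> 1" for N
    proof -
      have t: "tail_seq N x \<in> carrier" using tail_seq_step_ball[OF xr N] carrier_iff by blast
      show "p (x - (\<Sum>n<N. f n x *\<^sub>C y n)) \<le> p (tail_seq N x)"
        unfolding eq using seminorm_add_sum_le(2)[OF p t, of c N] by (simp add: c0)
      show "0 \<le> p (x - (\<Sum>n<N. f n x *\<^sub>C y n))"
        unfolding eq by (rule p_nonneg[OF seminorm_add_sum_le(1)[OF p t]])
    qed
    then have "(\<lambda>N. p (x - (\<Sum>n<N. f n x *\<^sub>C y n))) \<longlonglongrightarrow> 0"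
      by (intro tendsto_sandwich[OF _ _ tendsto_const seminorm_tail_tendsto[OF p x]])
        (auto simp: eventually_sequentially)
    then show "(\<lambda>N. completion_norm p (\<lambda>k. x - (\<Sum>n<N. f n x *\<^sub>C y n))) \<longlonglongrightarrow> 0"
      by (simp add: completion_norm_const)
  qed
  then show "\<exists>q. continuous_seminorm E q \<and> (\<forall>x\<in>topspace E. p x \<le> q x) \<and> canonical_map_nuclear (topspace E) q p"
    using q p_le_q by (intro exI[of _ q]) (simp add: topspace_E)
qed

end

section \<open>The spectra\<close>

lemma Re_inverse_iff:
  assumes "l \<noteq> 0"
  shows "l \<in> ball (1/2) (1/2) \<longleftrightarrow> 1 < Re (1 / l)" "l \<in> cball (1/2) (1/2) \<longleftrightarrow> 1 \<le> Re (1 / l)"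
proof -
  have pos: "0 < (cmod l)\<^sup>2" using assms by simp
  have Re: "Re (1 / l) = Re l / (cmod l)\<^sup>2" by (simp add: Re_divide cmod_power2)
  have d: "(dist (1/2) l)\<^sup>2 = (cmod l)\<^sup>2 - Re l + (1/2)\<^sup>2"
    by (simp add: dist_norm cmod_power2 power2_diff)
  have "dist (1/2) l < 1/2 \<longleftrightarrow> (dist (1/2) l)\<^sup>2 < (1/2)\<^sup>2"
    by (metis abs_of_nonneg abs_square_less_1 power2_less_imp_less power_strict_mono zero_le_dist
        zero_less_numeral zero_le_divide_1_iff zero_le_numeral)
  then show "l \<in> ball (1/2) (1/2) \<longleftrightarrow> 1 < Re (1 / l)" using pos by (simp add: d Re)
  have "dist (1/2) l \<le> 1/2 \<longleftrightarrow> (dist (1/2) l)\<^sup>2 \<le> (1/2)\<^sup>2"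
    by (metis power_mono power2_le_imp_le zero_le_dist zero_le_divide_1_iff zero_le_numeral)
  then show "l \<in> cball (1/2) (1/2) \<longleftrightarrow> 1 \<le> Re (1 / l)" using pos by (simp add: d Re)
qed

context growth_space
begin

text \<open>
  The values \<open>\<alpha> n\<close> are bounded below by \<open>\<alpha> 1 > 0\<close>, so a constant is at most a multiple of \<open>\<alpha> n\<close>, and
  so are the finitely many exceptional values.
\<close>

lemma eventually_affine_imp_linear_bound:
  assumes h: "\<And>n. n \<ge> N \<Longrightarrow> h n \<le> D + B * \<alpha> n"
  shows "\<exists>A. \<forall>n\<ge>1. h n \<le> A * \<alpha> n"
proof -
  define D' where "D' = \<bar>D\<bar> + (\<Sum>n<N. \<bar>h n\<bar>)"
  have D': "0 \<le> D'" by (simp add: D'_def sum_nonneg)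
  have a1: "0 < \<alpha> 1" by (rule \<alpha>_pos) simp
  have "h n \<le> (D' / \<alpha> 1 + \<bar>B\<bar>) * \<alpha> n" if n: "n \<ge> 1" for n
  proof -
    have an: "0 < \<alpha> n" "\<alpha> 1 \<le> \<alpha> n"
      using \<alpha>_pos[OF n] strict_mono_onD[OF \<alpha>_mono, of 1 n] n by (cases "n = 1"; auto)+
    have "h n \<le> D' + \<bar>B\<bar> * \<alpha> n"
    proof (cases "n < N")
      case True
      then have "\<bar>h n\<bar> \<le> (\<Sum>n<N. \<bar>h n\<bar>)" by (intro member_le_sum) auto
      moreover have "0 \<le> \<bar>B\<bar> * \<alpha> n" using an by simp
      ultimately show ?thesis by (simp add: D'_def)
    next
      case False
      have "B * \<alpha> n \<le> \<bar>B\<bar> * \<alpha> n" using an by (intro mult_right_mono) auto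
      moreover have "0 \<le> (\<Sum>n<N. \<bar>h n\<bar>)" by (simp add: sum_nonneg)
      moreover have "h n \<le> D + B * \<alpha> n" using h[of n] False by simp
      ultimately show ?thesis unfolding D'_def by linarith
    qed
    moreover have "D' \<le> D' / \<alpha> 1 * \<alpha> n"
      using mult_left_mono[OF an(2) D'] a1 by (simp add: field_simps)
    ultimately show ?thesis by (simp add: distrib_right)
  qed
  then show ?thesis by blast
qed

text \<open>
  Elements of \<open>E\<close> grow at most like \<open>(s k) powr \<alpha> n\<close>; taking logarithms turns this into a bound for
  \<open>log n\<close>.
\<close>

lemma power_growth_imp_log_bounded:
  assumes x: "x \<in> carrier" and c: "c > 0" "e > 0"
    and growth: "\<And>n. n \<ge> N \<Longrightarrow> c * real n powr e \<le> cmod (x n)"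
  shows "\<exists>A. \<forall>n\<ge>1. ln (real n) \<le> A * \<alpha> n"
proof -
  obtain k r where xr: "x \<in> step_ball k r" using x carrier_iff by blast
  show ?thesis
  proof (rule eventually_affine_imp_linear_bound)
    fix n assume n: "n \<ge> max N 1"
    have le: "c * real n powr e \<le> r * s k powr \<alpha> n"
      using growth[of n] step_ballD[OF xr, of n] n by simp
    have pos: "0 < c * real n powr e" using c n by simp
    then have "0 < r * s k powr \<alpha> n" using le by linarith
    then have r: "r > 0" using s_pos[of k] by (simp add: zero_less_mult_iff)
    have "ln (c * real n powr e) \<le> ln (r * s k powr \<alpha> n)"
      using le pos by (meson ln_mono less_le_trans)
    then have "ln c + e * ln (real n) \<le> ln r + \<alpha> n * ln (s k)"
      using c n r s_pos[of k] by (simp add: ln_mult ln_powr)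
    then have "ln (real n) \<le> (ln r - ln c + \<alpha> n * ln (s k)) / e"
      using c(2) by (simp add: field_simps)
    then show "ln (real n) \<le> (ln r - ln c) / e + (ln (s k) / e) * \<alpha> n"
      by (simp add: add_divide_distrib mult.commute)
  qed
qed

lemma log_growth_imp_log_log_bounded:
  assumes x: "x \<in> carrier" and c: "c > 0"
    and growth: "\<And>n. n \<ge> 1 \<Longrightarrow> c * ln (real n) \<le> cmod (x n) + d"
  shows "\<exists>A. \<forall>n\<ge>1. ln (ln (real n)) \<le> A * \<alpha> n"
proof -
  obtain k r where xr: "x \<in> step_ball k r" using x carrier_iff by blast
  show ?thesis
  proof (rule eventually_affine_imp_linear_bound)
    fix n :: nat assume n: "n \<ge> 3"
    have "1 \<le> s k powr \<alpha> n" using s_gt_1[of k] \<alpha>_pos[of n] n by (intro ge_one_powr_ge_zero) auto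
    then have "d \<le> \<bar>d\<bar> * s k powr \<alpha> n"
      using mult_left_mono[of 1 "s k powr \<alpha> n" "\<bar>d\<bar>"] by simp
    then have le: "c * ln (real n) \<le> (r + \<bar>d\<bar>) * s k powr \<alpha> n"
      using growth[of n] step_ballD[OF xr, of n] n by (simp add: distrib_right)
    have pos: "0 < c * ln (real n)" using c n by simp
    then have "0 < (r + \<bar>d\<bar>) * s k powr \<alpha> n" using le by linarith
    then have r: "r + \<bar>d\<bar> > 0" using s_pos[of k] by (simp add: zero_less_mult_iff)
    have "ln (c * ln (real n)) \<le> ln ((r + \<bar>d\<bar>) * s k powr \<alpha> n)"
      using le pos by (meson ln_mono less_le_trans)
    then have "ln c + ln (ln (real n)) \<le> ln (r + \<bar>d\<bar>) + \<alpha> n * ln (s k)"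
      using c n r s_pos[of k] by (simp add: ln_mult ln_powr)
    then show "ln (ln (real n)) \<le> (ln (r + \<bar>d\<bar>) - ln c) + ln (s k) * \<alpha> n"
      by (simp add: mult.commute)
  qed
qed

lemma bounded_imp_carrier:
  assumes "x 0 = 0" "\<And>n. cmod (x n) \<le> 1"
  shows "x \<in> carrier"
proof -
  have "cmod (x n) \<le> 1 * s 0 powr \<alpha> n" if "n \<ge> 1" for n
    using assms(2)[of n] ge_one_powr_ge_zero[of "s 0" "\<alpha> n"] s_gt_1[of 0] \<alpha>_pos[OF that] by simp
  then have "x \<in> step_ball 0 1" using assms(1) by (simp add: step_ball_def)
  then show ?thesis using carrier_iff by blast
qed

lemma reciprocal_in_spectrum:
  assumes "m \<ge> 1" "1 / l = of_nat m"
  shows "l \<in> spectrum E cesaro"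
proof (rule unsolvable_imp_spectrum)
  show "(\<lambda>n. if n = m then 1 else 0) \<in> carrier"
    using assms(1) by (intro bounded_imp_carrier) auto
qed (use cesaro_equation_unsolvable_at_diagonal[OF assms] in blast)

lemma zero_in_spectrum:
  assumes "\<not> nuclear_space E"
  shows "0 \<in> spectrum E cesaro"
proof (rule unsolvable_imp_spectrum)
  show "(\<lambda>n. if n = 0 then 0 else (-1) ^ n) \<in> carrier"
    by (intro bounded_imp_carrier) (auto simp: norm_power)
  fix x assume x: "x \<in> carrier" and eq: "0 *\<^sub>C x - cesaro x = (\<lambda>n. if n = 0 then 0 else (-1) ^ n)"
  have "1 * real n powr 1 \<le> cmod (x n)" if "n \<ge> 1" for n
    using cesaro_equation_growth_zero[OF eq that] by simp
  from power_growth_imp_log_bounded[OF x _ _ this] nuclear_if_log_bounded assms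
  show False by fastforce
qed

lemma disc_subset_spectrum:
  assumes nn: "\<not> nuclear_space E" and l: "l \<noteq> 0" "1 < Re (1 / l)"
  shows "l \<in> spectrum E cesaro"
proof (cases "\<exists>n\<ge>1. 1 / l = of_nat n")
  case True
  then show ?thesis using reciprocal_in_spectrum by blast
next
  case False
  show ?thesis
  proof (rule unsolvable_imp_spectrum)
    show "(\<lambda>n. if n = 1 then 1 else 0) \<in> carrier" by (intro bounded_imp_carrier) auto
    fix x assume x: "x \<in> carrier" and eq: "l *\<^sub>C x - cesaro x = (\<lambda>n. if n = 1 then 1 else 0)"
    obtain c e N where "c > 0" "e > 0" "\<And>n. n \<ge> N \<Longrightarrow> c * real n powr e \<le> cmod (x n)"
      using cesaro_equation_growth_inside[OF l _ eq] False by blast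
    from power_growth_imp_log_bounded[OF x this] obtain A where "\<And>n. n \<ge> 1 \<Longrightarrow> ln (real n) \<le> A * \<alpha> n"
      by blast
    from nuclear_if_log_bounded[OF this] nn show False by blast
  qed
qed

lemma circle_subset_spectrum:
  assumes unb: "\<not> (\<exists>A. \<forall>n\<ge>1. ln (ln (real n)) \<le> A * \<alpha> n)" and l: "l \<noteq> 0" "Re (1 / l) = 1"
  shows "l \<in> spectrum E cesaro"
proof (cases "l = 1")
  case True
  then show ?thesis using reciprocal_in_spectrum[of 1 l] by simp
next
  case False
  obtain y where y: "y 0 = 0" "\<And>n. cmod (y n) \<le> 1"
    "\<And>x. l *\<^sub>C x - cesaro x = y \<Longrightarrow> \<exists>c>0. \<exists>d. \<forall>n\<ge>1. c * ln (real n) \<le> cmod (x n) + d"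
    using cesaro_equation_growth_circle[OF l False] by blast
  show ?thesis
  proof (rule unsolvable_imp_spectrum)
    show "y \<in> carrier" by (rule bounded_imp_carrier) (rule y)+
    fix x assume x: "x \<in> carrier" and eq: "l *\<^sub>C x - cesaro x = y"
    obtain c d where "c > 0" "\<And>n. n \<ge> 1 \<Longrightarrow> c * ln (real n) \<le> cmod (x n) + d"
      using y(3)[OF eq] by blast
    from log_growth_imp_log_log_bounded[OF x this] unb show False by blast
  qed
qed

text \<open>
  The constant of the resolvent estimate depends continuously on the spectral parameter, so near \<open>l\<close> it
  exceeds its value at \<open>l\<close> by at most \<open>1\<close>.
\<close>

lemma outside_disc_resolvent_set_star:
  assumes l: "l \<noteq> 0" "Re (1 / l) < 1"
  shows "l \<in> resolvent_set_star E cesaro"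
proof -
  define K where "K m = cmod (1 / m) * (1 + cmod (1 / m) / (1 - Re (1 / m)))" for m
  have inv: "((\<lambda>m. 1 / m) \<longlongrightarrow> 1 / l) (nhds l)"
    using l(1) by (intro tendsto_intros filterlim_ident)
  then have Re: "((\<lambda>m. Re (1 / m)) \<longlongrightarrow> Re (1 / l)) (nhds l)"
    by (rule tendsto_Re)
  have "(K \<longlongrightarrow> K l) (nhds l)"
    unfolding K_def using l(2) by (intro tendsto_intros inv Re) auto
  then have "\<forall>\<^sub>F m in nhds l. K m < K l + 1" by (rule order_tendstoD(2)) simp
  moreover have "\<forall>\<^sub>F m in nhds l. Re (1 / m) < 1" by (rule order_tendstoD(2)[OF Re l(2)])
  moreover have "\<forall>\<^sub>F m in nhds l. m \<noteq> 0"
    using l(1) by (intro eventually_nhds_in_open[of "- {0}", simplified]) auto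
  ultimately have "\<forall>\<^sub>F m in nhds l. K m < K l + 1 \<and> Re (1 / m) < 1 \<and> m \<noteq> 0"
    by eventually_elim auto
  then obtain \<delta> where \<delta>: "\<delta> > 0" and Z: "\<And>m. m \<in> ball l \<delta> \<Longrightarrow> K m < K l + 1 \<and> Re (1 / m) < 1 \<and> m \<noteq> 0"
    unfolding eventually_nhds_metric by (auto simp: dist_commute)
  have ne: "1 / m \<noteq> of_nat n" if "m \<in> ball l \<delta>" "n \<ge> 1" for m n
  proof
    assume "1 / m = of_nat n"
    then have "Re (1 / m) = real n" by simp
    then show False using Z[OF that(1)] that(2) by simp
  qed
  have est: "x \<in> step_ball k ((K l + 1) * r)"
    if m: "m \<in> ball l \<delta>" and y: "y \<in> step_ball k r" and x: "x 0 = 0" "m *\<^sub>C x - cesaro x = y" for k m r x y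
  proof -
    have "cmod (x n) \<le> (K l + 1) * r * s k powr \<alpha> n" if n: "n \<ge> 1" for n
    proof -
      note r = step_ball_radius_nonneg[OF y]
      have "cmod (x n) \<le> K m * (r * s k powr \<alpha> n)"
        unfolding K_def
        using Z[OF m] powr_s_mono r step_ballD[OF y] n
        by (intro cesaro_resolvent_bound_outside[OF _ _ x(2)]) (auto intro: mult_left_mono)
      also have "\<dots> \<le> (K l + 1) * (r * s k powr \<alpha> n)"
        using Z[OF m] r by (intro mult_right_mono) auto
      finally show ?thesis by (simp add: mult_ac)
    qed
    then show ?thesis using x(1) by (simp add: step_ball_def)
  qed
  have "ball l \<delta> \<subseteq> resolvent_set E cesaro" "equicontinuous_ops E (resolvent_op E cesaro ` ball l \<delta>)"
    using resolvent_of_step_estimate[of "ball l \<delta>"] Z ne est by blast+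
  then show ?thesis using \<delta> by (auto simp: resolvent_set_star_def)
qed

text \<open>
  The logarithm in the estimate is at most \<open>exp (\<bar>A\<bar> \<alpha> n)\<close>, so it is absorbed by any step \<open>m\<close> with
  \<open>s m \<ge> s k exp \<bar>A\<bar>\<close>.
\<close>

lemma circle_resolvent_set:
  assumes A: "\<And>n. n \<ge> 1 \<Longrightarrow> ln (ln (real n)) \<le> A * \<alpha> n"
    and l: "l \<noteq> 0" "Re (1 / l) = 1" "l \<noteq> 1"
  shows "l \<in> resolvent_set E cesaro"
proof -
  define c where "c = 1 / cmod (1 - 1 / l)"
  define K where "K = cmod (1 / l) * (1 + cmod (1 / l) * (c + 2))"
  have c: "c \<ge> 0" by (simp add: c_def)
  have log: "ln (real n) \<le> exp (\<bar>A\<bar> * \<alpha> n)" if n: "n \<ge> 1" for n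
  proof (cases "ln (real n) \<le> 1")
    case True
    moreover have "1 \<le> exp (\<bar>A\<bar> * \<alpha> n)" using \<alpha>_pos[OF n] by simp
    ultimately show ?thesis by linarith
  next
    case False
    have "ln (ln (real n)) \<le> \<bar>A\<bar> * \<alpha> n"
      using A[OF n] \<alpha>_pos[OF n] mult_right_mono[of A "\<bar>A\<bar>" "\<alpha> n"] by linarith
    then have "exp (ln (ln (real n))) \<le> exp (\<bar>A\<bar> * \<alpha> n)" by simp
    then show ?thesis using False by simp
  qed
  have ne: "1 / l \<noteq> of_nat n" for n
  proof
    assume n: "1 / l = of_nat n"
    then have "Re (1 / l) = real n" by simp
    then have "n = 1" using l(2) by simp
    then show False using n l(1,3) by simp
  qed
  have "\<exists>m B. \<forall>z\<in>{l}. \<forall>r. \<forall>y\<in>step_ball k r. \<forall>x. x 0 = 0 \<longrightarrow>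
      z *\<^sub>C x - cesaro x = y \<longrightarrow> x \<in> step_ball m (B * r)" for k
  proof -
    obtain m where m: "s m \<ge> s k * exp \<bar>A\<bar>"
      using s_lim unfolding filterlim_at_top eventually_sequentially by (meson order_refl)
    have est: "x \<in> step_ball m (K * r)"
      if y: "y \<in> step_ball k r" and x: "x 0 = 0" "l *\<^sub>C x - cesaro x = y" for r x y
    proof -
      have "cmod (x n) \<le> K * r * s m powr \<alpha> n" if n: "n \<ge> 1" for n
      proof -
        note r = step_ball_radius_nonneg[OF y]
        let ?e = "exp (\<bar>A\<bar> * \<alpha> n)"
        have e1: "1 \<le> ?e" using \<alpha>_pos[OF n] by simp
        have "cmod (x n) \<le> cmod (1 / l) * (1 + cmod (1 / l) * (c + 2 * ln (real n))) * (r * s k powr \<alpha> n)"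
          unfolding c_def using powr_s_mono r step_ballD[OF y] n
          by (intro cesaro_resolvent_bound_circle[OF l x(2)]) (auto intro: mult_left_mono)
        also have "\<dots> \<le> K * ?e * (r * s k powr \<alpha> n)"
        proof (rule mult_right_mono)
          have "c * 1 \<le> c * ?e" using c e1 by (rule mult_left_mono[rotated])
          then have "c + 2 * ln (real n) \<le> (c + 2) * ?e"
            using log[OF n] by (simp add: distrib_right)
          then have "cmod (1 / l) * (c + 2 * ln (real n)) \<le> cmod (1 / l) * ((c + 2) * ?e)"
            by (rule mult_left_mono) simp
          then have "1 + cmod (1 / l) * (c + 2 * ln (real n)) \<le> (1 + cmod (1 / l) * (c + 2)) * ?e"
            using e1 unfolding distrib_right[of 1] mult.assoc by linarith
          then have "cmod (1 / l) * (1 + cmod (1 / l) * (c + 2 * ln (real n))) \<le>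
              cmod (1 / l) * ((1 + cmod (1 / l) * (c + 2)) * ?e)"
            by (rule mult_left_mono) simp
          then show "cmod (1 / l) * (1 + cmod (1 / l) * (c + 2 * ln (real n))) \<le> K * ?e"
            by (simp add: K_def mult.assoc)
        qed (use r in simp)
        also have "\<dots> = K * r * (s k * exp \<bar>A\<bar>) powr \<alpha> n"
          using s_pos[of k] by (simp add: powr_mult exp_powr_real)
        also have "\<dots> \<le> K * r * s m powr \<alpha> n"
        proof (intro mult_left_mono powr_mono2)
          show "0 \<le> K * r" using c r by (simp add: K_def)
        qed (use m s_pos[of k] \<alpha>_pos[OF n] in auto)
        finally show ?thesis .
      qed
      then show ?thesis using x(1) by (simp add: step_ball_def)
    qed
    then show ?thesis by blast
  qed
  from resolvent_of_step_estimate(1)[of "{l}", OF _ _ this] l(1) ne show ?thesis by blast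
qed

text \<open>
  The star spectrum contains the closed disc although the spectrum need not:
  near any point of the closed disc there are points of the open disc, and those lie in the spectrum.
\<close>

lemma spectrum_star_eq:
  assumes nn: "\<not> nuclear_space E"
  shows "spectrum_star E cesaro = cball (1/2) (1/2)"
proof (intro equalityI subsetI)
  fix l assume l: "l \<in> spectrum_star E cesaro"
  show "l \<in> cball (1/2) (1/2)"
  proof (cases "l = 0")
    case False
    then show ?thesis
      using l outside_disc_resolvent_set_star[of l] Re_inverse_iff(2)[of l] by (auto simp: spectrum_star_def)
  qed (simp add: dist_norm)
next
  fix l :: complex assume "l \<in> cball (1/2) (1/2)"
  then have l: "l \<in> closure (ball (1/2) (1/2))" by simp
  have "l \<notin> resolvent_set_star E cesaro"
  proof
    assume "l \<in> resolvent_set_star E cesaro"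
    then obtain \<delta> where \<delta>: "\<delta> > 0" "ball l \<delta> \<subseteq> resolvent_set E cesaro"
      by (auto simp: resolvent_set_star_def)
    obtain m where m: "m \<in> ball (1/2) (1/2)" "dist m l < \<delta>"
      using l \<delta>(1) unfolding closure_approachable by blast
    have "m \<noteq> 0" using m(1) by (auto simp: dist_norm)
    then have "m \<in> spectrum E cesaro"
      using disc_subset_spectrum[OF nn] Re_inverse_iff(1) m(1) by blast
    moreover have "m \<in> resolvent_set E cesaro" using \<delta>(2) m(2) by (auto simp: dist_commute)
    ultimately show False by (simp add: spectrum_def)
  qed
  then show "l \<in> spectrum_star E cesaro" by (simp add: spectrum_star_def)
qed

lemma spectrum_subset_cball:
  assumes "l \<in> spectrum E cesaro"
  shows "l \<in> cball (1/2) (1/2)"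
proof (cases "l = 0")
  case False
  have "resolvent_set_star E cesaro \<subseteq> resolvent_set E cesaro"
    by (auto simp: resolvent_set_star_def)
  then show ?thesis
    using assms False outside_disc_resolvent_set_star[of l] Re_inverse_iff(2)[of l]
    by (auto simp: spectrum_def)
qed (simp add: dist_norm)

lemma spectrum_eq_open_disc:
  assumes nn: "\<not> nuclear_space E" and A: "\<And>n. n \<ge> 1 \<Longrightarrow> ln (ln (real n)) \<le> A * \<alpha> n"
  shows "spectrum E cesaro = {0, 1} \<union> ball (1/2) (1/2)"
proof (intro equalityI subsetI)
  fix l assume l: "l \<in> spectrum E cesaro"
  have "Re (1 / l) \<noteq> 1" if "l \<noteq> 0" "l \<noteq> 1"
    using circle_resolvent_set[OF A that(1) _ that(2)] l by (auto simp: spectrum_def)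
  then show "l \<in> {0, 1} \<union> ball (1/2) (1/2)"
    using spectrum_subset_cball[OF l] Re_inverse_iff[of l] by force
next
  fix l :: complex assume "l \<in> {0, 1} \<union> ball (1/2) (1/2)"
  then consider "l = 0" | "l = 1" | "l \<noteq> 0" "l \<in> ball (1/2) (1/2)" by blast
  then show "l \<in> spectrum E cesaro"
  proof cases
    case 2
    then show ?thesis using reciprocal_in_spectrum[of 1 l] by simp
  qed (use zero_in_spectrum[OF nn] disc_subset_spectrum[OF nn] Re_inverse_iff(1) in auto)
qed

lemma spectrum_eq_closed_disc:
  assumes nn: "\<not> nuclear_space E" and unb: "\<not> (\<exists>A. \<forall>n\<ge>1. ln (ln (real n)) \<le> A * \<alpha> n)"
  shows "spectrum E cesaro = cball (1/2) (1/2)"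
proof (intro equalityI subsetI)
  fix l :: complex assume l: "l \<in> cball (1/2) (1/2)"
  show "l \<in> spectrum E cesaro"
  proof (cases "l = 0")
    case True
    then show ?thesis using zero_in_spectrum[OF nn] by simp
  next
    case False
    then have "1 \<le> Re (1 / l)" using l Re_inverse_iff(2) by blast
    then show ?thesis
      using disc_subset_spectrum[OF nn False] circle_subset_spectrum[OF unb False] by fastforce
  qed
qed (rule spectrum_subset_cball)

text \<open>
  The supremum starts at \<open>3\<close>, where \<open>log log n\<close> becomes positive; the values at \<open>1\<close> and \<open>2\<close> only affect
  the constant.
\<close>

lemma log_log_bounded_iff_SUP:
  "(SUP n\<in>{3..}. ereal (ln (ln (real n)) / \<alpha> n)) < \<infinity> \<longleftrightarrow>
    (\<exists>A. \<forall>n\<ge>1. ln (ln (real n)) \<le> A * \<alpha> n)"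
proof
  assume S: "(SUP n\<in>{3..}. ereal (ln (ln (real n)) / \<alpha> n)) < \<infinity>"
  obtain B :: real where B: "(SUP n\<in>{3..}. ereal (ln (ln (real n)) / \<alpha> n)) \<le> ereal B"
    using S by (cases "SUP n\<in>{3..}. ereal (ln (ln (real n)) / \<alpha> n)") auto
  show "\<exists>A. \<forall>n\<ge>1. ln (ln (real n)) \<le> A * \<alpha> n"
  proof (rule eventually_affine_imp_linear_bound)
    fix n :: nat assume n: "n \<ge> 3"
    have "ereal (ln (ln (real n)) / \<alpha> n) \<le> ereal B"
      using n by (intro order_trans[OF SUP_upper B]) auto
    then have "ln (ln (real n)) / \<alpha> n \<le> B" by simp
    then show "ln (ln (real n)) \<le> 0 + B * \<alpha> n" using \<alpha>_pos[of n] n by (simp add: field_simps)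
  qed
next
  assume "\<exists>A. \<forall>n\<ge>1. ln (ln (real n)) \<le> A * \<alpha> n"
  then obtain A where A: "\<And>n. n \<ge> 1 \<Longrightarrow> ln (ln (real n)) \<le> A * \<alpha> n" by blast
  have "(SUP n\<in>{3..}. ereal (ln (ln (real n)) / \<alpha> n)) \<le> ereal A"
  proof (rule SUP_least)
    fix n :: nat assume n: "n \<in> {3..}"
    then show "ereal (ln (ln (real n)) / \<alpha> n) \<le> ereal A"
      using A[of n] \<alpha>_pos[of n] by (simp add: field_simps)
  qed
  then show "(SUP n\<in>{3..}. ereal (ln (ln (real n)) / \<alpha> n)) < \<infinity>"
    by (rule le_less_trans) simp
qed

end

theorem proposition3p4:
  fixes \<alpha> :: "nat \<Rightarrow> real" and s :: "nat \<Rightarrow> real"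
  assumes "\<forall>n\<ge>1. 0 < \<alpha> n"
    and "strict_mono_on {1..} \<alpha>"
    and "filterlim \<alpha> at_top sequentially"
    and "\<forall>k. 1 < s k"
    and "strict_mono s"
    and "filterlim s at_top sequentially"
    and "\<not> nuclear_space (E_space s \<alpha>)"
  shows "((SUP n\<in>{3..}. ereal (ln (ln (real n)) / \<alpha> n)) < \<infinity> \<longrightarrow>
            spectrum (E_space s \<alpha>) cesaro = {0, 1} \<union> ball (1/2) (1/2) \<and>
            spectrum_star (E_space s \<alpha>) cesaro = closure (ball (1/2) (1/2)))
       \<and> ((SUP n\<in>{3..}. ereal (ln (ln (real n)) / \<alpha> n)) = \<infinity> \<longrightarrow>
            spectrum (E_space s \<alpha>) cesaro = closure (ball (1/2) (1/2)) \<and>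
            spectrum_star (E_space s \<alpha>) cesaro = closure (ball (1/2) (1/2)))"
proof -
  interpret growth_space \<alpha> s by unfold_locales (use assms in auto)
  have closed: "closure (ball (1/2) (1/2)) = (cball (1/2) (1/2) :: complex set)" by simp
  note star = spectrum_star_eq[OF assms(7)]
  let ?S = "SUP n\<in>{3..}. ereal (ln (ln (real n)) / \<alpha> n)"
  have "spectrum E cesaro = {0, 1} \<union> ball (1/2) (1/2)" if fin: "?S < \<infinity>"
  proof -
    obtain A where "\<And>n. n \<ge> 1 \<Longrightarrow> ln (ln (real n)) \<le> A * \<alpha> n"
      using iffD1[OF log_log_bounded_iff_SUP fin] by blast
    then show ?thesis by (rule spectrum_eq_open_disc[OF assms(7)])
  qed
  moreover have "spectrum E cesaro = cball (1/2) (1/2)" if inf: "?S = \<infinity>"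
  proof (rule spectrum_eq_closed_disc[OF assms(7)])
    show "\<not> (\<exists>A. \<forall>n\<ge>1. ln (ln (real n)) \<le> A * \<alpha> n)"
      unfolding log_log_bounded_iff_SUP[symmetric] inf by simp
  qed
  ultimately show ?thesis unfolding closed star by blast
qed

end
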